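(* Let $N\ge 2$ be an integer and $0<\alpha\leq 2$, with the case $N=\alpha=2$ excluded. Let $E\subset\mathbb{R}^N$ be a compact set with minimum $\alpha$-energy $W_\alpha(E)<\infty$ and $\alpha$-equilibrium measure $\mu_\alpha$. Let $m\geq 2$ and let $\nu_k$, $k=1,\ldots,m$, be positive compactly supported Borel measures on $\mathbb{R}^N$, normalized so that $\nu:=\sum_{k=1}^m\nu_k$ is a unit measure. Then $$\sum_{k=1}^m\inf_E U_\alpha^{\nu_k}\;\geq\; C_E(\alpha,m)+\inf_E\sum_{k=1}^m U_\alpha^{\nu_k},\qquad ( * )$$ where $$C_E(\alpha,m):=\min_{c_1,\ldots,c_m\in E}\int\min_{1\leq k\leq m}|x-c_k|^{\alpha-N}\,d\mu_\alpha(x)-W_\alpha(E),$$ and, for each $m\ge 2$, the constant $C_E(\alpha,m)$ cannot be replaced by a larger constant (i.e. for each fixed $m\ge2$ it is the largest constant for which $( * )$ holds for all such families $\nu_1,\dots,\nu_m$). Furthermore, $( * )$ holds with $C_E(\alpha,m)$ replaced by $$C_E(\alpha):=\int d_E(x)^{\alpha-N}\,d\mu_\alpha(x)-W_\alpha(E),$$ which does not depend on $m$.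
   Context: For a positive Borel measure $\mu$ on $\mathbb{R}^N$, its Riesz potential is $U_\alpha^\mu(x)=\int|x-t|^{\alpha-N}\,d\mu(t)$. For a compact set $E\subset\mathbb{R}^N$, $W_\alpha(E)$ is the minimum $\alpha$-energy of $E$, i.e. the minimum of $\int U_\alpha^\mu\,d\mu$ over all positive unit Borel measures $\mu$ supported on $E$. When $W_\alpha(E)<\infty$, the $\alpha$-equilibrium measure $\mu_\alpha$ of $E$ is the unique unit measure on $E$ attaining this minimum, so $W_\alpha(E)=\int U_\alpha^{\mu_\alpha}\,d\mu_\alpha$. The farthest distance function is $d_E(x):=\sup_{t\in E}|x-t|$, $x\in\mathbb{R}^N$. *)

theory Defs
  imports "HOL-Analysis.Analysis" "HOL-Probability.Probability"
begin

(* r^(alpha - N) on [0,\<infinity>).  The exponent is negative, so the value at 0 is infinite;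
   it has to be set explicitly because 0 powr a = 0 in HOL. *)
definition riesz_power :: "nat \<Rightarrow> real \<Rightarrow> real \<Rightarrow> ennreal" where
  "riesz_power N \<alpha> r = (if r = 0 then \<infinity> else ennreal (r powr (\<alpha> - real N)))"

definition riesz_potential :: "real \<Rightarrow> (real^'n) measure \<Rightarrow> real^'n \<Rightarrow> ennreal" where
  "riesz_potential \<alpha> \<mu> x = (\<integral>\<^sup>+ t. riesz_power CARD('n) \<alpha> (norm (x - t)) \<partial>\<mu>)"

definition riesz_energy :: "real \<Rightarrow> (real^'n) measure \<Rightarrow> ennreal" where
  "riesz_energy \<alpha> \<mu> = (\<integral>\<^sup>+ x. riesz_potential \<alpha> \<mu> x \<partial>\<mu>)"

definition borel_measure_on :: "(real^'n) set \<Rightarrow> (real^'n) measure \<Rightarrow> bool" where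
  "borel_measure_on S \<mu> \<longleftrightarrow> sets \<mu> = sets borel \<and> emeasure \<mu> (- S) = 0"

(* W_alpha(E).  The infimum is taken in [0,\<infinity>], hence is infinite if no unit measure on E has
   finite energy (in particular for empty E). *)
definition min_riesz_energy :: "real \<Rightarrow> (real^'n) set \<Rightarrow> ennreal" where
  "min_riesz_energy \<alpha> E = (INF \<mu> \<in> {\<mu>. borel_measure_on E \<mu> \<and> prob_space \<mu>}. riesz_energy \<alpha> \<mu>)"

definition equilibrium_measure :: "real \<Rightarrow> (real^'n) set \<Rightarrow> (real^'n) measure \<Rightarrow> bool" where
  "equilibrium_measure \<alpha> E \<mu> \<longleftrightarrow>
     borel_measure_on E \<mu> \<and> prob_space \<mu> \<and> riesz_energy \<alpha> \<mu> = min_riesz_energy \<alpha> E"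

definition farthest_dist :: "(real^'n) set \<Rightarrow> real^'n \<Rightarrow> real" where
  "farthest_dist E x = (SUP t\<in>E. norm (x - t))"

definition min_kernel_integral ::
    "real \<Rightarrow> (real^'n) measure \<Rightarrow> nat \<Rightarrow> (nat \<Rightarrow> real^'n) \<Rightarrow> ennreal" where
  "min_kernel_integral \<alpha> \<mu> m c =
     (\<integral>\<^sup>+ x. (MIN k\<in>{1..m}. riesz_power CARD('n) \<alpha> (norm (x - c k))) \<partial>\<mu>)"

(* C_E(alpha,m), where \<mu> is the equilibrium measure of E.  The constant is in general negative,
   so the difference is formed in the extended reals. *)
definition C_points :: "real \<Rightarrow> (real^'n) set \<Rightarrow> (real^'n) measure \<Rightarrow> nat \<Rightarrow> ereal" where
  "C_points \<alpha> E \<mu> m =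
     enn2ereal (INF c \<in> {1..m} \<rightarrow> E. min_kernel_integral \<alpha> \<mu> m c)
       - enn2ereal (min_riesz_energy \<alpha> E)"

(* C_E(alpha) *)
definition C_farthest :: "real \<Rightarrow> (real^'n) set \<Rightarrow> (real^'n) measure \<Rightarrow> ereal" where
  "C_farthest \<alpha> E \<mu> =
     enn2ereal (\<integral>\<^sup>+ x. riesz_power CARD('n) \<alpha> (farthest_dist E x) \<partial>\<mu>)
       - enn2ereal (min_riesz_energy \<alpha> E)"

(* Individual measures may be zero; the last conjunct says that their sum has total mass 1. *)
definition unit_sum_family :: "nat \<Rightarrow> (nat \<Rightarrow> (real^'n) measure) \<Rightarrow> bool" where
  "unit_sum_family m \<nu> \<longleftrightarrow>
     (\<forall>k\<in>{1..m}. \<exists>K. compact K \<and> borel_measure_on K (\<nu> k)) \<and>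
     (\<Sum>k=1..m. emeasure (\<nu> k) UNIV) = 1"

definition reverse_triangle ::
    "real \<Rightarrow> (real^'n) set \<Rightarrow> nat \<Rightarrow> (nat \<Rightarrow> (real^'n) measure) \<Rightarrow> ereal \<Rightarrow> bool" where
  "reverse_triangle \<alpha> E m \<nu> C \<longleftrightarrow>
     (\<Sum>k=1..m. enn2ereal (INF x\<in>E. riesz_potential \<alpha> (\<nu> k) x))
       \<ge> C + enn2ereal (INF x\<in>E. \<Sum>k=1..m. riesz_potential \<alpha> (\<nu> k) x)"

end

theory Submission
  imports Defs "HOL-Real_Asymp.Real_Asymp"
begin

text \<open>Write \<open>U M\<close> for the Riesz potential of \<open>M\<close> and \<open>W\<close> for the minimum energy. If \<open>c k \<in> E\<close> minimises the
  potential of \<open>\<nu> k\<close> on \<open>E\<close>, then the sum of the infima is at least \<open>\<integral>u d\<nu>\<close>, where \<open>u\<close> is the minimum of the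
  kernels centred at the \<open>c k\<close> and \<open>\<nu>\<close> is the sum of the \<open>\<nu> k\<close>. As \<open>\<alpha> \<le> 2\<close>, the kernel is excessive for a family
  of convolution operators \<open>p\<close> (Gaussians subordinated by the first jump of a stable subordinator over a small
  level), hence so is \<open>u\<close>, and \<open>u\<close> is a limit of potentials of charges of mass at most 1. With
  \<open>I = inf U \<nu>\<close> on \<open>E\<close>, a maximum principle for \<open>p\<close> first gives \<open>U \<mu> \<le> W\<close> and then \<open>U \<mu> \<le> U \<nu> + (W - I)\<close>
  everywhere; integrating against these charges yields \<open>\<integral>u d\<mu> \<le> \<integral>u d\<nu> + (W - I)\<close>.

  For sharpness one splits a measure close to \<open>\<mu>\<close>, whose potential is almost \<open>W\<close> at every point of \<open>E\<close>, along
  the cells on which the individual kernels are minimal.\<close>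

section \<open>Convolutions and Gaussians\<close>

text \<open>With \<beta> = \<alpha> / 2 the Riesz kernel k is a mixture of centred Gaussians of
  variance t with weight proportional to t^(\<beta> - 1), and \<alpha> \<le> 2 makes \<beta> the
  index of a stable subordinator (a pure drift for \<beta> = 1). The jump over a level \<epsilon> is
  used in place of the stable semigroup because its law is explicit, a generalised arcsine law, and
  because \<open>conv p k\<close> then just drops the variances up to \<epsilon> from the mixture.
  The loss \<open>g = k - conv p k\<close> is integrable, tiny away from the origin, and after
  normalisation an approximate identity. The second property localises the maximum principle; the
  third recovers u from \<open>conv g u\<close>, which is exactly the potential of the charge
  \<open>u - conv p u\<close>. The obstacle is that the inequality between potentials is first known
  on the support only, while g is small only at a positive distance from it. Hence the detour
  through restrictions of the measure whose potentials are uniformly approximated by truncated ones.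
  Subtraction in \<open>ennreal\<close> is truncated, so most inequalities are kept in additive
  form.\<close>

definition conv :: "('a::euclidean_space \<Rightarrow> ennreal) \<Rightarrow> ('a \<Rightarrow> ennreal) \<Rightarrow> 'a \<Rightarrow> ennreal" where
  "conv f h x = (\<integral>\<^sup>+ y. f y * h (x - y) \<partial>lborel)"

lemma borel_measurable_conv [measurable]:
  fixes f h :: "'a::euclidean_space \<Rightarrow> ennreal"
  assumes [measurable]: "f \<in> borel_measurable borel" "h \<in> borel_measurable borel"
  shows "conv f h \<in> borel_measurable borel"
  unfolding conv_def by measurable

lemma nn_integral_lborel_shift:
  fixes f :: "'a::euclidean_space \<Rightarrow> ennreal"
  assumes [measurable]: "f \<in> borel_measurable borel"
  shows "(\<integral>\<^sup>+ x. f (a + x) \<partial>lborel) = (\<integral>\<^sup>+ x. f x \<partial>lborel)"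
proof -
  have "(\<integral>\<^sup>+ x. f x \<partial>distr lborel borel ((+) a)) = (\<integral>\<^sup>+ x. f (a + x) \<partial>lborel)"
    by (subst nn_integral_distr) auto
  then show ?thesis by (simp add: lborel_distr_plus)
qed

lemma nn_integral_lborel_scale:
  fixes f :: "'a::euclidean_space \<Rightarrow> ennreal"
  assumes [measurable]: "f \<in> borel_measurable borel" and "c \<noteq> 0"
  shows "(\<integral>\<^sup>+ x. f x \<partial>lborel) = ennreal (\<bar>c\<bar> ^ DIM('a)) * (\<integral>\<^sup>+ x. f (c *\<^sub>R x) \<partial>lborel)"
  by (subst lborel_affine[OF \<open>c \<noteq> 0\<close>, of 0])
    (simp add: nn_integral_density nn_integral_distr nn_integral_cmult)

lemma nn_integral_lborel_reflect:
  fixes f :: "'a::euclidean_space \<Rightarrow> ennreal"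
  assumes [measurable]: "f \<in> borel_measurable borel"
  shows "(\<integral>\<^sup>+ x. f (a - x) \<partial>lborel) = (\<integral>\<^sup>+ x. f x \<partial>lborel)"
proof -
  have "(\<integral>\<^sup>+ x. f x \<partial>lborel) = (\<integral>\<^sup>+ x. f (- x) \<partial>lborel)"
    by (subst nn_integral_lborel_scale[of f "-1"]) auto
  also have "\<dots> = (\<integral>\<^sup>+ x. f (- (- a + x)) \<partial>lborel)"
    by (rule nn_integral_lborel_shift[symmetric]) simp
  finally show ?thesis by (simp add: algebra_simps)
qed

lemma conv_commute:
  fixes f h :: "'a::euclidean_space \<Rightarrow> ennreal"
  assumes [measurable]: "f \<in> borel_measurable borel" "h \<in> borel_measurable borel"
  shows "conv f h = conv h f"
proof
  fix x
  have "conv f h x = (\<integral>\<^sup>+ y. f (x - y) * h (x - (x - y)) \<partial>lborel)"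
    unfolding conv_def by (rule nn_integral_lborel_reflect[symmetric]) simp
  then show "conv f h x = conv h f x" by (simp add: conv_def mult.commute)
qed

lemma conv_assoc:
  fixes f h l :: "'a::euclidean_space \<Rightarrow> ennreal"
  assumes [measurable]: "f \<in> borel_measurable borel" "h \<in> borel_measurable borel"
    "l \<in> borel_measurable borel"
  shows "conv (conv f h) l = conv f (conv h l)"
proof
  fix x
  have "conv (conv f h) l x = conv l (conv f h) x"
    by (subst conv_commute) auto
  also have "\<dots> = (\<integral>\<^sup>+ z. \<integral>\<^sup>+ y. l z * (f y * h (x - z - y)) \<partial>lborel \<partial>lborel)"
    by (simp add: conv_def nn_integral_cmult)
  also have "\<dots> = (\<integral>\<^sup>+ y. \<integral>\<^sup>+ z. l z * (f y * h (x - z - y)) \<partial>lborel \<partial>lborel)"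
    by (rule lborel_pair.Fubini') simp
  also have "\<dots> = (\<integral>\<^sup>+ y. f y * conv l h (x - y) \<partial>lborel)"
    by (simp add: conv_def nn_integral_cmult[symmetric] mult.left_commute diff_diff_eq add.commute)
  also have "\<dots> = conv f (conv h l) x"
    by (subst conv_commute[of l h]) (auto simp: conv_def)
  finally show "conv (conv f h) l x = conv f (conv h l) x" .
qed

lemma conv_mono:
  assumes "\<And>x. f x \<le> f' x" "\<And>x. h x \<le> h' x"
  shows "conv f h x \<le> conv f' h' x"
  unfolding conv_def by (intro nn_integral_mono mult_mono assms) auto

lemma conv_add_left:
  fixes f h :: "'a::euclidean_space \<Rightarrow> ennreal"
  assumes [measurable]: "f \<in> borel_measurable borel" "f' \<in> borel_measurable borel"
    "h \<in> borel_measurable borel"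
  shows "conv (\<lambda>x. f x + f' x) h x = conv f h x + conv f' h x"
  unfolding conv_def by (simp add: distrib_right nn_integral_add)

lemma conv_add_right:
  fixes f h :: "'a::euclidean_space \<Rightarrow> ennreal"
  assumes [measurable]: "f \<in> borel_measurable borel" "h \<in> borel_measurable borel"
    "h' \<in> borel_measurable borel"
  shows "conv f (\<lambda>x. h x + h' x) x = conv f h x + conv f h' x"
  unfolding conv_def by (simp add: distrib_left nn_integral_add)

lemma conv_const_right:
  fixes f :: "'a::euclidean_space \<Rightarrow> ennreal"
  assumes [measurable]: "f \<in> borel_measurable borel"
  shows "conv f (\<lambda>_. c) x = (\<integral>\<^sup>+ y. f y \<partial>lborel) * c"
  unfolding conv_def by (simp add: nn_integral_multc)

section \<open>Gaussian densities\<close>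

definition gauss :: "real \<Rightarrow> 'a::euclidean_space \<Rightarrow> ennreal" where
  "gauss t x = ennreal ((2 * pi * t) powr (- (real DIM('a) / 2)) * exp (- (norm x)\<^sup>2 / (2 * t)))"

lemma borel_measurable_gauss [measurable (raw)]:
  assumes [measurable]: "f \<in> borel_measurable M" "h \<in> borel_measurable M"
  shows "(\<lambda>x. gauss (f x) (h x :: 'a::euclidean_space)) \<in> borel_measurable M"
  unfolding gauss_def by measurable

text \<open>The factorisation brings in the one-dimensional facts on \<open>normal_density\<close>:
  total mass and convolution follow coordinate by coordinate. The parameter t is the variance per
  coordinate, so that parameters add under convolution.\<close>

lemma gauss_eq_prod:
  fixes x :: "'a::euclidean_space"
  assumes "0 < t"
  shows "gauss t x = (\<Prod>b\<in>Basis. ennreal (normal_density 0 (sqrt t) (x \<bullet> b)))"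
proof -
  have "(\<Prod>b\<in>Basis. ennreal (normal_density 0 (sqrt t) (x \<bullet> b)))
    = ennreal (\<Prod>b\<in>(Basis::'a set). 1 / sqrt (2 * pi * t) * exp (- (x \<bullet> b)\<^sup>2 / (2 * t)))"
    using assms by (subst prod_ennreal) (auto simp: normal_density_def)
  also have "(\<Prod>b\<in>(Basis::'a set). 1 / sqrt (2 * pi * t) * exp (- (x \<bullet> b)\<^sup>2 / (2 * t)))
    = (1 / sqrt (2 * pi * t)) ^ DIM('a) * exp (\<Sum>b\<in>Basis. - (x \<bullet> b)\<^sup>2 / (2 * t))"
    by (simp add: prod.distrib exp_sum power_one_over power_divide prod_dividef)
  also have "(\<Sum>b\<in>Basis. - (x \<bullet> b)\<^sup>2 / (2 * t)) = - (norm x)\<^sup>2 / (2 * t)"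
    by (simp add: norm_eq_sqrt_inner euclidean_inner[of x x] power2_eq_square sum_nonneg
        sum_divide_distrib[symmetric] sum_negf)
  also have "(1 / sqrt (2 * pi * t)) ^ DIM('a) = (2 * pi * t) powr (- (real DIM('a) / 2))"
  proof -
    have "1 / sqrt (2 * pi * t) = (2 * pi * t) powr (- (1/2))"
      using assms by (subst powr_minus, subst powr_half_sqrt) (auto simp: inverse_eq_divide)
    moreover have "((2 * pi * t) powr (- (1/2))) ^ DIM('a) = (2 * pi * t) powr (- (1/2) * real DIM('a))"
      using assms by (subst powr_powr[symmetric], subst powr_realpow) auto
    ultimately show ?thesis by simp
  qed
  finally show ?thesis by (simp add: gauss_def)
qed

lemma nn_integral_normal_density_real:
  "0 < \<sigma> \<Longrightarrow> (\<integral>\<^sup>+ x. ennreal (normal_density m \<sigma> x) \<partial>lborel) = 1"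
  by (subst nn_integral_eq_integral) auto

lemma nn_integral_gauss:
  assumes "0 < t"
  shows "(\<integral>\<^sup>+ x. gauss t (x::'a::euclidean_space) \<partial>lborel) = 1"
  using assms by (simp add: gauss_eq_prod nn_integral_normal_density_real
      nn_integral_lborel_prod[where f="\<lambda>_ y. ennreal (normal_density 0 (sqrt t) y)"])

lemma conv_gauss:
  assumes "0 < s" "0 < t"
  shows "conv (gauss s) (gauss t) (x::'a::euclidean_space) = gauss (s + t) x"
proof -
  have "conv (gauss t) (gauss s) x
    = (\<integral>\<^sup>+ y. (\<Prod>b\<in>Basis. ennreal (normal_density 0 (sqrt s) (x \<bullet> b - y \<bullet> b) * normal_density 0 (sqrt t) (y \<bullet> b))) \<partial>lborel)"
    using assms by (simp add: conv_def gauss_eq_prod prod.distrib[symmetric] ennreal_mult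
        inner_diff_left mult.commute)
  also have "\<dots> = (\<Prod>b\<in>Basis. ennreal (normal_density 0 (sqrt (s + t)) (x \<bullet> b)))"
    using assms fun_cong[OF conv_normal_density_zero_mean[of "sqrt s" "sqrt t"]]
    by (subst nn_integral_lborel_prod[where f="\<lambda>b y. ennreal (normal_density 0 (sqrt s) (x \<bullet> b - y) * normal_density 0 (sqrt t) y)"]) auto
  finally show ?thesis using assms
    by (subst conv_commute) (auto simp: gauss_eq_prod)
qed

lemma gauss_minus: "gauss t (- x) = gauss t x"
  by (simp add: gauss_def)

text \<open>Brownian scaling. It gives the homogeneity of the mixture in
  \<open>gmix_power_weight_norm\<close> and the change of variables in
  \<open>conv_gauss_tendsto\<close>.\<close>

lemma gauss_scaleR:
  fixes x :: "'a::euclidean_space"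
  assumes "0 < r" "0 < t"
  shows "gauss (r\<^sup>2 * t) (r *\<^sub>R x) = ennreal (r powr (- real DIM('a))) * gauss t x"
proof -
  have "(2 * pi * (r\<^sup>2 * t)) powr (- (real DIM('a) / 2)) = (r\<^sup>2 * (2 * pi * t)) powr (- (real DIM('a) / 2))"
    by (simp add: ac_simps)
  also have "\<dots> = r powr (- real DIM('a)) * (2 * pi * t) powr (- (real DIM('a) / 2))"
  proof -
    have "r\<^sup>2 = r powr 2"
      using assms by (simp add: powr_numeral)
    then have "(r\<^sup>2) powr (- (real DIM('a) / 2)) = r powr (- real DIM('a))"
      by (simp only: powr_powr) simp
    then show ?thesis using assms by (subst powr_mult) auto
  qed
  finally have 1: "(2 * pi * (r\<^sup>2 * t)) powr (- (real DIM('a) / 2)) = r powr (- real DIM('a)) * (2 * pi * t) powr (- (real DIM('a) / 2))" .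
  have 2: "(norm (r *\<^sub>R x))\<^sup>2 / (2 * (r\<^sup>2 * t)) = (norm x)\<^sup>2 / (2 * t)"
    using assms by (simp add: power_mult_distrib field_simps)
  show ?thesis
    unfolding gauss_def using 1 2 by (simp add: ennreal_mult[symmetric] mult.assoc)
qed

section \<open>Subordination\<close>

lemma nn_integral_beta_kernel:
  fixes \<beta> :: real
  assumes "0 < \<beta>" "\<beta> < 1"
  shows "(\<integral>\<^sup>+ z. indicator {0<..<1} z * ennreal (z powr (\<beta> - 1) * (1 - z) powr (- \<beta>)) \<partial>lborel)
    = ennreal (Beta \<beta> (1 - \<beta>))"
proof -
  have "((\<lambda>z. z powr (\<beta> - 1) * (1 - z) powr ((1 - \<beta>) - 1)) has_integral Beta \<beta> (1 - \<beta>)) {0<..<1}"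
    using has_integral_Beta_real[of \<beta> "1 - \<beta>"] assms by (simp add: has_integral_Icc_iff_Ioo)
  then have "integral\<^sup>N lborel (\<lambda>z. indicator {0<..<1} z * (z powr (\<beta> - 1) * (1 - z) powr ((1 - \<beta>) - 1)))
    = ennreal (Beta \<beta> (1 - \<beta>))"
    by (intro nn_integral_has_integral_lebesgue) auto
  then show ?thesis by (simp add: ennreal_mult' ennreal_indicator)
qed

text \<open>Under z = a + (1 - a) z' the exponents \<beta> - 1 and - \<beta> add up to - 1 and
  cancel the Jacobian 1 - a. That the value does not depend on a is the renewal equation of
  \<open>stable_overshoot_law\<close>.\<close>

lemma nn_integral_beta_kernel_shift:
  fixes \<beta> a :: real
  assumes "0 < \<beta>" "\<beta> < 1" "0 \<le> a" "a < 1"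
  shows "(\<integral>\<^sup>+ z. indicator {a<..<1} z * ennreal ((z - a) powr (\<beta> - 1) * (1 - z) powr (- \<beta>)) \<partial>lborel)
    = ennreal (Beta \<beta> (1 - \<beta>))"
proof -
  have eq: "ennreal \<bar>1 - a\<bar> * (indicator {a<..<1} (a + (1 - a) * z)
      * ennreal ((a + (1 - a) * z - a) powr (\<beta> - 1) * (1 - (a + (1 - a) * z)) powr (- \<beta>)))
    = indicator {0<..<1} z * ennreal (z powr (\<beta> - 1) * (1 - z) powr (- \<beta>))" for z
  proof (cases "0 < z \<and> z < 1")
    case True
    have 1: "1 - (a + (1 - a) * z) = (1 - a) * (1 - z)" by (simp add: algebra_simps)
    have 2: "(1 - a) * ((1 - a) powr (\<beta> - 1) * (1 - a) powr (- \<beta>)) = 1"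
    proof -
      have "(1 - a) * ((1 - a) powr (\<beta> - 1) * (1 - a) powr (- \<beta>)) = (1 - a) * (1 - a) powr - 1"
        by (simp only: powr_add[symmetric]) simp
      then show ?thesis using assms by (simp add: powr_minus)
    qed
    have "a + (1 - a) * z \<in> {a<..<1}"
      using True assms 1 mult_pos_pos[of "1 - a" "1 - z"] by (auto simp: algebra_simps)
    moreover have "((1 - a) * z) powr (\<beta> - 1) * ((1 - a) * (1 - z)) powr (- \<beta>)
      = ((1 - a) powr (\<beta> - 1) * (1 - a) powr (- \<beta>)) * (z powr (\<beta> - 1) * (1 - z) powr (- \<beta>))"
      using True assms by (simp add: powr_mult)
    ultimately show ?thesis using True assms 2
      unfolding 1 by (simp add: ennreal_mult[symmetric] mult.assoc[symmetric])
  next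
    case False
    have "a + (1 - a) * z \<notin> {a<..<1}"
    proof
      assume "a + (1 - a) * z \<in> {a<..<1}"
      then have "0 < (1 - a) * z" "(1 - a) * z < (1 - a) * 1" by (auto simp: algebra_simps)
      then show False using assms False by (auto simp: zero_less_mult_iff)
    qed
    then show ?thesis using False by auto
  qed
  have "(\<integral>\<^sup>+ z. indicator {a<..<1} z * ennreal ((z - a) powr (\<beta> - 1) * (1 - z) powr (- \<beta>)) \<partial>lborel)
    = (\<integral>\<^sup>+ z. indicator {0<..<1} z * ennreal (z powr (\<beta> - 1) * (1 - z) powr (- \<beta>)) \<partial>lborel)"
    unfolding eq[symmetric] using assms
    by (subst nn_integral_real_affine[where c = "1 - a" and t = a]) (simp_all add: nn_integral_cmult)
  then show ?thesis using assms by (simp add: nn_integral_beta_kernel)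
qed

text \<open>\<open>\<epsilon> / Q\<close> with \<open>Q\<close> distributed according to \<open>\<kappa>\<close> is the law of the first jump of a stable
  subordinator over the level \<open>\<epsilon>\<close>; the last equation is the renewal property at that jump.\<close>

lemma stable_overshoot_law:
  fixes \<beta> :: real
  assumes "0 < \<beta>" "\<beta> \<le> 1"
  obtains \<kappa> :: "real measure" where "prob_space \<kappa>" "sets \<kappa> = sets borel"
    "AE q in \<kappa>. 0 < q \<and> q \<le> 1"
    "\<And>a. 0 < a \<Longrightarrow> a < 1 \<Longrightarrow> (\<integral>\<^sup>+ q. indicator {a<..} q * ennreal ((1 - a / q) powr (\<beta> - 1)) \<partial>\<kappa>) = 1"
proof (cases "\<beta> = 1")
  \<comment> \<open>For \<beta> = 1 the subordinator is a drift and passes the level \<epsilon> at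
    \<epsilon> itself, so Q = 1.\<close>
  case True
  show ?thesis
  proof (rule that)
    show "prob_space (return borel (1::real))" by (rule prob_space_return) simp
    show "AE q in return borel (1::real). 0 < q \<and> q \<le> 1" by (simp add: AE_return)
  qed (auto simp: nn_integral_return True)
next
  case False
  then have \<beta>: "0 < \<beta>" "\<beta> < 1" using assms by auto
  define B where "B = Beta \<beta> (1 - \<beta>)"
  have "B > 0" using \<beta> unfolding B_def Beta_def by (auto intro!: divide_pos_pos mult_pos_pos Gamma_real_pos)
  \<comment> \<open>The generalised arcsine density. Multiplied by (1 - a / q)^(\<beta> - 1) it
    becomes the shifted beta integrand, because q (1 - a / q) = q - a.\<close>
  define d where "d = (\<lambda>z::real. ennreal (1 / B) * (indicator {0<..<1} z * ennreal (z powr (\<beta> - 1) * (1 - z) powr (- \<beta>))))"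
  have [measurable]: "d \<in> borel_measurable borel" unfolding d_def by measurable
  show ?thesis
  proof (rule that)
    show "prob_space (density lborel d)"
    proof
      show "emeasure (density lborel d) (space (density lborel d)) = 1"
        using \<open>B > 0\<close> nn_integral_beta_kernel[OF \<beta>]
        by (simp add: emeasure_density d_def nn_integral_cmult B_def[symmetric] ennreal_mult[symmetric])
    qed
    show "sets (density lborel d) = sets borel" by simp
    show "AE q in density lborel d. 0 < q \<and> q \<le> 1"
      by (subst AE_density) (auto simp: d_def split: split_indicator_asm)
    fix a :: real assume a: "0 < a" "a < 1"
    have eq: "d q * (indicator {a<..} q * ennreal ((1 - a / q) powr (\<beta> - 1)))
      = ennreal (1 / B) * (indicator {a<..<1} q * ennreal ((q - a) powr (\<beta> - 1) * (1 - q) powr (- \<beta>)))" for q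
    proof (cases "a < q \<and> q < 1")
      case True
      then have "q powr (\<beta> - 1) * (1 - a / q) powr (\<beta> - 1) = (q - a) powr (\<beta> - 1)"
        using a by (subst powr_mult[symmetric]) (auto simp: right_diff_distrib)
      then show ?thesis using True a \<open>B > 0\<close>
        by (simp add: d_def ennreal_mult[symmetric] mult_ac)
    qed (use a in \<open>auto simp: d_def\<close>)
    show "(\<integral>\<^sup>+ q. indicator {a<..} q * ennreal ((1 - a / q) powr (\<beta> - 1)) \<partial>density lborel d) = 1"
      using \<open>B > 0\<close> a nn_integral_beta_kernel_shift[OF \<beta>, of a]
      by (subst nn_integral_density) (simp_all add: eq nn_integral_cmult B_def[symmetric] ennreal_mult[symmetric])
  qed
qed

section \<open>Gaussian mixtures and subordinated steps\<close>

definition gmix :: "(real \<Rightarrow> ennreal) \<Rightarrow> 'a::euclidean_space \<Rightarrow> ennreal" where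
  "gmix w x = (\<integral>\<^sup>+ t. w t * gauss t x \<partial>lborel)"

definition power_weight :: "real \<Rightarrow> real \<Rightarrow> real \<Rightarrow> real \<Rightarrow> ennreal" where
  "power_weight c \<beta> T t = indicator {T<..} t * ennreal (c * t powr (\<beta> - 1))"

text \<open>For the overshoot law \<kappa> this is the density of Brownian motion at the random time
  \<epsilon> / q, that is, of the stable process right after its subordinator has passed
  \<epsilon>.\<close>

definition scaled_gauss :: "real measure \<Rightarrow> real \<Rightarrow> 'a::euclidean_space \<Rightarrow> ennreal" where
  "scaled_gauss \<kappa> \<epsilon> x = (\<integral>\<^sup>+ q. gauss (\<epsilon> / q) x \<partial>\<kappa>)"

lemma borel_measurable_power_weight [measurable (raw)]:
  assumes [measurable]: "f \<in> borel_measurable M"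
  shows "(\<lambda>x. power_weight c \<beta> T (f x)) \<in> borel_measurable M"
  unfolding power_weight_def by measurable

lemma borel_measurable_gmix [measurable]:
  assumes [measurable]: "w \<in> borel_measurable borel"
  shows "gmix w \<in> borel_measurable borel"
  unfolding gmix_def by measurable

lemma gmix_add:
  assumes [measurable]: "w \<in> borel_measurable borel" "w' \<in> borel_measurable borel"
  shows "gmix (\<lambda>t. w t + w' t) x = gmix w x + gmix w' x"
  unfolding gmix_def by (simp add: distrib_right nn_integral_add)

lemma gauss_le_0:
  fixes x :: "'a::euclidean_space"
  assumes "0 < t"
  shows "gauss t x \<le> gauss t (0::'a)"
  unfolding gauss_def using assms by (intro ennreal_leI mult_left_mono) auto

text \<open>\<open>gauss t\<close> is a Gaussian density only for t > 0; hence the recurring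
  hypothesis that the weight vanishes on the nonpositive half-line.\<close>

lemma gmix_le_0:
  fixes x :: "'a::euclidean_space"
  assumes "\<And>t. t \<le> 0 \<Longrightarrow> w t = 0"
  shows "gmix w x \<le> gmix w (0::'a)"
  unfolding gmix_def
  by (intro nn_integral_mono) (metis assms gauss_le_0 linorder_not_le mult_left_mono mult_zero_left order_refl zero_le)

lemma conv_gmix:
  fixes x :: "'a::euclidean_space"
  assumes [measurable]: "w \<in> borel_measurable borel" "f \<in> borel_measurable borel"
  shows "conv (gmix w) f x = (\<integral>\<^sup>+ t. w t * conv (gauss t) f x \<partial>lborel)"
proof -
  have "conv (gmix w) f x = (\<integral>\<^sup>+ y. \<integral>\<^sup>+ t. w t * (gauss t y * f (x - y)) \<partial>lborel \<partial>lborel)"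
    unfolding conv_def gmix_def by (simp add: nn_integral_multc[symmetric] mult.assoc)
  also have "\<dots> = (\<integral>\<^sup>+ t. \<integral>\<^sup>+ y. w t * (gauss t y * f (x - y)) \<partial>lborel \<partial>lborel)"
    by (rule lborel_pair.Fubini') simp
  also have "\<dots> = (\<integral>\<^sup>+ t. w t * conv (gauss t) f x \<partial>lborel)"
    unfolding conv_def by (simp add: nn_integral_cmult)
  finally show ?thesis .
qed

lemma nn_integral_gmix:
  assumes [measurable]: "w \<in> borel_measurable borel" and w: "\<And>t. t \<le> 0 \<Longrightarrow> w t = 0"
  shows "(\<integral>\<^sup>+ x. gmix w (x::'a::euclidean_space) \<partial>lborel) = (\<integral>\<^sup>+ t. w t \<partial>lborel)"
proof -
  have "(\<integral>\<^sup>+ x. gmix w (x::'a) \<partial>lborel) = (\<integral>\<^sup>+ t. \<integral>\<^sup>+ x. w t * gauss t (x::'a) \<partial>lborel \<partial>lborel)"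
    unfolding gmix_def by (rule lborel_pair.Fubini') simp
  also have "\<dots> = (\<integral>\<^sup>+ t. w t \<partial>lborel)"
  proof (rule nn_integral_cong)
    fix t show "(\<integral>\<^sup>+ x. w t * gauss t (x::'a) \<partial>lborel) = w t"
      using w[of t] by (cases "0 < t") (auto simp: nn_integral_cmult nn_integral_gauss)
  qed
  finally show ?thesis .
qed

lemma conv_gauss_gmix:
  fixes x :: "'a::euclidean_space"
  assumes [measurable]: "w \<in> borel_measurable borel" and w: "\<And>t. t \<le> 0 \<Longrightarrow> w t = 0" and "0 < s"
  shows "conv (gauss s) (gmix w) x = gmix (\<lambda>t. w (t - s)) x"
proof -
  have "conv (gauss s) (gmix w) x = (\<integral>\<^sup>+ t. w t * conv (gauss t) (gauss s) x \<partial>lborel)"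
    by (subst conv_commute) (auto simp: conv_gmix)
  also have "\<dots> = (\<integral>\<^sup>+ t. w t * gauss (s + t) x \<partial>lborel)"
  proof (rule nn_integral_cong)
    fix t show "w t * conv (gauss t) (gauss s) x = w t * gauss (s + t) x"
      using w[of t] \<open>0 < s\<close> by (cases "0 < t") (auto simp: conv_gauss add.commute)
  qed
  also have "\<dots> = (\<integral>\<^sup>+ t. w (s + t - s) * gauss (s + t) x \<partial>lborel)" by simp
  also have "\<dots> = gmix (\<lambda>t. w (t - s)) x"
    unfolding gmix_def by (rule nn_integral_lborel_shift) simp
  finally show ?thesis .
qed

lemma scaled_gauss_facts:
  fixes x :: "'a::euclidean_space"
  assumes \<kappa>: "prob_space \<kappa>" "sets \<kappa> = sets borel" "AE q in \<kappa>. 0 < q \<and> q \<le> 1" and "0 < \<epsilon>"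
  shows borel_measurable_scaled_gauss: "(scaled_gauss \<kappa> \<epsilon> :: 'a \<Rightarrow> ennreal) \<in> borel_measurable borel"
    and nn_integral_scaled_gauss: "(\<integral>\<^sup>+ x. scaled_gauss \<kappa> \<epsilon> (x::'a) \<partial>lborel) = 1"
    and conv_scaled_gauss_gmix: "\<And>w. w \<in> borel_measurable borel \<Longrightarrow> (\<And>t. t \<le> 0 \<Longrightarrow> w t = 0) \<Longrightarrow>
      conv (scaled_gauss \<kappa> \<epsilon>) (gmix w) x = gmix (\<lambda>t. \<integral>\<^sup>+ q. w (t - \<epsilon> / q) \<partial>\<kappa>) x"
proof -
  interpret \<kappa>: prob_space \<kappa> by fact
  note [measurable_cong] = \<kappa>(2)
  interpret L: pair_sigma_finite \<kappa> "lborel :: 'a measure" ..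
  interpret R: pair_sigma_finite \<kappa> "lborel :: real measure" ..
  have pos: "AE q in \<kappa>. 0 < \<epsilon> / q" using \<kappa>(3) by eventually_elim (use \<open>0 < \<epsilon>\<close> in auto)
  show 1[measurable]: "(scaled_gauss \<kappa> \<epsilon> :: 'a \<Rightarrow> ennreal) \<in> borel_measurable borel"
    unfolding scaled_gauss_def by measurable
  have "(\<integral>\<^sup>+ x. scaled_gauss \<kappa> \<epsilon> (x::'a) \<partial>lborel) = (\<integral>\<^sup>+ q. \<integral>\<^sup>+ x. gauss (\<epsilon> / q) (x::'a) \<partial>lborel \<partial>\<kappa>)"
    unfolding scaled_gauss_def by (rule L.Fubini') simp
  also have "\<dots> = (\<integral>\<^sup>+ q. 1 \<partial>\<kappa>)"
    by (rule nn_integral_cong_AE) (use pos in eventually_elim, simp add: nn_integral_gauss)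
  finally show "(\<integral>\<^sup>+ x. scaled_gauss \<kappa> \<epsilon> (x::'a) \<partial>lborel) = 1" by (simp add: \<kappa>.emeasure_space_1)
  fix w :: "real \<Rightarrow> ennreal" assume w[measurable]: "w \<in> borel_measurable borel" and w0: "\<And>t. t \<le> 0 \<Longrightarrow> w t = 0"
  have "conv (scaled_gauss \<kappa> \<epsilon>) (gmix w) x
    = (\<integral>\<^sup>+ y. \<integral>\<^sup>+ q. gauss (\<epsilon> / q) y * gmix w (x - y) \<partial>\<kappa> \<partial>lborel)"
    unfolding conv_def scaled_gauss_def by (simp add: nn_integral_multc)
  also have "\<dots> = (\<integral>\<^sup>+ q. conv (gauss (\<epsilon> / q)) (gmix w) x \<partial>\<kappa>)"
    unfolding conv_def by (rule L.Fubini') simp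
  also have "\<dots> = (\<integral>\<^sup>+ q. gmix (\<lambda>t. w (t - \<epsilon> / q)) x \<partial>\<kappa>)"
    by (rule nn_integral_cong_AE) (use pos in eventually_elim, simp add: conv_gauss_gmix w0)
  also have "\<dots> = (\<integral>\<^sup>+ t. \<integral>\<^sup>+ q. w (t - \<epsilon> / q) * gauss t x \<partial>\<kappa> \<partial>lborel)"
    unfolding gmix_def by (rule R.Fubini'[symmetric]) simp
  also have "\<dots> = gmix (\<lambda>t. \<integral>\<^sup>+ q. w (t - \<epsilon> / q) \<partial>\<kappa>) x"
    unfolding gmix_def by (simp add: nn_integral_multc)
  finally show "conv (scaled_gauss \<kappa> \<epsilon>) (gmix w) x = gmix (\<lambda>t. \<integral>\<^sup>+ q. w (t - \<epsilon> / q) \<partial>\<kappa>) x" .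
qed

text \<open>Up to a constant, \<open>power_weight c \<beta> 0\<close> is the potential density of
  the subordinator. What it visits after passing \<epsilon> is exactly the part above \<epsilon>,
  hence the equality. For general T an upper bound suffices, as it only serves to bound the iterates
  of a step: the jump shifts by \<epsilon> / q \<ge> \<epsilon>, so nothing remains below T +
  \<epsilon>.\<close>

lemma stable_overshoot_power_weight:
  assumes \<kappa>: "prob_space \<kappa>" "sets \<kappa> = sets borel" "AE q in \<kappa>. 0 < q \<and> q \<le> 1"
    and ren: "\<And>a. 0 < a \<Longrightarrow> a < 1 \<Longrightarrow> (\<integral>\<^sup>+ q. indicator {a<..} q * ennreal ((1 - a / q) powr (\<beta> - 1)) \<partial>\<kappa>) = 1"
    and "0 < \<epsilon>" "0 \<le> T" "0 \<le> c"
  shows stable_overshoot_power_weight_0: "t \<noteq> \<epsilon> \<Longrightarrow> (\<integral>\<^sup>+ q. power_weight c \<beta> 0 (t - \<epsilon> / q) \<partial>\<kappa>) = power_weight c \<beta> \<epsilon> t"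
    and stable_overshoot_power_weight_le: "t \<noteq> \<epsilon> \<Longrightarrow> (\<integral>\<^sup>+ q. power_weight c \<beta> T (t - \<epsilon> / q) \<partial>\<kappa>) \<le> power_weight c \<beta> (T + \<epsilon>) t"
proof -
  interpret \<kappa>: prob_space \<kappa> by fact
  note [measurable_cong] = \<kappa>(2)
  have ge: "AE q in \<kappa>. 0 < q \<and> \<epsilon> \<le> \<epsilon> / q" using \<kappa>(3)
    by eventually_elim (use \<open>0 < \<epsilon>\<close> in \<open>auto simp: field_simps\<close>)
  have zero: "(\<integral>\<^sup>+ q. power_weight c \<beta> T (t - \<epsilon> / q) \<partial>\<kappa>) = 0" if "t \<le> T + \<epsilon>" for t T
  proof -
    have "(\<integral>\<^sup>+ q. power_weight c \<beta> T (t - \<epsilon> / q) \<partial>\<kappa>) = (\<integral>\<^sup>+ q. 0 \<partial>\<kappa>)"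
      by (rule nn_integral_cong_AE) (use ge in eventually_elim, use that in \<open>auto simp: power_weight_def split: split_indicator\<close>)
    then show ?thesis by simp
  qed
  show 0: "(\<integral>\<^sup>+ q. power_weight c \<beta> 0 (t - \<epsilon> / q) \<partial>\<kappa>) = power_weight c \<beta> \<epsilon> t" if "t \<noteq> \<epsilon>" for t
  proof (cases "\<epsilon> < t")
    case True
    have "(\<integral>\<^sup>+ q. power_weight c \<beta> 0 (t - \<epsilon> / q) \<partial>\<kappa>)
      = (\<integral>\<^sup>+ q. ennreal (c * t powr (\<beta> - 1)) * (indicator {\<epsilon> / t<..} q * ennreal ((1 - (\<epsilon> / t) / q) powr (\<beta> - 1))) \<partial>\<kappa>)"
    proof (rule nn_integral_cong_AE, use ge in eventually_elim)
      fix q assume q: "0 < q \<and> \<epsilon> \<le> \<epsilon> / q"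
      \<comment> \<open>Factoring out t leads to the renewal equation at a = \<epsilon> / t.\<close>
      have "t - \<epsilon> / q = t * (1 - (\<epsilon> / t) / q)" using True \<open>0 < \<epsilon>\<close> by (simp add: field_simps)
      moreover have "0 < t - \<epsilon> / q \<longleftrightarrow> \<epsilon> / t < q" using q True \<open>0 < \<epsilon>\<close> by (simp add: field_simps)
      ultimately show "power_weight c \<beta> 0 (t - \<epsilon> / q) = ennreal (c * t powr (\<beta> - 1)) *
          (indicator {\<epsilon> / t<..} q * ennreal ((1 - (\<epsilon> / t) / q) powr (\<beta> - 1)))"
        using True \<open>0 < \<epsilon>\<close> \<open>0 \<le> c\<close>
        by (auto simp: power_weight_def powr_mult zero_less_mult_iff ennreal_mult[symmetric] mult_ac split: split_indicator)
    qed
    also have "\<dots> = ennreal (c * t powr (\<beta> - 1))"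
      using True \<open>0 < \<epsilon>\<close> ren[of "\<epsilon> / t"] by (subst nn_integral_cmult) auto
    finally show ?thesis using True by (simp add: power_weight_def)
  next
    case False
    then show ?thesis using zero[of t 0] by (simp add: power_weight_def)
  qed
  show "(\<integral>\<^sup>+ q. power_weight c \<beta> T (t - \<epsilon> / q) \<partial>\<kappa>) \<le> power_weight c \<beta> (T + \<epsilon>) t" if "t \<noteq> \<epsilon>" for t
  proof (cases "T + \<epsilon> < t")
    case True
    have "(\<integral>\<^sup>+ q. power_weight c \<beta> T (t - \<epsilon> / q) \<partial>\<kappa>) \<le> (\<integral>\<^sup>+ q. power_weight c \<beta> 0 (t - \<epsilon> / q) \<partial>\<kappa>)"
      using \<open>0 \<le> T\<close> by (intro nn_integral_mono) (auto simp: power_weight_def split: split_indicator)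
    also have "\<dots> = power_weight c \<beta> (T + \<epsilon>) t"
      using 0[OF that] True \<open>0 \<le> T\<close> by (simp add: power_weight_def)
    finally show ?thesis .
  qed (use zero[of t T] in simp)
qed

lemma conv_scaled_gauss_power_weight:
  fixes x :: "'a::euclidean_space"
  assumes \<kappa>: "prob_space \<kappa>" "sets \<kappa> = sets borel" "AE q in \<kappa>. 0 < q \<and> q \<le> 1"
    and ren: "\<And>a. 0 < a \<Longrightarrow> a < 1 \<Longrightarrow> (\<integral>\<^sup>+ q. indicator {a<..} q * ennreal ((1 - a / q) powr (\<beta> - 1)) \<partial>\<kappa>) = 1"
    and "0 < \<epsilon>" "0 \<le> T" "0 \<le> c"
  shows conv_scaled_gauss_power_weight_0:
      "conv (scaled_gauss \<kappa> \<epsilon>) (gmix (power_weight c \<beta> 0)) x = gmix (power_weight c \<beta> \<epsilon>) x"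
    and conv_scaled_gauss_power_weight_le:
      "conv (scaled_gauss \<kappa> \<epsilon>) (gmix (power_weight c \<beta> T)) x \<le> gmix (power_weight c \<beta> (T + \<epsilon>)) x"
proof -
  have 1: "conv (scaled_gauss \<kappa> \<epsilon>) (gmix (power_weight c \<beta> T)) x
    = gmix (\<lambda>t. \<integral>\<^sup>+ q. power_weight c \<beta> T (t - \<epsilon> / q) \<partial>\<kappa>) x" if "0 \<le> T" for T
    by (rule conv_scaled_gauss_gmix[OF \<kappa> \<open>0 < \<epsilon>\<close>]) (use that in \<open>auto simp: power_weight_def\<close>)
  have ne: "AE t in lborel. t \<noteq> \<epsilon>" by (rule AE_lborel_singleton)
  show "conv (scaled_gauss \<kappa> \<epsilon>) (gmix (power_weight c \<beta> 0)) x = gmix (power_weight c \<beta> \<epsilon>) x"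
    unfolding 1[OF order_refl] unfolding gmix_def
    by (rule nn_integral_cong_AE)
      (use ne in eventually_elim, simp add: stable_overshoot_power_weight_0[OF \<kappa> ren \<open>0 < \<epsilon>\<close> \<open>0 \<le> T\<close> \<open>0 \<le> c\<close>])
  show "conv (scaled_gauss \<kappa> \<epsilon>) (gmix (power_weight c \<beta> T)) x \<le> gmix (power_weight c \<beta> (T + \<epsilon>)) x"
    unfolding 1[OF \<open>0 \<le> T\<close>] unfolding gmix_def
    by (rule nn_integral_mono_AE)
      (use ne in eventually_elim, simp add: mult_right_mono stable_overshoot_power_weight_le[OF \<kappa> ren \<open>0 < \<epsilon>\<close> \<open>0 \<le> T\<close> \<open>0 \<le> c\<close>])
qed

section \<open>The Riesz kernel as a Gaussian mixture\<close>

text \<open>The part of the Riesz weight that one step at level \<epsilon> removes; its mixture is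
  the loss g of the kernel.\<close>

definition head_weight :: "real \<Rightarrow> real \<Rightarrow> real \<Rightarrow> real \<Rightarrow> ennreal" where
  "head_weight c \<beta> \<epsilon> t = indicator {0<..\<epsilon>} t * ennreal (c * t powr (\<beta> - 1))"

lemma borel_measurable_head_weight [measurable (raw)]:
  assumes [measurable]: "f \<in> borel_measurable M"
  shows "(\<lambda>x. head_weight c \<beta> \<epsilon> (f x)) \<in> borel_measurable M"
  unfolding head_weight_def by measurable

lemma power_weight_0_split:
  assumes "0 < \<epsilon>"
  shows "power_weight c \<beta> 0 t = head_weight c \<beta> \<epsilon> t + power_weight c \<beta> \<epsilon> t"
  using assms by (auto simp: power_weight_def head_weight_def split: split_indicator)

lemma gmix_power_weight_split:
  assumes "0 < \<epsilon>"
  shows "gmix (power_weight c \<beta> 0) x = gmix (head_weight c \<beta> \<epsilon>) x + gmix (power_weight c \<beta> \<epsilon>) x"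
proof -
  have "power_weight c \<beta> 0 = (\<lambda>t. head_weight c \<beta> \<epsilon> t + power_weight c \<beta> \<epsilon> t)"
    using power_weight_0_split[OF assms] by auto
  then show ?thesis by (simp add: gmix_add)
qed

lemma nn_integral_head_weight:
  assumes "0 < \<beta>" "0 < \<epsilon>" "0 \<le> c"
  shows "(\<integral>\<^sup>+ t. head_weight c \<beta> \<epsilon> t \<partial>lborel) = ennreal (c * (\<epsilon> powr \<beta> / \<beta>))"
proof -
  have "((\<lambda>t. t powr (\<beta> - 1)) has_integral (\<epsilon> powr \<beta> / \<beta>)) {0..\<epsilon>}"
    using has_integral_powr_from_0[of "\<beta> - 1" \<epsilon>] assms by simp
  then have "integral\<^sup>N lborel (\<lambda>t. indicator {0..\<epsilon>} t * (t powr (\<beta> - 1))) = ennreal (\<epsilon> powr \<beta> / \<beta>)"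
    by (intro nn_integral_has_integral_lebesgue) auto
  also have "integral\<^sup>N lborel (\<lambda>t. indicator {0..\<epsilon>} t * (t powr (\<beta> - 1)))
    = (\<integral>\<^sup>+ t. indicator {0<..\<epsilon>} t * ennreal (t powr (\<beta> - 1)) \<partial>lborel)"
    using AE_lborel_singleton[of "0::real"]
    by (intro nn_integral_cong_AE, eventually_elim) (auto split: split_indicator)
  finally have "(\<integral>\<^sup>+ t. indicator {0<..\<epsilon>} t * ennreal (t powr (\<beta> - 1)) \<partial>lborel) = ennreal (\<epsilon> powr \<beta> / \<beta>)" .
  moreover have "(\<integral>\<^sup>+ t. head_weight c \<beta> \<epsilon> t \<partial>lborel)
    = ennreal c * (\<integral>\<^sup>+ t. indicator {0<..\<epsilon>} t * ennreal (t powr (\<beta> - 1)) \<partial>lborel)"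
    unfolding head_weight_def using assms
    by (subst nn_integral_cmult[symmetric]) (auto intro!: nn_integral_cong simp: ennreal_mult mult_ac)
  ultimately show ?thesis using assms by (simp add: ennreal_mult[symmetric])
qed

text \<open>A Gaussian of variance t is at most (2 pi t)^(- N / 2), with N the dimension, and
  \<beta> < N / 2 makes t^(\<beta> - 1 - N / 2) integrable at infinity. This is the transience of
  the process.\<close>

lemma gmix_power_weight_bound:
  assumes "0 \<le> c" "\<beta> < real DIM('a::euclidean_space) / 2"
  obtains C where "0 \<le> C" "\<And>T (x::'a). 0 < T \<Longrightarrow>
    gmix (power_weight c \<beta> T) x \<le> ennreal (C * T powr (\<beta> - real DIM('a) / 2))"
proof
  define n where "n = real DIM('a) / 2"
  define K where "K = c * (2 * pi) powr (- n)"
  have "K \<ge> 0" using assms by (simp add: K_def)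
  show "0 \<le> K / (n - \<beta>)" using assms \<open>K \<ge> 0\<close> by (simp add: n_def)
  fix T :: real and x :: 'a assume "0 < T"
  have "gmix (power_weight c \<beta> T) x \<le> gmix (power_weight c \<beta> T) (0::'a)"
    by (rule gmix_le_0) (use \<open>0 < T\<close> in \<open>auto simp: power_weight_def\<close>)
  also have "\<dots> \<le> (\<integral>\<^sup>+ t. ennreal K * (indicator {T..} t * ennreal (t powr (\<beta> - 1 - n))) \<partial>lborel)"
    unfolding gmix_def
  proof (rule nn_integral_mono)
    fix t
    have "t powr (\<beta> - 1) * (2 * pi * t) powr (- n) = (2 * pi) powr (- n) * t powr (\<beta> - 1 - n)" if "T < t"
      using that \<open>0 < T\<close> by (simp add: powr_mult powr_diff powr_minus divide_inverse)
    then show "power_weight c \<beta> T t * gauss t (0::'a) \<le> ennreal K * (indicator {T..} t * ennreal (t powr (\<beta> - 1 - n)))"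
      using \<open>0 < T\<close> assms
      by (auto simp: power_weight_def gauss_def n_def[symmetric] K_def ennreal_mult[symmetric] mult.assoc split: split_indicator)
  qed
  also have "\<dots> = ennreal K * ennreal (- (T powr (\<beta> - 1 - n + 1)) / (\<beta> - 1 - n + 1))"
  proof (subst nn_integral_cmult, simp)
    have "((\<lambda>t. t powr (\<beta> - 1 - n)) has_integral - (T powr (\<beta> - 1 - n + 1)) / (\<beta> - 1 - n + 1)) {T..}"
      using assms \<open>0 < T\<close> by (intro has_integral_powr_to_inf) (auto simp: n_def)
    then have "integral\<^sup>N lborel (\<lambda>t. indicator {T..} t * (t powr (\<beta> - 1 - n)))
      = ennreal (- (T powr (\<beta> - 1 - n + 1)) / (\<beta> - 1 - n + 1))"
      by (intro nn_integral_has_integral_lebesgue) auto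
    then show "ennreal K * (\<integral>\<^sup>+ t. indicator {T..} t * ennreal (t powr (\<beta> - 1 - n)) \<partial>lborel)
      = ennreal K * ennreal (- (T powr (\<beta> - 1 - n + 1)) / (\<beta> - 1 - n + 1))"
      by (simp add: ennreal_mult' ennreal_indicator)
  qed
  also have "\<dots> = ennreal (K / (n - \<beta>) * T powr (\<beta> - n))"
    using \<open>K \<ge> 0\<close> by (simp add: ennreal_mult'[symmetric] minus_divide_right)
  finally show "gmix (power_weight c \<beta> T) x \<le> ennreal (K / (n - \<beta>) * T powr (\<beta> - real DIM('a) / 2))"
    by (simp add: n_def)
qed

text \<open>Away from the origin Gaussians of small variance t decay faster than any power of t. The
  cube is chosen to beat the (j + 1)^2 steps at level 1 / (j + 1) taken in
  \<open>riesz_potential_kernel\<close>; the other factor is the mass of the head.\<close>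

lemma gmix_head_weight_small:
  assumes "0 < \<beta>" "0 \<le> c" "0 < d"
  shows "\<forall>\<^sub>F \<epsilon> in at_right 0. \<forall>x::'a::euclidean_space. d \<le> norm x \<longrightarrow>
    gmix (head_weight c \<beta> \<epsilon>) x \<le> ennreal (\<epsilon> ^ 3 * (c * (\<epsilon> powr \<beta> / \<beta>)))"
proof -
  define n where "n = real DIM('a) / 2"
  have "((\<lambda>t. (2 * pi * t) powr (- n) * exp (- d\<^sup>2 / (2 * t)) / t ^ 3) \<longlongrightarrow> 0) (at_right 0)"
    using \<open>0 < d\<close> by real_asymp
  then have "\<forall>\<^sub>F t in at_right 0. (2 * pi * t) powr (- n) * exp (- d\<^sup>2 / (2 * t)) / t ^ 3 < 1"
    by (rule order_tendstoD) simp
  then obtain e where e: "0 < e" "\<And>t. 0 < t \<Longrightarrow> t < e \<Longrightarrow> (2 * pi * t) powr (- n) * exp (- d\<^sup>2 / (2 * t)) / t ^ 3 < 1"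
    unfolding eventually_at_right_field by auto
  have "gmix (head_weight c \<beta> \<epsilon>) x \<le> ennreal (\<epsilon> ^ 3 * (c * (\<epsilon> powr \<beta> / \<beta>)))"
    if "0 < \<epsilon>" "\<epsilon> < e" "d \<le> norm x" for \<epsilon> and x :: 'a
  proof -
    have "gmix (head_weight c \<beta> \<epsilon>) x \<le> (\<integral>\<^sup>+ t. ennreal (\<epsilon> ^ 3) * head_weight c \<beta> \<epsilon> t \<partial>lborel)"
      unfolding gmix_def
    proof (rule nn_integral_mono)
      fix t
      show "head_weight c \<beta> \<epsilon> t * gauss t x \<le> ennreal (\<epsilon> ^ 3) * head_weight c \<beta> \<epsilon> t"
      proof (cases "0 < t \<and> t \<le> \<epsilon>")
        case True
        have "(2 * pi * t) powr (- n) * exp (- (norm x)\<^sup>2 / (2 * t)) \<le> (2 * pi * t) powr (- n) * exp (- d\<^sup>2 / (2 * t))"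
          using that \<open>0 < d\<close> True by (intro mult_left_mono) (auto simp: divide_right_mono)
        also have "\<dots> \<le> t ^ 3" using e(2)[of t] True that by (simp add: field_simps)
        also have "\<dots> \<le> \<epsilon> ^ 3" using True by (intro power_mono) auto
        finally have "gauss t x \<le> ennreal (\<epsilon> ^ 3)"
          unfolding gauss_def n_def by (rule ennreal_leI)
        then have "head_weight c \<beta> \<epsilon> t * gauss t x \<le> head_weight c \<beta> \<epsilon> t * ennreal (\<epsilon> ^ 3)"
          by (rule mult_left_mono) simp
        then show ?thesis by (simp add: mult.commute)
      qed (auto simp: head_weight_def)
    qed
    also have "\<dots> = ennreal (\<epsilon> ^ 3 * (c * (\<epsilon> powr \<beta> / \<beta>)))"
      using that assms by (simp add: nn_integral_cmult nn_integral_head_weight ennreal_mult[symmetric])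
    finally show ?thesis .
  qed
  then show ?thesis unfolding eventually_at_right_field using e(1) by auto
qed

text \<open>Substitution of |x|^2 t for t. Comparison with a unit vector makes the value of the
  Gamma integral irrelevant; the constant is normalised in
  \<open>gmix_power_weight_eq_riesz_power\<close>.\<close>

lemma gmix_power_weight_norm:
  fixes x e :: "'a::euclidean_space"
  assumes "x \<noteq> 0" "norm e = 1" "0 \<le> c"
  shows "gmix (power_weight c \<beta> 0) x
    = ennreal (norm x powr (2 * \<beta> - real DIM('a))) * gmix (power_weight c \<beta> 0) e"
proof -
  define r where "r = norm x"
  have r: "0 < r" using assms by (simp add: r_def)
  have gx: "gauss t x = gauss t (r *\<^sub>R e)" for t using assms by (simp add: gauss_def r_def)
  have eq: "ennreal (r\<^sup>2) * (power_weight c \<beta> 0 (r\<^sup>2 * t) * gauss (r\<^sup>2 * t) x)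
    = ennreal (r powr (2 * \<beta> - real DIM('a))) * (power_weight c \<beta> 0 t * gauss t e)" for t
  proof (cases "0 < t")
    case True
    have "r\<^sup>2 * ((r\<^sup>2) powr (\<beta> - 1) * r powr (- real DIM('a))) = r powr (2 * \<beta> - real DIM('a))"
    proof -
      have "r\<^sup>2 = r powr 2" using r by (simp add: powr_numeral)
      then have "r\<^sup>2 * ((r\<^sup>2) powr (\<beta> - 1) * r powr (- real DIM('a)))
        = r powr 2 * (r powr (2 * (\<beta> - 1)) * r powr (- real DIM('a)))" by (simp only: powr_powr)
      also have "\<dots> = r powr (2 + (2 * (\<beta> - 1) + - real DIM('a)))" by (simp only: powr_add)
      finally show ?thesis by (simp add: algebra_simps)
    qed
    then have "ennreal (r powr (2 * \<beta> - real DIM('a))) * ennreal (c * t powr (\<beta> - 1))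
      = ennreal (r\<^sup>2) * (ennreal (c * (r\<^sup>2 * t) powr (\<beta> - 1)) * ennreal (r powr (- real DIM('a))))"
      using r True assms by (simp add: ennreal_mult'[symmetric] powr_mult mult_ac)
    then show ?thesis using True r
      unfolding gx by (simp add: power_weight_def gauss_scaleR mult.assoc[symmetric])
  next
    case False
    then have "\<not> 0 < r\<^sup>2 * t" using r by (simp add: zero_less_mult_iff)
    with False show ?thesis by (simp add: power_weight_def)
  qed
  have "gmix (power_weight c \<beta> 0) x = ennreal (r\<^sup>2) * (\<integral>\<^sup>+ t. power_weight c \<beta> 0 (r\<^sup>2 * t) * gauss (r\<^sup>2 * t) x \<partial>lborel)"
    unfolding gmix_def using r by (subst nn_integral_real_affine[where c = "r\<^sup>2" and t = 0]) auto
  also have "\<dots> = (\<integral>\<^sup>+ t. ennreal (r powr (2 * \<beta> - real DIM('a))) * (power_weight c \<beta> 0 t * gauss t e) \<partial>lborel)"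
    by (subst nn_integral_cmult[symmetric]) (auto simp: eq)
  also have "\<dots> = ennreal (r powr (2 * \<beta> - real DIM('a))) * gmix (power_weight c \<beta> 0) e"
    unfolding gmix_def by (rule nn_integral_cmult) simp
  finally show ?thesis by (simp add: r_def)
qed

lemma gauss_pos: "0 < t \<Longrightarrow> 0 < gauss t x"
  by (simp add: gauss_def ennreal_zero_less_mult_iff)

lemma gmix_power_weight_finite_pos:
  fixes x :: "'a::euclidean_space"
  assumes "x \<noteq> 0" "0 < c" "0 < \<beta>" "\<beta> < real DIM('a) / 2"
  shows "0 < gmix (power_weight c \<beta> 0) x" "gmix (power_weight c \<beta> 0) x < \<infinity>"
proof -
  have "\<forall>\<^sub>F \<epsilon> in at_right 0. \<forall>y::'a. norm x \<le> norm y \<longrightarrow>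
    gmix (head_weight c \<beta> \<epsilon>) y \<le> ennreal (\<epsilon> ^ 3 * (c * (\<epsilon> powr \<beta> / \<beta>)))"
    using assms by (intro gmix_head_weight_small) auto
  then obtain e where e: "0 < e" "\<And>\<epsilon>. 0 < \<epsilon> \<Longrightarrow> \<epsilon> < e \<Longrightarrow>
      gmix (head_weight c \<beta> \<epsilon>) x \<le> ennreal (\<epsilon> ^ 3 * (c * (\<epsilon> powr \<beta> / \<beta>)))"
    unfolding eventually_at_right_field by auto
  have "gmix (head_weight c \<beta> (e/2)) x < \<infinity>"
    using e(2)[of "e/2"] e(1) by (auto intro: le_less_trans)
  moreover obtain C where "\<And>T (y::'a). 0 < T \<Longrightarrow> gmix (power_weight c \<beta> T) y \<le> ennreal (C * T powr (\<beta> - real DIM('a) / 2))"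
    using gmix_power_weight_bound[of c \<beta>] assms by (metis less_imp_le)
  then have "gmix (power_weight c \<beta> (e/2)) x < \<infinity>"
    using e(1) le_less_trans[OF _ ennreal_less_top] by (metis half_gt_zero infinity_ennreal_def)
  ultimately show "gmix (power_weight c \<beta> 0) x < \<infinity>"
    using e(1) by (simp add: gmix_power_weight_split[of "e/2"])
  show "0 < gmix (power_weight c \<beta> 0) x"
  proof (rule ccontr)
    assume "\<not> ?thesis"
    then have "AE t in lborel. power_weight c \<beta> 0 t * gauss t x = 0"
      by (simp add: gmix_def nn_integral_0_iff_AE)
    then have "AE t in lborel. t \<notin> {1<..<2::real}"
    proof eventually_elim
      case (elim t)
      then show ?case using gauss_pos[of t x] assms
        by (auto simp: power_weight_def split: split_indicator_asm)
    qed
    then have "emeasure lborel {1<..<2::real} = 0"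
      by (subst (asm) AE_iff_measurable[where N = "{1<..<2::real}"]) auto
    then show False by simp
  qed
qed

lemma gmix_power_weight_eq_riesz_power:
  assumes "0 < \<beta>" "\<beta> < real DIM('a::euclidean_space) / 2"
  obtains c where "0 < c" "\<And>x::'a. gmix (power_weight c \<beta> 0) x = riesz_power DIM('a) (2 * \<beta>) (norm x)"
proof -
  obtain e :: 'a where e: "norm e = 1" using norm_Basis SOME_Basis by blast
  define K where "K = enn2real (gmix (power_weight 1 \<beta> 0) e)"
  have "e \<noteq> 0" using e by auto
  note fp = gmix_power_weight_finite_pos[OF this, of 1 \<beta>] 
  have K: "0 < K" "gmix (power_weight 1 \<beta> 0) e = ennreal K"
    using fp assms by (auto simp: K_def enn2real_positive_iff)
  define c where "c = 1 / K"
  have c: "0 < c" using K by (simp add: c_def)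
  have "gmix (power_weight c \<beta> 0) e = ennreal c * gmix (power_weight 1 \<beta> 0) e"
    unfolding gmix_def using c
    by (subst nn_integral_cmult[symmetric]) (auto intro!: nn_integral_cong simp: power_weight_def ennreal_mult mult.assoc split: split_indicator)
  then have ce: "gmix (power_weight c \<beta> 0) e = 1"
    using K c by (simp add: c_def ennreal_mult[symmetric])
  have nz: "gmix (power_weight c \<beta> 0) x = ennreal (norm x powr (2 * \<beta> - real DIM('a)))" if "x \<noteq> 0" for x :: 'a
    using gmix_power_weight_norm[OF that e, of c \<beta>] c ce by simp
  have "gmix (power_weight c \<beta> 0) (0::'a) = \<infinity>"
  proof (rule ccontr)
    assume "gmix (power_weight c \<beta> 0) (0::'a) \<noteq> \<infinity>"
    then obtain B where B: "0 \<le> B" "gmix (power_weight c \<beta> 0) (0::'a) = ennreal B"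
      by (cases "gmix (power_weight c \<beta> 0) (0::'a)") auto
    define s where "s = 2 * \<beta> - real DIM('a)"
    \<comment> \<open>At this radius the homogeneous formula gives B + 1, while no value of the
      mixture exceeds its value B at the origin.\<close>
    define r where "r = (B + 1) powr (1 / s)"
    have "s < 0" "0 < r" using assms B by (auto simp: s_def r_def)
    have "ennreal (B + 1) = ennreal (norm (r *\<^sub>R e) powr s)"
      using e B \<open>s < 0\<close> by (simp add: r_def powr_powr)
    also have "\<dots> = gmix (power_weight c \<beta> 0) (r *\<^sub>R e)"
      using \<open>0 < r\<close> \<open>e \<noteq> 0\<close> by (subst nz) (auto simp: s_def)
    also have "\<dots> \<le> ennreal B"
      unfolding B(2)[symmetric] by (rule gmix_le_0) (auto simp: power_weight_def)
    finally show False using B by (simp add: ennreal_le_iff)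
  qed
  then have "gmix (power_weight c \<beta> 0) x = riesz_power DIM('a) (2 * \<beta>) (norm x)" for x :: 'a
    using nz[of x] by (cases "x = 0") (auto simp: riesz_power_def)
  then show ?thesis using that c by blast
qed

section \<open>Gaussian averages as approximate identities\<close>

lemma conv_gauss_tendsto:
  fixes f :: "'a::euclidean_space \<Rightarrow> ennreal"
  assumes [measurable]: "f \<in> borel_measurable borel" and "\<And>y. f y \<le> ennreal L" and "isCont f x"
  shows "((\<lambda>t. conv (gauss t) f x) \<longlongrightarrow> f x) (at_right 0)"
  unfolding tendsto_at_iff_sequentially comp_def
proof (intro allI impI)
  fix t :: "nat \<Rightarrow> real" assume t: "\<forall>i. t i \<in> {0<..} - {0}" "t \<longlonglongrightarrow> 0"
  have tp: "0 < t i" for i using t(1) by auto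
  \<comment> \<open>Rescaling space by the square root of \<open>t i\<close> leaves one fixed
    Gaussian as weight, so dominated convergence applies.\<close>
  have eq: "conv (gauss (t i)) f x = (\<integral>\<^sup>+ z. gauss 1 z * f (x - sqrt (t i) *\<^sub>R z) \<partial>lborel)" for i
  proof -
    have "sqrt (t i) powr real DIM('a) * sqrt (t i) powr - real DIM('a) = 1"
      using tp[of i] by (simp add: powr_minus)
    moreover have "gauss (t i) (sqrt (t i) *\<^sub>R z) = ennreal (sqrt (t i) powr - real DIM('a)) * gauss 1 z" for z :: 'a
      using gauss_scaleR[of "sqrt (t i)" 1 z] tp[of i] by simp
    ultimately have e: "ennreal (sqrt (t i) ^ DIM('a)) * (gauss (t i) (sqrt (t i) *\<^sub>R z) * f y) = gauss 1 z * f y" for z :: 'a and y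
      using tp[of i] by (simp add: mult.assoc[symmetric] ennreal_mult[symmetric] powr_realpow)
    show ?thesis
      unfolding conv_def using tp[of i]
      by (subst nn_integral_lborel_scale[of _ "sqrt (t i)"]) (auto simp: nn_integral_cmult[symmetric] e)
  qed
  have "(\<lambda>i. \<integral>\<^sup>+ z. gauss 1 z * f (x - sqrt (t i) *\<^sub>R z) \<partial>lborel) \<longlonglongrightarrow> (\<integral>\<^sup>+ z. gauss 1 (z::'a) * f x \<partial>lborel)"
  proof (rule nn_integral_dominated_convergence[where w = "\<lambda>z::'a. gauss 1 z * ennreal L"])
    show "(\<integral>\<^sup>+ z. gauss 1 (z::'a) * ennreal L \<partial>lborel) < \<infinity>"
      by (simp add: nn_integral_multc nn_integral_gauss)
    show "AE z in lborel. (\<lambda>i. gauss 1 z * f (x - sqrt (t i) *\<^sub>R z)) \<longlonglongrightarrow> gauss 1 z * f x"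
    proof (intro AE_I2 ennreal_tendsto_cmult isCont_tendsto_compose[OF \<open>isCont f x\<close>])
      fix z :: 'a
      have "(\<lambda>i. x - sqrt (t i) *\<^sub>R z) \<longlonglongrightarrow> x - sqrt 0 *\<^sub>R z" by (intro tendsto_intros t(2))
      then show "(\<lambda>i. x - sqrt (t i) *\<^sub>R z) \<longlonglongrightarrow> x" by simp
    qed (simp add: gauss_def)
  qed (auto intro!: mult_left_mono assms)
  then show "(\<lambda>i. conv (gauss (t i)) f x) \<longlonglongrightarrow> f x"
    by (simp add: eq nn_integral_multc nn_integral_gauss)
qed

lemma conv_gmix_head_tendsto:
  fixes f :: "'a::euclidean_space \<Rightarrow> ennreal"
  assumes [measurable]: "f \<in> borel_measurable borel" and "\<And>y. f y \<le> ennreal L" and "isCont f x"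
    and "0 < \<beta>" "0 < c"
  shows "((\<lambda>\<epsilon>. conv (gmix (head_weight c \<beta> \<epsilon>)) f x / (\<integral>\<^sup>+ t. head_weight c \<beta> \<epsilon> t \<partial>lborel)) \<longlongrightarrow> f x) (at_right 0)"
proof -
  let ?m = "\<lambda>\<epsilon>. \<integral>\<^sup>+ t. head_weight c \<beta> \<epsilon> t \<partial>lborel" and ?g = "\<lambda>\<epsilon>. conv (gmix (head_weight c \<beta> \<epsilon>)) f x"
  note lim = conv_gauss_tendsto[OF assms(1,2,3)]
  have m: "?m \<epsilon> \<noteq> 0" "?m \<epsilon> \<noteq> \<infinity>" if "0 < \<epsilon>" for \<epsilon>
    using that assms by (auto simp: nn_integral_head_weight)
  have cg: "?g \<epsilon> = (\<integral>\<^sup>+ t. head_weight c \<beta> \<epsilon> t * conv (gauss t) f x \<partial>lborel)" for \<epsilon>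
    by (rule conv_gmix) auto
  have [measurable]: "(\<lambda>t. conv (gauss t) f x) \<in> borel_measurable borel"
    unfolding conv_def by measurable
  show ?thesis
  proof (rule order_tendstoI)
    fix a assume "a < f x"
    then obtain a' where a': "a < a'" "a' < f x" using dense by blast
    obtain e where e: "0 < e" "\<And>t. 0 < t \<Longrightarrow> t < e \<Longrightarrow> a' < conv (gauss t) f x"
      using order_tendstoD(1)[OF lim a'(2)] unfolding eventually_at_right_field by auto
    have "a < ?g \<epsilon> / ?m \<epsilon>" if \<epsilon>: "0 < \<epsilon>" "\<epsilon> < e" for \<epsilon>
    proof -
      have "a' = (\<integral>\<^sup>+ t. head_weight c \<beta> \<epsilon> t * a' \<partial>lborel) / ?m \<epsilon>"
        using m[OF \<epsilon>(1)] by (subst nn_integral_multc) (auto simp: mult.commute[of _ a'] ennreal_mult_divide_eq)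
      also have "\<dots> \<le> ?g \<epsilon> / ?m \<epsilon>"
        unfolding cg
      proof (intro divide_right_mono_ennreal nn_integral_mono)
        fix t show "head_weight c \<beta> \<epsilon> t * a' \<le> head_weight c \<beta> \<epsilon> t * conv (gauss t) f x"
          using e(2)[of t] \<epsilon> by (cases "0 < t \<and> t \<le> \<epsilon>") (auto simp: head_weight_def intro!: mult_left_mono)
      qed
      finally show ?thesis using a'(1) by simp
    qed
    then show "\<forall>\<^sub>F \<epsilon> in at_right 0. a < ?g \<epsilon> / ?m \<epsilon>"
      unfolding eventually_at_right_field using e(1) by auto
  next
    fix a assume "f x < a"
    then obtain a' where a': "f x < a'" "a' < a" using dense by blast
    obtain e where e: "0 < e" "\<And>t. 0 < t \<Longrightarrow> t < e \<Longrightarrow> conv (gauss t) f x < a'"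
      using order_tendstoD(2)[OF lim a'(1)] unfolding eventually_at_right_field by auto
    have "?g \<epsilon> / ?m \<epsilon> < a" if \<epsilon>: "0 < \<epsilon>" "\<epsilon> < e" for \<epsilon>
    proof -
      have "?g \<epsilon> / ?m \<epsilon>
        \<le> (\<integral>\<^sup>+ t. head_weight c \<beta> \<epsilon> t * a' \<partial>lborel) / ?m \<epsilon>"
        unfolding cg
      proof (intro divide_right_mono_ennreal nn_integral_mono)
        fix t show "head_weight c \<beta> \<epsilon> t * conv (gauss t) f x \<le> head_weight c \<beta> \<epsilon> t * a'"
          using e(2)[of t] \<epsilon> by (cases "0 < t \<and> t \<le> \<epsilon>") (auto simp: head_weight_def intro!: mult_left_mono)
      qed
      also have "\<dots> = a'"
        using m[OF \<epsilon>(1)] by (subst nn_integral_multc) (auto simp: mult.commute[of _ a'] ennreal_mult_divide_eq)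
      finally show ?thesis using a'(2) by simp
    qed
    then show "\<forall>\<^sub>F \<epsilon> in at_right 0. ?g \<epsilon> / ?m \<epsilon> < a"
      unfolding eventually_at_right_field using e(1) by auto
  qed
qed

section \<open>Approximate Green functions\<close>

text \<open>h mixes Gaussians of variance at least T, and each of them drops from its centre to x by
  a factor no smaller than exp (- |x|^2 / (2 T)). So h / h 0 stays below 1 and tends to 1 as T
  grows: a substitute for the equilibrium potentials of large balls, used to measure the mass of a
  charge.\<close>

lemma conv_gauss_bounds:
  fixes x :: "'a::euclidean_space" and \<beta> :: real
  assumes "0 < T" "0 < c"
  defines "h \<equiv> conv (gauss T) (gmix (power_weight c \<beta> 0)) :: 'a \<Rightarrow> ennreal"
  shows conv_gauss_le_0: "h x \<le> h 0"
    and conv_gauss_ge: "ennreal (exp (- (norm x)\<^sup>2 / (2 * T))) * h 0 \<le> h x"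
proof -
  have h: "h = gmix (\<lambda>t. power_weight c \<beta> 0 (t - T))"
    unfolding h_def by (intro ext conv_gauss_gmix) (use assms in \<open>auto simp: power_weight_def\<close>)
  show "h x \<le> h 0" unfolding h by (rule gmix_le_0) (use assms in \<open>auto simp: power_weight_def\<close>)
  show "ennreal (exp (- (norm x)\<^sup>2 / (2 * T))) * h 0 \<le> h x"
    unfolding h gmix_def
  proof (subst nn_integral_cmult[symmetric], simp, rule nn_integral_mono)
    fix t
    show "ennreal (exp (- (norm x)\<^sup>2 / (2 * T))) * (power_weight c \<beta> 0 (t - T) * gauss t (0::'a))
      \<le> power_weight c \<beta> 0 (t - T) * gauss t x"
    proof (cases "T < t")
      case True
      have "(norm x)\<^sup>2 / (2 * t) \<le> (norm x)\<^sup>2 / (2 * T)"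
        using True \<open>0 < T\<close> by (intro divide_left_mono) auto
      then have "ennreal (exp (- (norm x)\<^sup>2 / (2 * T))) * gauss t (0::'a) \<le> gauss t x"
        using True \<open>0 < T\<close> by (auto simp: gauss_def ennreal_mult[symmetric] mult.commute[of "exp _"] intro!: ennreal_leI mult_left_mono)
      then show ?thesis by (metis mult.left_commute mult_left_mono zero_le)
    qed (auto simp: power_weight_def)
  qed
qed

text \<open>Finiteness: the singular part of the kernel is integrable and the Gaussian bounded,
  while the rest of the kernel is bounded and the Gaussian integrable.\<close>

lemma conv_gauss_0_finite_pos:
  assumes "0 < T" "0 < c" "0 < \<beta>" "\<beta> < real DIM('a::euclidean_space) / 2"
  defines "h \<equiv> conv (gauss T) (gmix (power_weight c \<beta> 0)) :: 'a \<Rightarrow> ennreal"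
  shows "h 0 < \<infinity>" "0 < h 0"
proof -
  obtain C where C: "\<And>R (y::'a). 0 < R \<Longrightarrow> gmix (power_weight c \<beta> R) y \<le> ennreal (C * R powr (\<beta> - real DIM('a) / 2))"
    using gmix_power_weight_bound[of c \<beta>] assms by (metis less_imp_le)
  have split: "gmix (power_weight c \<beta> 0) = (\<lambda>y::'a. gmix (head_weight c \<beta> 1) y + gmix (power_weight c \<beta> 1) y)"
    by (intro ext gmix_power_weight_split) simp
  have "conv (gauss T) (gmix (head_weight c \<beta> 1)) (0::'a) \<le> (\<integral>\<^sup>+ y. gauss T (0::'a) * gmix (head_weight c \<beta> 1) (0 - y :: 'a) \<partial>lborel)"
    unfolding conv_def by (intro nn_integral_mono mult_right_mono gauss_le_0) (use assms in auto)
  also have "\<dots> = gauss T (0::'a) * (\<integral>\<^sup>+ y. gmix (head_weight c \<beta> 1) (y::'a) \<partial>lborel)"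
    using nn_integral_lborel_reflect[of "gmix (head_weight c \<beta> 1)" "0::'a"] by (subst nn_integral_cmult) auto
  also have "\<dots> < \<infinity>"
    using assms by (subst nn_integral_gmix)
      (auto simp: nn_integral_head_weight head_weight_def[of _ _ _ "_::real"] gauss_def ennreal_mult_less_top)
  finally have 1: "conv (gauss T) (gmix (head_weight c \<beta> 1)) (0::'a) < \<infinity>" .
  have "conv (gauss T) (gmix (power_weight c \<beta> 1)) (0::'a) \<le> conv (gauss T) (\<lambda>_. ennreal C) (0::'a)"
    using C[of 1] by (intro conv_mono) auto
  also have "\<dots> < \<infinity>" using assms by (simp add: conv_const_right nn_integral_gauss)
  finally show "h 0 < \<infinity>" using 1 unfolding h_def split by (simp add: conv_add_right)
  show "0 < h 0"
  proof (rule ccontr)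
    assume "\<not> ?thesis"
    then have "AE y in lborel. gauss T (y::'a) * gmix (power_weight c \<beta> 0) (0 - y) = 0"
      unfolding h_def conv_def by (subst nn_integral_0_iff_AE[symmetric]) auto
    moreover have "AE y in lborel. y \<noteq> (0::'a)" by (rule AE_lborel_singleton)
    ultimately have "AE y in lborel. (y::'a) \<notin> UNIV"
    proof eventually_elim
      case (elim y)
      then show ?case
        using gmix_power_weight_finite_pos(1)[of "- y" c \<beta>] gauss_pos[of T y] assms by auto
    qed
    then have "emeasure lborel (UNIV :: 'a set) = 0"
      by (subst (asm) AE_iff_measurable[where N = UNIV]) auto
    then show False by simp
  qed
qed

lemma conv_divide_left:
  fixes f h :: "'a::euclidean_space \<Rightarrow> ennreal"
  assumes [measurable]: "f \<in> borel_measurable borel" "h \<in> borel_measurable borel"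
  shows "conv (\<lambda>x. f x / a) h x = conv f h x / a"
  unfolding conv_def
  by (subst nn_integral_divide[symmetric]) (auto simp: divide_ennreal_def mult_ac)

context
  fixes c \<beta> :: real and x :: "'a::euclidean_space" and h :: "real \<Rightarrow> 'a \<Rightarrow> ennreal"
  assumes c: "0 < c" and \<beta>: "0 < \<beta>" "\<beta> < real DIM('a) / 2"
  defines "h \<equiv> \<lambda>T. conv (gauss T) (gmix (power_weight c \<beta> 0))"
begin

lemma conv_normalized_gauss:
  "conv (\<lambda>x. gauss T x / h T 0) (gmix (power_weight c \<beta> 0)) x = h T x / h T 0"
  unfolding h_def by (rule conv_divide_left) simp_all

lemma conv_normalized_gauss_le_1:
  assumes "0 < T"
  shows "conv (\<lambda>x. gauss T x / h T 0) (gmix (power_weight c \<beta> 0)) x \<le> 1"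
proof -
  have "h T x \<le> h T 0" unfolding h_def by (rule conv_gauss_le_0[OF assms c])
  moreover have "0 < h T 0" unfolding h_def by (rule conv_gauss_0_finite_pos(2)[OF assms c \<beta>])
  ultimately show ?thesis
    unfolding conv_normalized_gauss by (intro divide_le_posI_ennreal) simp_all
qed

lemma conv_normalized_gauss_tendsto_1:
  "(\<lambda>n. conv (\<lambda>x. gauss (real (Suc n)) x / h (real (Suc n)) 0) (gmix (power_weight c \<beta> 0)) x) \<longlonglongrightarrow> 1"
proof (rule tendsto_sandwich)
  have "filterlim (\<lambda>n. 2 * real (Suc n)) at_top sequentially"
    by (intro filterlim_tendsto_pos_mult_at_top[OF tendsto_const] filterlim_compose[OF filterlim_real_sequentially filterlim_Suc]) simp
  then have "(\<lambda>n. exp (- (norm x)\<^sup>2 / (2 * real (Suc n)))) \<longlonglongrightarrow> exp 0"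
    by (intro tendsto_exp real_tendsto_divide_at_top[OF tendsto_const])
  then show "(\<lambda>n. ennreal (exp (- (norm x)\<^sup>2 / (2 * real (Suc n))))) \<longlonglongrightarrow> 1"
    using tendsto_ennrealI by fastforce
  have lower: "ennreal (exp (- (norm x)\<^sup>2 / (2 * T))) \<le> h T x / h T 0" if T: "0 < T" for T
  proof -
    have "0 < h T 0" "h T 0 < \<infinity>" unfolding h_def by (rule conv_gauss_0_finite_pos[OF T c \<beta>])+
    then have "ennreal (exp (- (norm x)\<^sup>2 / (2 * T))) = ennreal (exp (- (norm x)\<^sup>2 / (2 * T))) * h T 0 / h T 0"
      by (simp add: ennreal_mult_divide_eq)
    also have "\<dots> \<le> h T x / h T 0"
      unfolding h_def by (intro divide_right_mono_ennreal conv_gauss_ge[OF T c])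
    finally show ?thesis .
  qed
  show "\<forall>\<^sub>F n in sequentially. ennreal (exp (- (norm x)\<^sup>2 / (2 * real (Suc n))))
      \<le> conv (\<lambda>x. gauss (real (Suc n)) x / h (real (Suc n)) 0) (gmix (power_weight c \<beta> 0)) x"
    unfolding conv_normalized_gauss by (intro always_eventually allI lower) simp
  show "\<forall>\<^sub>F n in sequentially. conv (\<lambda>x. gauss (real (Suc n)) x / h (real (Suc n)) 0) (gmix (power_weight c \<beta> 0)) x \<le> 1"
    by (intro always_eventually allI conv_normalized_gauss_le_1) simp
qed simp

end

text \<open>What the later arguments use of the kernel. \<open>p j\<close> is one step of a random
  walk for which k is excessive, \<open>g j\<close> is the loss of k in one step and has mass
  \<open>m j\<close>, \<open>b j n\<close> bounds k after n steps uniformly, and \<open>q n\<close>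
  has a potential that stays below 1 and tends to 1. The axiom \<open>far\<close> couples two
  scales: \<open>N j\<close> steps suffice for the potential to die out, although the losses at
  distance d, summed over these steps, are still negligible.\<close>

locale potential_kernel =
  fixes k :: "'a::euclidean_space \<Rightarrow> ennreal" and p g q :: "nat \<Rightarrow> 'a \<Rightarrow> ennreal"
    and m :: "nat \<Rightarrow> ennreal" and b :: "nat \<Rightarrow> nat \<Rightarrow> ennreal"
  assumes meas [measurable]: "k \<in> borel_measurable borel" "\<And>j. p j \<in> borel_measurable borel"
      "\<And>j. g j \<in> borel_measurable borel" "\<And>n. q n \<in> borel_measurable borel"
    and even: "\<And>x. k (- x) = k x"
    and nn_integral_p: "\<And>j. (\<integral>\<^sup>+ x. p j x \<partial>lborel) = 1"
    and decomp: "\<And>j x. k x = conv (p j) k x + g j x"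
    and iterates: "\<And>j n x. (conv (p j) ^^ n) k x \<le> b j n"
    and b_tendsto: "\<And>j. b j \<longlonglongrightarrow> 0"
    and far: "\<And>d. 0 < d \<Longrightarrow> \<exists>N \<tau>. (\<forall>\<^sub>F j in sequentially. \<forall>x. d \<le> norm x \<longrightarrow> g j x \<le> \<tau> j) \<and>
      (\<lambda>j. of_nat (N j) * \<tau> j) \<longlonglongrightarrow> 0 \<and> (\<lambda>j. b j (N j)) \<longlonglongrightarrow> 0"
    and nn_integral_g: "\<And>j. (\<integral>\<^sup>+ x. g j x \<partial>lborel) = m j" and m: "\<And>j. 0 < m j" "\<And>j. m j < \<infinity>"
    and approx: "\<And>f L x. f \<in> borel_measurable borel \<Longrightarrow> (\<And>y. f y \<le> ennreal L) \<Longrightarrow> isCont f x \<Longrightarrow>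
      (\<lambda>j. conv (g j) f x / m j) \<longlonglongrightarrow> f x"
    and q_le: "\<And>n x. conv (q n) k x \<le> 1" and q_tendsto: "\<And>x. (\<lambda>n. conv (q n) k x) \<longlonglongrightarrow> 1"

lemma riesz_potential_kernel:
  fixes \<alpha> :: real
  assumes "0 < \<alpha>" "\<alpha> \<le> 2" "\<alpha> < real DIM('a::euclidean_space)"
  shows "\<exists>p g q m b. potential_kernel (\<lambda>x::'a. riesz_power DIM('a) \<alpha> (norm x)) p g q m b"
proof -
  define \<beta> where "\<beta> = \<alpha> / 2"
  have \<beta>: "0 < \<beta>" "\<beta> \<le> 1" "\<beta> < real DIM('a) / 2" using assms by (auto simp: \<beta>_def)
  obtain c where c: "0 < c" and k: "\<And>x::'a. gmix (power_weight c \<beta> 0) x = riesz_power DIM('a) (2 * \<beta>) (norm x)"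
    by (rule gmix_power_weight_eq_riesz_power[OF \<beta>(1,3)]) (rule that)
  obtain \<kappa> :: "real measure" where \<kappa>: "prob_space \<kappa>" "sets \<kappa> = sets borel" "AE q in \<kappa>. 0 < q \<and> q \<le> 1"
    and ren: "\<And>a. 0 < a \<Longrightarrow> a < 1 \<Longrightarrow> (\<integral>\<^sup>+ q. indicator {a<..} q * ennreal ((1 - a / q) powr (\<beta> - 1)) \<partial>\<kappa>) = 1"
    by (rule stable_overshoot_law[OF \<beta>(1,2)]) (rule that)
  define \<epsilon> where "\<epsilon> = (\<lambda>j. 1 / real (Suc j))"
  have \<epsilon>: "0 < \<epsilon> j" for j by (simp add: \<epsilon>_def)
  have \<epsilon>_lim: "filterlim \<epsilon> (at_right 0) sequentially" unfolding \<epsilon>_def by real_asymp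
  define p where "p = (\<lambda>j. scaled_gauss \<kappa> (\<epsilon> j) :: 'a \<Rightarrow> ennreal)"
  define g where "g = (\<lambda>j. gmix (head_weight c \<beta> (\<epsilon> j)) :: 'a \<Rightarrow> ennreal)"
  define h where "h = (\<lambda>n. conv (gauss (real (Suc n))) (gmix (power_weight c \<beta> 0)) :: 'a \<Rightarrow> ennreal)"
  define q where "q = (\<lambda>n (x::'a). gauss (real (Suc n)) x * inverse (h n 0))"
  define m where "m = (\<lambda>j. \<integral>\<^sup>+ t. head_weight c \<beta> (\<epsilon> j) t \<partial>lborel)"
  define b where "b = (\<lambda>j n. gmix (power_weight c \<beta> (real n * \<epsilon> j)) (0::'a))"
  note [simp] = \<open>0 < c\<close> less_imp_le[OF \<open>0 < c\<close>]
  have [measurable]: "p j \<in> borel_measurable borel" for j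
    unfolding p_def by (rule borel_measurable_scaled_gauss[OF \<kappa> \<epsilon>])
  have g_meas [measurable]: "g j \<in> borel_measurable borel" for j unfolding g_def by simp
  obtain C where "0 \<le> C" and C: "\<And>R (y::'a). 0 < R \<Longrightarrow> gmix (power_weight c \<beta> R) y \<le> ennreal (C * R powr (\<beta> - real DIM('a) / 2))"
    by (rule gmix_power_weight_bound[OF less_imp_le[OF c] \<beta>(3)]) (rule that)
  have tail0: "(\<lambda>n. gmix (power_weight c \<beta> (T n)) (0::'a)) \<longlonglongrightarrow> 0" if "filterlim T at_top sequentially" for T :: "nat \<Rightarrow> real"
  proof (rule tendsto_sandwich[of "\<lambda>_. 0" _ _ "\<lambda>n. ennreal (C * T n powr (\<beta> - real DIM('a) / 2))"])
    have "(\<lambda>n. C * T n powr (\<beta> - real DIM('a) / 2)) \<longlonglongrightarrow> C * 0"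
      using \<beta> that by (intro tendsto_mult_left tendsto_neg_powr) auto
    then show "(\<lambda>n. ennreal (C * T n powr (\<beta> - real DIM('a) / 2))) \<longlonglongrightarrow> 0"
      using tendsto_ennrealI by fastforce
    show "\<forall>\<^sub>F n in sequentially. gmix (power_weight c \<beta> (T n)) (0::'a) \<le> ennreal (C * T n powr (\<beta> - real DIM('a) / 2))"
      using filterlim_at_top_dense[THEN iffD1, rule_format, OF that, of 0]
      by eventually_elim (rule C)
  qed auto
  have "potential_kernel (gmix (power_weight c \<beta> 0) :: 'a \<Rightarrow> ennreal) p g q m b"
  proof
    show "gmix (power_weight c \<beta> 0) (- x) = gmix (power_weight c \<beta> 0) x" for x :: 'a
      by (simp add: gmix_def gauss_minus)
    show "(\<integral>\<^sup>+ x. p j x \<partial>lborel) = 1" for j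
      unfolding p_def by (rule nn_integral_scaled_gauss[OF \<kappa> \<epsilon>])
    show "gmix (power_weight c \<beta> 0) x = conv (p j) (gmix (power_weight c \<beta> 0)) x + g j x" for j and x :: 'a
      unfolding p_def g_def
      by (subst conv_scaled_gauss_power_weight_0[OF \<kappa> ren \<epsilon>, of 0 c]) (auto simp: gmix_power_weight_split[OF \<epsilon>[of j]] add.commute)
    show "(conv (p j) ^^ n) (gmix (power_weight c \<beta> 0)) x \<le> b j n" for j n and x :: 'a
    proof -
      have "(conv (p j) ^^ n) (gmix (power_weight c \<beta> 0)) x \<le> gmix (power_weight c \<beta> (real n * \<epsilon> j)) x" for x :: 'a
      proof (induction n arbitrary: x)
        case (Suc n)
        have "(conv (p j) ^^ Suc n) (gmix (power_weight c \<beta> 0)) x \<le> conv (p j) (gmix (power_weight c \<beta> (real n * \<epsilon> j))) x"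
          by (simp, intro conv_mono Suc.IH) simp
        also have "\<dots> \<le> gmix (power_weight c \<beta> (real n * \<epsilon> j + \<epsilon> j)) x"
          unfolding p_def using \<epsilon>[of j] by (intro conv_scaled_gauss_power_weight_le[OF \<kappa> ren \<epsilon>]) auto
        finally show ?case by (simp add: algebra_simps)
      qed simp
      also have "gmix (power_weight c \<beta> (real n * \<epsilon> j)) x \<le> b j n"
        unfolding b_def
      proof (rule gmix_le_0)
        fix t :: real assume "t \<le> 0"
        moreover have "0 \<le> real n * \<epsilon> j" using \<epsilon>[of j] by simp
        ultimately show "power_weight c \<beta> (real n * \<epsilon> j) t = 0"
          by (auto simp: power_weight_def)
      qed
      finally show ?thesis .
    qed
    show "b j \<longlonglongrightarrow> 0" for j
      unfolding b_def using \<epsilon>[of j]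
      by (intro tail0 filterlim_at_top_mult_tendsto_pos[OF tendsto_const] filterlim_real_sequentially)
    show "\<exists>N \<tau>. (\<forall>\<^sub>F j in sequentially. \<forall>x. d \<le> norm x \<longrightarrow> g j x \<le> \<tau> j) \<and>
      (\<lambda>j. of_nat (N j) * \<tau> j) \<longlonglongrightarrow> 0 \<and> (\<lambda>j. b j (N j)) \<longlonglongrightarrow> 0" if "0 < d" for d
    \<comment> \<open>(j + 1)^2 steps at level \<epsilon> j = 1 / (j + 1) advance the time to at
      least j + 1, which tends to infinity, whereas (j + 1)^2 times the cube of \<epsilon> j is
      \<epsilon> j and tends to 0.\<close>
    proof (intro exI conjI)
      have "\<forall>\<^sub>F j in sequentially. \<forall>x. d \<le> norm x \<longrightarrow> g j x \<le> ennreal (\<epsilon> j ^ 3 * (c * (\<epsilon> j powr \<beta> / \<beta>)))"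
        unfolding g_def
        by (rule eventually_compose_filterlim[OF gmix_head_weight_small[OF \<beta>(1) _ that] \<epsilon>_lim]) simp
      then show "\<forall>\<^sub>F j in sequentially. \<forall>x. d \<le> norm x \<longrightarrow> g j x \<le> ennreal (\<epsilon> j ^ 3 * (c / \<beta>))"
      proof eventually_elim
        case (elim j)
        have "\<epsilon> j powr \<beta> \<le> 1 powr \<beta>" using \<beta>(1) by (intro powr_mono2) (auto simp: \<epsilon>_def)
        then have "\<epsilon> j ^ 3 * (c * (\<epsilon> j powr \<beta> / \<beta>)) \<le> \<epsilon> j ^ 3 * (c / \<beta>)"
          using \<epsilon>[of j] \<beta>(1) by (intro mult_left_mono) (auto simp: field_simps)
        then show ?case using elim ennreal_leI order_trans by blast
      qed
      have "(\<lambda>j. \<epsilon> j * (c / \<beta>)) \<longlonglongrightarrow> 0 * (c / \<beta>)"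
        using \<epsilon>_lim by (intro tendsto_mult_right) (simp add: filterlim_at)
      moreover have "real ((Suc j)\<^sup>2) * (\<epsilon> j ^ 3 * (c / \<beta>)) = \<epsilon> j * (c / \<beta>)" for j
      proof -
        have "real ((Suc j)\<^sup>2) * \<epsilon> j ^ 2 = 1" by (simp add: \<epsilon>_def power_one_over)
        then show ?thesis by (simp add: power3_eq_cube power2_eq_square mult.assoc[symmetric])
      qed
      ultimately have "(\<lambda>j. real ((Suc j)\<^sup>2) * (\<epsilon> j ^ 3 * (c / \<beta>))) \<longlonglongrightarrow> 0"
        by (simp only: mult_zero_left)
      then have "(\<lambda>j. ennreal (real ((Suc j)\<^sup>2) * (\<epsilon> j ^ 3 * (c / \<beta>)))) \<longlonglongrightarrow> 0"
        using tendsto_ennrealI by fastforce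
      then show "(\<lambda>j. of_nat ((Suc j)\<^sup>2) * ennreal (\<epsilon> j ^ 3 * (c / \<beta>))) \<longlonglongrightarrow> 0"
        by (simp only: ennreal_mult' ennreal_of_nat_eq_real_of_nat of_nat_0_le_iff)
      have "(\<lambda>j. real ((Suc j)\<^sup>2) * \<epsilon> j) = (\<lambda>j. real (Suc j))"
        by (simp only: \<epsilon>_def of_nat_mult power2_eq_square times_divide_eq_right mult_1_right
            nonzero_mult_div_cancel_right of_nat_eq_0_iff nat.distinct not_False_eq_True)
      then have "filterlim (\<lambda>j. real ((Suc j)\<^sup>2) * \<epsilon> j) at_top sequentially"
        by (simp only: filterlim_compose[OF filterlim_real_sequentially filterlim_Suc])
      then show "(\<lambda>j. b j ((Suc j)\<^sup>2)) \<longlonglongrightarrow> 0" unfolding b_def by (rule tail0)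
    qed
    show "(\<integral>\<^sup>+ x. g j x \<partial>lborel) = m j" for j
      unfolding g_def m_def by (rule nn_integral_gmix) (auto simp: head_weight_def)
    show "0 < m j" "m j < \<infinity>" for j
      unfolding m_def using \<epsilon>[of j] \<beta> by (auto simp: nn_integral_head_weight)
    show "(\<lambda>j. conv (g j) f x / m j) \<longlonglongrightarrow> f x"
      if "f \<in> borel_measurable borel" "\<And>y. f y \<le> ennreal L" "isCont f x" for f L and x :: 'a
      unfolding g_def m_def
      by (rule filterlim_compose[OF conv_gmix_head_tendsto[OF that \<beta>(1) c] \<epsilon>_lim])
    have qh: "q n = (\<lambda>x. gauss (real (Suc n)) x / h n 0)" for n by (simp add: q_def divide_ennreal_def)
    show "q n \<in> borel_measurable borel" for n unfolding q_def by measurable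
    show "conv (q n) (gmix (power_weight c \<beta> 0)) x \<le> 1" for n and x :: 'a
      unfolding qh h_def by (rule conv_normalized_gauss_le_1) (use c \<beta> in auto)
    show "(\<lambda>n. conv (q n) (gmix (power_weight c \<beta> 0)) x) \<longlonglongrightarrow> 1" for x :: 'a
      unfolding qh h_def by (rule conv_normalized_gauss_tendsto_1) (use c \<beta> in auto)
  qed simp_all
  moreover have "(gmix (power_weight c \<beta> 0) :: 'a \<Rightarrow> ennreal) = (\<lambda>x. riesz_power DIM('a) \<alpha> (norm x))"
    using k by (auto simp: \<beta>_def)
  ultimately have "potential_kernel (\<lambda>x::'a. riesz_power DIM('a) \<alpha> (norm x)) p g q m b" by simp
  then show ?thesis by blast
qed

section \<open>Domination principle\<close>

context potential_kernel
begin

definition pot :: "'a measure \<Rightarrow> 'a \<Rightarrow> ennreal" where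
  "pot M x = (\<integral>\<^sup>+ t. k (x - t) \<partial>M)"

lemma funpow_conv_measurable [measurable]:
  assumes [measurable]: "f \<in> borel_measurable borel"
  shows "(conv (p j) ^^ n) f \<in> borel_measurable borel"
  by (induction n) auto

lemma funpow_conv_mono:
  assumes "\<And>x. f x \<le> h x"
  shows "(conv (p j) ^^ n) f x \<le> (conv (p j) ^^ n) h x"
  by (induction n arbitrary: x) (auto intro!: conv_mono assms)

lemma funpow_conv_conv:
  assumes [measurable]: "f \<in> borel_measurable borel" "h \<in> borel_measurable borel"
  shows "(conv (p j) ^^ n) (conv f h) = conv ((conv (p j) ^^ n) f) h"
  by (induction n) (auto simp: conv_assoc)

lemma pot_measurable [measurable]:
  assumes "finite_measure M" and [measurable_cong]: "sets M = sets borel"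
  shows "pot M \<in> borel_measurable borel"
proof -
  interpret finite_measure M by fact
  show ?thesis unfolding pot_def by measurable
qed

lemma conv_shift:
  fixes f h :: "'a \<Rightarrow> ennreal"
  assumes "finite_measure M" and [measurable_cong]: "sets M = sets borel"
    and [measurable]: "f \<in> borel_measurable borel" "h \<in> borel_measurable borel"
  shows "conv f (\<lambda>x. \<integral>\<^sup>+ t. h (x - t) \<partial>M) x = (\<integral>\<^sup>+ t. conv f h (x - t) \<partial>M)"
proof -
  interpret finite_measure M by fact
  interpret P: pair_sigma_finite M "lborel :: 'a measure" ..
  have "conv f (\<lambda>x. \<integral>\<^sup>+ t. h (x - t) \<partial>M) x = (\<integral>\<^sup>+ y. \<integral>\<^sup>+ t. f y * h (x - y - t) \<partial>M \<partial>lborel)"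
    unfolding conv_def by (simp add: nn_integral_cmult)
  also have "\<dots> = (\<integral>\<^sup>+ t. \<integral>\<^sup>+ y. f y * h (x - y - t) \<partial>lborel \<partial>M)"
    by (rule P.Fubini') simp
  finally show ?thesis by (simp add: conv_def diff_diff_eq add.commute)
qed

lemma funpow_conv_shift:
  assumes M: "finite_measure M" "sets M = sets borel" and [measurable]: "h \<in> borel_measurable borel"
  shows "(conv (p j) ^^ n) (\<lambda>x. \<integral>\<^sup>+ t. h (x - t) \<partial>M) x = (\<integral>\<^sup>+ t. (conv (p j) ^^ n) h (x - t) \<partial>M)"
proof (induction n arbitrary: x)
  case (Suc n)
  have "(conv (p j) ^^ n) (\<lambda>x. \<integral>\<^sup>+ t. h (x - t) \<partial>M) = (\<lambda>x. \<integral>\<^sup>+ t. (conv (p j) ^^ n) h (x - t) \<partial>M)"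
    using Suc.IH by (rule ext)
  then show ?case by (simp add: conv_shift[OF M])
qed simp

lemma pot_decomp:
  assumes M: "finite_measure M" and s[measurable_cong]: "sets M = sets borel"
  shows "pot M x = conv (p j) (pot M) x + (\<integral>\<^sup>+ t. g j (x - t) \<partial>M)"
proof -
  have "pot M x = (\<integral>\<^sup>+ t. conv (p j) k (x - t) + g j (x - t) \<partial>M)"
    unfolding pot_def using decomp by (intro nn_integral_cong)
  also have "\<dots> = (\<integral>\<^sup>+ t. conv (p j) k (x - t) \<partial>M) + (\<integral>\<^sup>+ t. g j (x - t) \<partial>M)"
    by (rule nn_integral_add) auto
  finally show ?thesis unfolding pot_def[abs_def] by (simp add: conv_shift[OF M s])
qed

lemma conv_pot_le:
  assumes "finite_measure M" "sets M = sets borel"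
  shows "conv (p j) (pot M) x \<le> pot M x"
  by (metis le_iff_add pot_decomp[OF assms])

lemma funpow_pot_le:
  assumes "finite_measure M" "sets M = sets borel"
  shows "(conv (p j) ^^ n) (pot M) x \<le> b j n * emeasure M UNIV"
proof -
  have sp: "space M = UNIV" using sets_eq_imp_space_eq[OF assms(2)] by simp
  have "(conv (p j) ^^ n) (pot M) x = (\<integral>\<^sup>+ t. (conv (p j) ^^ n) k (x - t) \<partial>M)"
    unfolding pot_def[abs_def] by (rule funpow_conv_shift[OF assms]) simp
  also have "\<dots> \<le> (\<integral>\<^sup>+ t. b j n \<partial>M)" by (intro nn_integral_mono iterates)
  finally show ?thesis by (simp add: sp)
qed

text \<open>A discrete maximum principle: away from \<open>K\<close> the potential is almost \<open>p j\<close>-harmonic, so an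
  excess over \<open>S\<close> there can only be transported to infinity, where the iterates of \<open>pot M\<close> vanish.\<close>

lemma domination_principle:
  assumes M: "finite_measure M" "sets M = sets borel" and K: "emeasure M (- K) = 0" "- K \<in> sets borel"
    and [measurable]: "S \<in> borel_measurable borel" and S: "\<And>j x. conv (p j) S x \<le> S x"
    and "0 < d" and near: "\<And>x t. t \<in> K \<Longrightarrow> dist x t < d \<Longrightarrow> pot M x \<le> S x + \<delta>"
  shows "pot M x \<le> S x + \<delta>"
proof -
  interpret finite_measure M by fact
  note [measurable_cong] = M(2)
  note [measurable] = pot_measurable[OF M]
  have sp: "space M = UNIV" using sets_eq_imp_space_eq[OF M(2)] by simp
  define c where "c = emeasure M UNIV"
  have c: "c < \<infinity>" by (simp add: c_def less_top[symmetric])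
  obtain N \<tau> where \<tau>: "\<forall>\<^sub>F j in sequentially. \<forall>x. d \<le> norm x \<longrightarrow> g j x \<le> \<tau> j"
    and Nt: "(\<lambda>j. of_nat (N j) * \<tau> j) \<longlonglongrightarrow> 0" and Nb: "(\<lambda>j. b j (N j)) \<longlonglongrightarrow> 0"
    using far[OF \<open>0 < d\<close>] by blast
  have inK: "AE t in M. t \<in> K"
    using K M(2) by (intro AE_I[where N = "- K"]) auto
  \<comment> \<open>Induction on the number n of steps. Near K the claim is \<open>near\<close>;
    elsewhere one more step maps S below itself, preserves the constants, and costs at most \<tau> j
    times the mass of M.\<close>
  have bound: "pot M x \<le> S x + \<delta> + (conv (p j) ^^ n) (pot M) x + of_nat n * (\<tau> j * c)"
    if j: "\<forall>x. d \<le> norm x \<longrightarrow> g j x \<le> \<tau> j" for j n x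
  proof (induction n arbitrary: x)
    case (Suc n)
    show ?case
    proof (cases "\<exists>t\<in>K. dist x t < d")
      case True
      then have "pot M x \<le> S x + \<delta>" using near by blast
      then show ?thesis by (rule add_increasing2[OF zero_le add_increasing2[OF zero_le]])
    next
      case False
      have "(\<integral>\<^sup>+ t. g j (x - t) \<partial>M) \<le> (\<integral>\<^sup>+ t. \<tau> j \<partial>M)"
      proof (rule nn_integral_mono_AE, use inK in eventually_elim)
        fix t assume "t \<in> K"
        then have "d \<le> norm (x - t)" using False by (auto simp: dist_norm not_less)
        then show "g j (x - t) \<le> \<tau> j" using j by blast
      qed
      also have "\<dots> = \<tau> j * c" by (simp add: c_def sp)
      finally have 1: "(\<integral>\<^sup>+ t. g j (x - t) \<partial>M) \<le> \<tau> j * c" .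
      have "conv (p j) (pot M) x
        \<le> conv (p j) (\<lambda>x. S x + \<delta> + (conv (p j) ^^ n) (pot M) x + of_nat n * (\<tau> j * c)) x"
        by (intro conv_mono Suc.IH) simp
      also have "\<dots> = conv (p j) S x + \<delta> + (conv (p j) ^^ Suc n) (pot M) x + of_nat n * (\<tau> j * c)"
        by (simp add: conv_add_right conv_const_right nn_integral_p)
      also have "\<dots> \<le> S x + \<delta> + (conv (p j) ^^ Suc n) (pot M) x + of_nat n * (\<tau> j * c)"
        by (intro add_mono S order_refl)
      finally have "conv (p j) (pot M) x + (\<integral>\<^sup>+ t. g j (x - t) \<partial>M)
        \<le> S x + \<delta> + (conv (p j) ^^ Suc n) (pot M) x + of_nat n * (\<tau> j * c) + \<tau> j * c"
        using 1 by (rule add_mono)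
      then show ?thesis
        by (subst pot_decomp[OF M, of _ j]) (simp add: distrib_right add.assoc add.commute[of "\<tau> j * c"])
    qed
  qed simp
  \<comment> \<open>With n = \<open>N j\<close> both error terms vanish in the limit.\<close>
  have "(\<lambda>j. c * b j (N j) + c * (of_nat (N j) * \<tau> j)) \<longlonglongrightarrow> c * 0 + c * 0"
    using c by (intro tendsto_add ennreal_tendsto_cmult Nt Nb) auto
  then have lim: "(\<lambda>j. (S x + \<delta>) + (c * b j (N j) + c * (of_nat (N j) * \<tau> j))) \<longlonglongrightarrow> (S x + \<delta>) + 0"
    by (intro tendsto_add tendsto_const) simp
  have "\<forall>\<^sub>F j in sequentially. pot M x \<le> (S x + \<delta>) + (c * b j (N j) + c * (of_nat (N j) * \<tau> j))"
    using \<tau>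
  proof eventually_elim
    case (elim j)
    have "pot M x \<le> S x + \<delta> + (conv (p j) ^^ N j) (pot M) x + of_nat (N j) * (\<tau> j * c)"
      by (rule bound[OF elim])
    also have "\<dots> \<le> S x + \<delta> + b j (N j) * c + of_nat (N j) * (\<tau> j * c)"
      unfolding c_def by (intro add_mono order_refl funpow_pot_le M)
    finally show ?case by (simp add: mult_ac add.assoc)
  qed
  then have "pot M x \<le> (S x + \<delta>) + 0"
    by (rule tendsto_lowerbound[OF lim _ trivial_limit_sequentially])
  then show ?thesis by simp
qed

section \<open>Charges of bounded superharmonic functions\<close>

context
  fixes j :: nat and u :: "'a \<Rightarrow> ennreal" and L :: real and c :: 'a
  assumes u_meas [measurable]: "u \<in> borel_measurable borel" and u_le: "\<And>x. u x \<le> ennreal L"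
    and u_super: "\<And>x. conv (p j) u x \<le> u x" and u_k: "\<And>x. u x \<le> k (x - c)"
begin

definition charge :: "'a \<Rightarrow> ennreal" where
  "charge x = u x - conv (p j) u x"

text \<open>Partial sums of the Neumann series that arises from iterating \<open>decomp\<close>; by
  \<open>iterates\<close> and \<open>b_tendsto\<close> they exhaust k.\<close>

definition green :: "nat \<Rightarrow> 'a \<Rightarrow> ennreal" where
  "green n x = (\<Sum>i<n. (conv (p j) ^^ i) (g j) x)"

lemma charge_measurable [measurable]: "charge \<in> borel_measurable borel"
  unfolding charge_def by measurable

lemma green_measurable [measurable]: "green n \<in> borel_measurable borel"
  unfolding green_def by measurable

lemma u_eq: "u = (\<lambda>x. conv (p j) u x + charge x)"
  using u_super by (auto simp: charge_def fun_eq_iff add.commute[of "conv _ _ _"] diff_add_cancel_ennreal)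

lemma k_eq_green: "k x = (conv (p j) ^^ n) k x + green n x"
proof (induction n arbitrary: x)
  case (Suc n)
  have "(conv (p j) ^^ n) k x = (conv (p j) ^^ Suc n) k x + (conv (p j) ^^ n) (g j) x" for x
  proof (induction n arbitrary: x)
    case 0
    show ?case using decomp by simp
  next
    case (Suc n)
    have "(conv (p j) ^^ n) k = (\<lambda>x. (conv (p j) ^^ Suc n) k x + (conv (p j) ^^ n) (g j) x)"
      by (intro ext Suc.IH)
    then have "(conv (p j) ^^ Suc n) k x = conv (p j) (\<lambda>x. (conv (p j) ^^ Suc n) k x + (conv (p j) ^^ n) (g j) x) x"
      by (simp only: funpow.simps comp_apply)
    also have "\<dots> = (conv (p j) ^^ Suc (Suc n)) k x + (conv (p j) ^^ Suc n) (g j) x"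
      by (subst conv_add_right) auto
    finally show ?case .
  qed
  then show ?case using Suc.IH[of x] by (simp add: green_def add_ac)
qed (simp add: green_def)

text \<open>Telescoping: each summand of \<open>green n\<close> is paired with the difference of u
  and conv (p j) u. The remainder is carried as an added term.\<close>

lemma conv_g_eq: "conv (g j) u x = conv ((conv (p j) ^^ n) (g j)) u x + conv (green n) charge x"
proof (induction n arbitrary: x)
  case 0
  show ?case by (simp add: green_def conv_def)
next
  case (Suc n)
  let ?G = "(conv (p j) ^^ n) (g j)"
  have "conv ?G u x = conv ?G (\<lambda>x. conv (p j) u x + charge x) x" by (simp only: u_eq[symmetric])
  also have "\<dots> = conv ?G (conv (p j) u) x + conv ?G charge x" by (rule conv_add_right) auto
  also have "conv ?G (conv (p j) u) = conv (conv (p j) ?G) u"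
    by (subst conv_commute[of "p j" ?G]) (auto simp: conv_assoc)
  finally have "conv ?G u x = conv ((conv (p j) ^^ Suc n) (g j)) u x + conv ?G charge x" by simp
  moreover have "conv (green (Suc n)) charge x = conv (green n) charge x + conv ?G charge x"
    using conv_add_left[of "green n" ?G charge x] by (simp add: green_def[abs_def])
  ultimately show ?case using Suc.IH[of x] by (simp add: add_ac)
qed

text \<open>The limit of \<open>conv_g_eq\<close> for large n. It exhibits
  \<open>conv (g j) u\<close>, which divided by \<open>m j\<close> approximates u, as the potential
  of an explicit nonnegative density.\<close>

lemma conv_k_charge: "conv k charge x = conv (g j) u x"
proof (rule antisym)
  have inc: "green n y \<le> green (Suc n) y" for n y by (simp add: green_def)
  have k_le: "k y \<le> (SUP n. green n y)" for y
  proof -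
    have "k y \<le> b j n + (SUP n. green n y)" for n
      by (subst k_eq_green[of y n]) (intro add_mono iterates SUP_upper UNIV_I)
    moreover have "(\<lambda>n. b j n + (SUP n. green n y)) \<longlonglongrightarrow> 0 + (SUP n. green n y)"
      by (intro tendsto_add tendsto_const b_tendsto)
    ultimately show ?thesis
      using LIMSEQ_le_const[of _ "0 + (SUP n. green n y)" "k y"] by auto
  qed
  have "conv k charge x \<le> (\<integral>\<^sup>+ y. (SUP n. green n y * charge (x - y)) \<partial>lborel)"
    unfolding conv_def by (intro nn_integral_mono) (simp add: SUP_mult_right_ennreal[symmetric] mult_right_mono k_le)
  also have "\<dots> = (SUP n. conv (green n) charge x)"
    unfolding conv_def
    by (rule nn_integral_monotone_convergence_SUP) (auto intro!: incseq_SucI le_funI mult_right_mono inc)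
  also have "\<dots> \<le> conv (g j) u x"
  proof (rule SUP_least)
    fix n show "conv (green n) charge x \<le> conv (g j) u x" by (subst conv_g_eq[where n = n]) simp
  qed
  finally show "conv k charge x \<le> conv (g j) u x" .
next
  \<comment> \<open>The remainder vanishes because u lies below a single translated kernel, whose
    iterates tend to 0 uniformly. The translate is written as the potential of a point mass so that
    \<open>funpow_conv_shift\<close> applies.\<close>
  have up: "(conv (p j) ^^ n) u y \<le> b j n" for n y
  proof -
    have "(conv (p j) ^^ n) u y \<le> (conv (p j) ^^ n) (\<lambda>x. \<integral>\<^sup>+ t. k (x - t) \<partial>return borel c) y"
      by (intro funpow_conv_mono) (simp add: nn_integral_return u_k)
    also have "\<dots> = (\<integral>\<^sup>+ t. (conv (p j) ^^ n) k (y - t) \<partial>return borel c)"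
      using prob_space_return[of c borel] by (subst funpow_conv_shift) (auto simp: prob_space_def)
    also have "\<dots> = (conv (p j) ^^ n) k (y - c)"
      by (subst nn_integral_return) auto
    finally show ?thesis using iterates order_trans by blast
  qed
  have "conv (g j) u x \<le> m j * b j n + conv k charge x" for n
  proof -
    have "conv ((conv (p j) ^^ n) (g j)) u x = conv (g j) ((conv (p j) ^^ n) u) x"
    proof -
      have "conv ((conv (p j) ^^ n) (g j)) u = (conv (p j) ^^ n) (conv (g j) u)"
        by (rule funpow_conv_conv[symmetric]) measurable
      also have "conv (g j) u = conv u (g j)" by (rule conv_commute) measurable
      also have "(conv (p j) ^^ n) (conv u (g j)) = conv ((conv (p j) ^^ n) u) (g j)"
        by (rule funpow_conv_conv) measurable
      also have "\<dots> = conv (g j) ((conv (p j) ^^ n) u)" by (rule conv_commute) measurable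
      finally show ?thesis by simp
    qed
    also have "\<dots> \<le> conv (g j) (\<lambda>_. b j n) x" by (intro conv_mono up) simp
    also have "\<dots> = m j * b j n" by (simp add: conv_const_right nn_integral_g)
    finally have "conv ((conv (p j) ^^ n) (g j)) u x \<le> m j * b j n" .
    moreover have "conv (green n) charge x \<le> conv k charge x"
      by (intro conv_mono order_refl) (subst k_eq_green[where n = n], simp)
    ultimately show ?thesis by (subst conv_g_eq) (intro add_mono)
  qed
  moreover have "(\<lambda>n. m j * b j n + conv k charge x) \<longlonglongrightarrow> m j * 0 + conv k charge x"
    using m(2)[of j] by (intro tendsto_add tendsto_const ennreal_tendsto_cmult b_tendsto) auto
  ultimately show "conv (g j) u x \<le> conv k charge x"
    using LIMSEQ_le_const[of _ "m j * 0 + conv k charge x" "conv (g j) u x"] by auto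
qed

text \<open>Tested against the potential of \<open>q n\<close>, the charge gives conv (g j) (conv (q
  n) u) at 0, and u \<le> k (x - c) bounds conv (q n) u by 1. The test functions tend to 1, so
  Fatou's lemma bounds the mass itself.\<close>

lemma nn_integral_charge: "(\<integral>\<^sup>+ x. charge x \<partial>lborel) \<le> m j"
proof -
  have le: "(\<integral>\<^sup>+ y. charge y * conv (q n) k (0 - y) \<partial>lborel) \<le> m j" for n
  proof -
    have "(\<integral>\<^sup>+ y. charge y * conv (q n) k (0 - y) \<partial>lborel) = conv charge (conv (q n) k) 0"
      by (simp add: conv_def)
    also have "\<dots> = conv (q n) (conv k charge) 0"
      by (subst conv_commute) (auto simp: conv_assoc)
    also have "\<dots> = conv (q n) (conv (g j) u) 0" using conv_k_charge by (simp add: conv_def)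
    also have "\<dots> = conv (g j) (conv (q n) u) 0"
    proof -
      have "conv (q n) (conv (g j) u) = conv (conv (q n) (g j)) u" by (rule conv_assoc[symmetric]) measurable
      also have "conv (q n) (g j) = conv (g j) (q n)" by (rule conv_commute) measurable
      also have "conv (conv (g j) (q n)) u = conv (g j) (conv (q n) u)" by (rule conv_assoc) measurable
      finally show ?thesis by simp
    qed
    also have "\<dots> \<le> conv (g j) (\<lambda>_. 1) 0"
    proof (rule conv_mono[OF order_refl])
      fix x
      have "conv (q n) u x \<le> conv (q n) (\<lambda>x. k (x - c)) x" by (intro conv_mono u_k) simp
      also have "\<dots> = conv (q n) k (x - c)" by (simp add: conv_def diff_diff_eq add.commute)
      also have "\<dots> \<le> 1" by (rule q_le)
      finally show "conv (q n) u x \<le> 1" .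
    qed
    finally show ?thesis by (simp add: conv_const_right nn_integral_g)
  qed
  have "(\<integral>\<^sup>+ y. charge y \<partial>lborel) = (\<integral>\<^sup>+ y. liminf (\<lambda>n. charge y * conv (q n) k (0 - y)) \<partial>lborel)"
  proof (rule nn_integral_cong)
    fix y
    have "charge y < top" using u_le[of y] unfolding charge_def
      by (meson diff_le_self_ennreal ennreal_less_top order_le_less_trans)
    then have "(\<lambda>n. charge y * conv (q n) k (0 - y)) \<longlonglongrightarrow> charge y * 1"
      by (intro ennreal_tendsto_cmult q_tendsto)
    then show "charge y = liminf (\<lambda>n. charge y * conv (q n) k (0 - y))"
      by (simp add: lim_imp_Liminf)
  qed
  also have "\<dots> \<le> liminf (\<lambda>n. \<integral>\<^sup>+ y. charge y * conv (q n) k (0 - y) \<partial>lborel)"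
    by (rule nn_integral_liminf) simp
  also have "\<dots> \<le> m j" using le by (intro Liminf_le) auto
  finally show ?thesis .
qed

end

lemma nn_integral_conv_k:
  assumes "finite_measure M" and [measurable_cong]: "sets M = sets borel" and [measurable]: "r \<in> borel_measurable borel"
  shows "(\<integral>\<^sup>+ x. conv k r x \<partial>M) = (\<integral>\<^sup>+ y. r y * pot M y \<partial>lborel)"
proof -
  interpret finite_measure M by fact
  interpret P: pair_sigma_finite M "lborel :: 'a measure" ..
  have "(\<integral>\<^sup>+ x. conv k r x \<partial>M) = (\<integral>\<^sup>+ x. \<integral>\<^sup>+ y. r y * k (y - x) \<partial>lborel \<partial>M)"
    by (subst conv_commute) (auto simp: conv_def even[of "_ - _", simplified, symmetric] intro!: nn_integral_cong)
  also have "\<dots> = (\<integral>\<^sup>+ y. \<integral>\<^sup>+ x. r y * k (y - x) \<partial>M \<partial>lborel)"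
    by (rule P.Fubini'[symmetric]) simp
  also have "\<dots> = (\<integral>\<^sup>+ y. r y * pot M y \<partial>lborel)" unfolding pot_def by (simp add: nn_integral_cmult)
  finally show ?thesis .
qed

text \<open>\<open>u\<close> is a limit of potentials of charges of total mass at most 1, so an inequality between
  potentials can be integrated against these charges.\<close>

lemma nn_integral_superharmonic_le:
  fixes I :: "'i set"
  assumes M: "finite_measure M" "sets M = sets borel"
    and N: "finite I" "\<And>i. i \<in> I \<Longrightarrow> finite_measure (N i)" "\<And>i. i \<in> I \<Longrightarrow> sets (N i) = sets borel"
    and le: "\<And>x. pot M x \<le> (\<Sum>i\<in>I. pot (N i) x) + e"
    and u [measurable]: "u \<in> borel_measurable borel" and u_le: "\<And>x. u x \<le> ennreal L"
    and u_super: "\<And>j x. conv (p j) u x \<le> u x" and u_k: "\<And>x. u x \<le> k (x - c)" and u_cont: "\<And>x. isCont u x"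
  shows "(\<integral>\<^sup>+ x. u x \<partial>M) \<le> (\<Sum>i\<in>I. \<integral>\<^sup>+ x. u x \<partial>N i) + e"
proof -
  have lim: "(\<lambda>j. \<integral>\<^sup>+ x. conv (g j) u x / m j \<partial>R) \<longlonglongrightarrow> (\<integral>\<^sup>+ x. u x \<partial>R)"
    if "finite_measure R" and [measurable_cong]: "sets R = sets borel" for R
  proof (rule nn_integral_dominated_convergence[where w = "\<lambda>_. ennreal L"])
    interpret finite_measure R by fact
    show "(\<integral>\<^sup>+ x. ennreal L \<partial>R) < \<infinity>" by (simp add: less_top[symmetric] ennreal_mult_eq_top_iff)
    show "AE x in R. conv (g j) u x / m j \<le> ennreal L" for j
    proof (rule AE_I2)
      fix x
      have "conv (g j) u x \<le> conv (g j) (\<lambda>_. ennreal L) x" by (intro conv_mono u_le) simp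
      also have "\<dots> = m j * ennreal L" by (simp add: conv_const_right nn_integral_g)
      finally show "conv (g j) u x / m j \<le> ennreal L" using m[of j] by (intro divide_le_posI_ennreal) (auto simp: mult.commute)
    qed
    show "AE x in R. (\<lambda>j. conv (g j) u x / m j) \<longlonglongrightarrow> u x"
      using approx[OF u u_le u_cont] by simp
  qed simp_all
  have "(\<integral>\<^sup>+ x. conv (g j) u x / m j \<partial>M) \<le> (\<Sum>i\<in>I. \<integral>\<^sup>+ x. conv (g j) u x / m j \<partial>N i) + e" for j
  proof -
    define r where "r = charge j u"
    have r[measurable]: "r \<in> borel_measurable borel"
      unfolding r_def by (rule charge_measurable[OF u u_le u_super u_k])
    have cg: "conv (g j) u = conv k r"
      unfolding r_def by (intro ext conv_k_charge[OF u u_le u_super u_k, symmetric])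
    have int: "(\<integral>\<^sup>+ x. conv (g j) u x / m j \<partial>R) = (\<integral>\<^sup>+ y. r y * pot R y \<partial>lborel) / m j"
      if "finite_measure R" and [measurable_cong]: "sets R = sets borel" for R
      unfolding nn_integral_conv_k[OF that r, symmetric] cg by (rule nn_integral_divide) simp
    have [measurable]: "i \<in> I \<Longrightarrow> pot (N i) \<in> borel_measurable borel" for i
      using N by simp
    have "(\<integral>\<^sup>+ y. r y * pot M y \<partial>lborel) \<le> (\<integral>\<^sup>+ y. r y * ((\<Sum>i\<in>I. pot (N i) y) + e) \<partial>lborel)"
      by (intro nn_integral_mono mult_left_mono le) simp
    also have "\<dots> = (\<Sum>i\<in>I. \<integral>\<^sup>+ y. r y * pot (N i) y \<partial>lborel) + (\<integral>\<^sup>+ y. r y \<partial>lborel) * e"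
      by (simp add: distrib_left sum_distrib_left nn_integral_add nn_integral_sum nn_integral_multc)
    \<comment> \<open>The mass bound of the charge is what lets e enter, after division by
      \<open>m j\<close>, without a factor.\<close>
    also have "\<dots> \<le> (\<Sum>i\<in>I. \<integral>\<^sup>+ y. r y * pot (N i) y \<partial>lborel) + m j * e"
      unfolding r_def by (intro add_mono order_refl mult_right_mono nn_integral_charge[OF u u_le u_super u_k]) simp
    finally have "(\<integral>\<^sup>+ x. conv (g j) u x / m j \<partial>M)
      \<le> ((\<Sum>i\<in>I. \<integral>\<^sup>+ y. r y * pot (N i) y \<partial>lborel) + m j * e) / m j"
      unfolding int[OF M] by (rule divide_right_mono_ennreal)
    also have "\<dots> = (\<Sum>i\<in>I. (\<integral>\<^sup>+ y. r y * pot (N i) y \<partial>lborel) / m j) + e"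
    proof -
      have "m j * e / m j = e" using m[of j] by (subst mult.commute) (simp add: ennreal_mult_divide_eq)
      then show ?thesis by (simp add: divide_ennreal_def distrib_right sum_distrib_right)
    qed
    also have "\<dots> = (\<Sum>i\<in>I. \<integral>\<^sup>+ x. conv (g j) u x / m j \<partial>N i) + e"
      using N by (simp add: int)
    finally show ?thesis .
  qed
  moreover have "(\<lambda>j. (\<Sum>i\<in>I. \<integral>\<^sup>+ x. conv (g j) u x / m j \<partial>N i) + e) \<longlonglongrightarrow> (\<Sum>i\<in>I. \<integral>\<^sup>+ x. u x \<partial>N i) + e"
    using N by (intro tendsto_add tendsto_sum tendsto_const lim)
  ultimately show ?thesis
    by (intro LIMSEQ_le[OF lim[OF M]]) auto
qed

end

section \<open>Maximum principle\<close>

lemma riesz_power_antimono: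
  assumes "0 \<le> r" "r \<le> r'" "\<alpha> < real N"
  shows "riesz_power N \<alpha> r' \<le> riesz_power N \<alpha> r"
  using assms by (auto simp: riesz_power_def intro!: ennreal_leI powr_mono2')

lemma riesz_power_half:
  assumes "0 \<le> r" "\<alpha> < real N"
  shows "riesz_power N \<alpha> (r / 2) = ennreal (2 powr (real N - \<alpha>)) * riesz_power N \<alpha> r"
proof (cases "r = 0")
  case False
  have "(r / 2) powr (\<alpha> - real N) = r powr (\<alpha> - real N) / 2 powr (\<alpha> - real N)"
    using assms by (simp add: powr_divide)
  also have "\<dots> = 2 powr (real N - \<alpha>) * r powr (\<alpha> - real N)"
    using powr_minus[of 2 "\<alpha> - real N"] by (simp add: divide_inverse)
  finally show ?thesis using False by (simp add: riesz_power_def ennreal_mult)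
qed (simp add: riesz_power_def ennreal_mult_top)

text \<open>Continuity is meant in [0, \<infinity>] and includes the origin, where
  \<open>riesz_power\<close> has the value \<infinity>. Lower semicontinuity of potentials and
  continuity of truncated kernels rest on this.\<close>

lemma isCont_riesz_power:
  fixes x :: "'a::euclidean_space"
  assumes "\<alpha> < real N"
  shows "isCont (\<lambda>x. riesz_power N \<alpha> (norm x)) x"
proof (cases "x = 0")
  case False
  have "continuous_on (- {0}) (\<lambda>x::'a. ennreal (norm x powr (\<alpha> - real N)))"
    by (intro continuous_intros continuous_on_ennreal) auto
  then have "continuous_on (- {0}) (\<lambda>x::'a. riesz_power N \<alpha> (norm x))"
    by (rule continuous_on_eq) (auto simp: riesz_power_def)
  then show ?thesis
    using False by (subst (asm) continuous_on_eq_continuous_at) auto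
next
  case True
  have "((\<lambda>x::'a. riesz_power N \<alpha> (norm x)) \<longlongrightarrow> top) (at 0)"
    unfolding tendsto_top_iff_ennreal
  proof (intro allI impI)
    fix l :: real assume "0 \<le> l"
    define d where "d = (l + 1) powr (1 / (\<alpha> - real N))"
    have d: "0 < d" "d powr (\<alpha> - real N) = l + 1"
      using \<open>0 \<le> l\<close> assms by (auto simp: d_def powr_powr)
    have "ennreal l < riesz_power N \<alpha> (norm y)" if "y \<noteq> 0" "norm y < d" for y :: 'a
    proof -
      have "l < norm y powr (\<alpha> - real N)"
        using powr_less_mono2_neg[of "\<alpha> - real N" "norm y" d] that d assms by simp
      then show ?thesis using that \<open>0 \<le> l\<close> by (simp add: riesz_power_def ennreal_lessI)
    qed
    then show "\<forall>\<^sub>F y in at (0::'a). ennreal l < riesz_power N \<alpha> (norm y)"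
      unfolding eventually_at using d(1) by (auto simp: dist_norm)
  qed
  then show ?thesis using True by (simp add: isCont_def riesz_power_def)
qed

lemma borel_measurable_riesz_power [measurable]: "riesz_power N \<alpha> \<in> borel_measurable borel"
  unfolding riesz_power_def[abs_def] by measurable

text \<open>The sequential form is the one that Fatou's lemma delivers for integrals; in first
  countable spaces it yields closed sublevel sets and attained minima on compact sets.\<close>

definition seq_lsc :: "('a::topological_space \<Rightarrow> ennreal) \<Rightarrow> bool" where
  "seq_lsc f \<longleftrightarrow> (\<forall>X x. X \<longlonglongrightarrow> x \<longrightarrow> f x \<le> liminf (\<lambda>n. f (X n)))"

lemma seq_lscD: "seq_lsc f \<Longrightarrow> X \<longlonglongrightarrow> x \<Longrightarrow> f x \<le> liminf (\<lambda>n. f (X n))"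
  unfolding seq_lsc_def by blast

lemma seq_lsc_const: "seq_lsc (\<lambda>_. c)"
  unfolding seq_lsc_def by (simp add: Liminf_const)

lemma liminf_add_le_ennreal:
  fixes f g :: "nat \<Rightarrow> ennreal"
  shows "liminf f + liminf g \<le> liminf (\<lambda>n. f n + g n)"
proof -
  have "liminf f + liminf g = (SUP N. (INF n\<in>{N..}. f n) + (INF n\<in>{N..}. g n))"
    unfolding liminf_SUP_INF
    by (rule ennreal_SUP_add[symmetric]) (auto simp: incseq_def intro!: INF_superset_mono)
  also have "\<dots> \<le> (SUP N. INF n\<in>{N..}. f n + g n)"
    by (intro SUP_mono' INF_greatest add_mono INF_lower)
  finally show ?thesis by (simp add: liminf_SUP_INF)
qed

lemma seq_lsc_add:
  fixes f g :: "'a::topological_space \<Rightarrow> ennreal"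
  assumes "seq_lsc f" "seq_lsc g"
  shows "seq_lsc (\<lambda>x. f x + g x)"
  unfolding seq_lsc_def
proof (intro allI impI)
  fix X and x :: 'a assume X: "X \<longlonglongrightarrow> x"
  have "f x + g x \<le> liminf (\<lambda>n. f (X n)) + liminf (\<lambda>n. g (X n))"
    by (intro add_mono seq_lscD[OF _ X] assms)
  also have "\<dots> \<le> liminf (\<lambda>n. f (X n) + g (X n))"
    by (rule liminf_add_le_ennreal)
  finally show "f x + g x \<le> liminf (\<lambda>n. f (X n) + g (X n))" .
qed

lemma seq_lsc_sum: "(\<And>i. i \<in> I \<Longrightarrow> seq_lsc (f i)) \<Longrightarrow> seq_lsc (\<lambda>x. \<Sum>i\<in>I. f i x)"
  by (induction I rule: infinite_finite_induct) (auto intro!: seq_lsc_add seq_lsc_const)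

lemma seq_lsc_nn_integral:
  fixes f :: "'a::topological_space \<Rightarrow> 'b \<Rightarrow> ennreal"
  assumes "\<And>x. f x \<in> borel_measurable M" and "\<And>t X x. X \<longlonglongrightarrow> x \<Longrightarrow> (\<lambda>n. f (X n) t) \<longlonglongrightarrow> f x t"
  shows "seq_lsc (\<lambda>x. \<integral>\<^sup>+ t. f x t \<partial>M)"
  unfolding seq_lsc_def
proof (intro allI impI)
  fix X and x :: 'a assume X: "X \<longlonglongrightarrow> x"
  have "(\<integral>\<^sup>+ t. f x t \<partial>M) = (\<integral>\<^sup>+ t. liminf (\<lambda>n. f (X n) t) \<partial>M)"
    by (intro nn_integral_cong lim_imp_Liminf[symmetric] assms(2)[OF X]) simp
  also have "\<dots> \<le> liminf (\<lambda>n. \<integral>\<^sup>+ t. f (X n) t \<partial>M)"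
    by (rule nn_integral_liminf) (rule assms)
  finally show "(\<integral>\<^sup>+ t. f x t \<partial>M) \<le> liminf (\<lambda>n. \<integral>\<^sup>+ t. f (X n) t \<partial>M)" .
qed

lemma seq_lsc_le_closed:
  fixes f :: "'a::first_countable_topology \<Rightarrow> ennreal"
  assumes "seq_lsc f"
  shows "closed {x. f x \<le> c}"
  unfolding closed_sequential_limits
proof (intro allI impI, elim conjE)
  fix X x assume X: "\<forall>n. X n \<in> {x. f x \<le> c}" "X \<longlonglongrightarrow> x"
  have "f x \<le> liminf (\<lambda>n. f (X n))" by (rule seq_lscD[OF assms X(2)])
  also have "\<dots> \<le> c" using X(1) by (intro Liminf_le) auto
  finally show "x \<in> {x. f x \<le> c}" by simp
qed

lemma seq_lsc_attains_inf:
  fixes f :: "'a::first_countable_topology \<Rightarrow> ennreal"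
  assumes "seq_lsc f" "compact K" "K \<noteq> {}"
  shows "\<exists>x\<in>K. \<forall>y\<in>K. f x \<le> f y"
proof -
  obtain s where s: "range s \<subseteq> f ` K" "s \<longlonglongrightarrow> Inf (f ` K)"
    using Inf_as_limit[of "f ` K"] assms(3) by (auto simp: image_subset_iff)
  then have "\<forall>n. \<exists>x\<in>K. s n = f x" by auto
  then obtain X where X: "\<And>n. X n \<in> K" "\<And>n. s n = f (X n)" by metis
  obtain x r where x: "x \<in> K" "strict_mono r" "(X \<circ> r) \<longlonglongrightarrow> x"
    using compact_imp_seq_compact[OF assms(2), unfolded seq_compact_def, rule_format, of X] X(1) by blast
  have "(\<lambda>n. f ((X \<circ> r) n)) \<longlonglongrightarrow> Inf (f ` K)"
    using LIMSEQ_subseq_LIMSEQ[OF s(2) x(2)] by (simp add: comp_def X(2)[symmetric])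
  then have "f x \<le> Inf (f ` K)"
    using seq_lscD[OF assms(1) x(3)] by (simp add: lim_imp_Liminf)
  then show ?thesis using x(1) by (auto simp: le_INF_iff)
qed

lemma tendsto_minus_const_ennreal:
  fixes f :: "'a \<Rightarrow> ennreal"
  assumes "(f \<longlongrightarrow> x) F"
  shows "((\<lambda>i. f i - ennreal c) \<longlongrightarrow> x - ennreal c) F"
proof (cases "x = top")
  case True
  have "((\<lambda>i. f i - ennreal c) \<longlongrightarrow> top) F"
    unfolding tendsto_top_iff_ennreal
  proof (intro allI impI)
    fix l :: real assume "0 \<le> l"
    have "0 \<le> l + max 0 c" using \<open>0 \<le> l\<close> by simp
    then have "\<forall>\<^sub>F i in F. ennreal (l + max 0 c) < f i"
      by (rule assms[unfolded True tendsto_top_iff_ennreal, rule_format])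
    then show "\<forall>\<^sub>F i in F. ennreal l < f i - ennreal c"
    proof eventually_elim
      case (elim i)
      then have "ennreal c + ennreal l < f i"
        using \<open>0 \<le> l\<close> by (auto simp: max_def ennreal_neg add.commute split: if_splits)
      then show ?case by (simp add: less_diff_eq_ennreal add.commute)
    qed
  qed
  then show ?thesis using True by simp
qed (use assms in \<open>auto intro: tendsto_diff_ennreal\<close>)

section \<open>Tails of potentials and behaviour near the support\<close>

locale riesz_kernel = potential_kernel "\<lambda>x::real^'n. riesz_power CARD('n) \<alpha> (norm x)" p g q m b
  for \<alpha> :: real and p g q :: "nat \<Rightarrow> real^'n \<Rightarrow> ennreal" and m :: "nat \<Rightarrow> ennreal" and b :: "nat \<Rightarrow> nat \<Rightarrow> ennreal" +
  assumes \<alpha>_less: "\<alpha> < real CARD('n)"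
begin

lemma pot_eq: "pot M x = riesz_potential \<alpha> M x"
  by (simp add: pot_def riesz_potential_def)

lemma kernel_tendsto:
  fixes y :: "real^'n"
  assumes "X \<longlonglongrightarrow> (x::real^'n)"
  shows "(\<lambda>n. riesz_power CARD('n) \<alpha> (norm (X n - y))) \<longlonglongrightarrow> riesz_power CARD('n) \<alpha> (norm (x - y))"
  by (rule isCont_tendsto_compose[OF isCont_riesz_power[OF \<alpha>_less] tendsto_diff[OF assms tendsto_const]])

lemma seq_lsc_pot:
  assumes [measurable_cong]: "sets M = sets borel"
  shows "seq_lsc (pot M)"
  unfolding pot_def by (intro seq_lsc_nn_integral kernel_tendsto) measurable

text \<open>Subtraction is truncated at 0, so this is the potential of the part of the kernel above
  the height J. Uniform smallness of tails on a set stands in for continuity of the potential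
  there.\<close>

definition tail :: "real \<Rightarrow> (real^'n) measure \<Rightarrow> real^'n \<Rightarrow> ennreal" where
  "tail J M x = (\<integral>\<^sup>+ t. (riesz_power CARD('n) \<alpha> (norm (x - t)) - ennreal J) \<partial>M)"

lemma seq_lsc_tail:
  assumes [measurable_cong]: "sets M = sets borel"
  shows "seq_lsc (tail J M)"
  unfolding tail_def by (intro seq_lsc_nn_integral tendsto_minus_const_ennreal kernel_tendsto) measurable

text \<open>Comparison with the nearest point of the support: a uniform bound for the tails on the support
  yields one on the whole space.\<close>

lemma tail_off_support:
  assumes K: "closed K" "K \<noteq> {}" "AE t in M. t \<in> K" and [measurable_cong]: "sets M = sets borel"
    and small: "\<And>x. x \<in> K \<Longrightarrow> tail J M x \<le> \<eta>" and "0 \<le> J"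
  shows "tail (2 powr (real CARD('n) - \<alpha>) * J) M y \<le> ennreal (2 powr (real CARD('n) - \<alpha>)) * \<eta>"
proof -
  define C where "C = 2 powr (real CARD('n) - \<alpha>)"
  have "C > 0" by (simp add: C_def)
  obtain z where z: "z \<in> K" "\<And>t. t \<in> K \<Longrightarrow> dist y z \<le> dist y t"
    using distance_attains_inf[OF K(1,2), of y] by blast
  have "tail (C * J) M y \<le> (\<integral>\<^sup>+ t. ennreal C * (riesz_power CARD('n) \<alpha> (norm (z - t)) - ennreal J) \<partial>M)"
    unfolding tail_def
  proof (rule nn_integral_mono_AE, use K(3) in eventually_elim)
    fix t assume "t \<in> K"
    have "norm (z - t) / 2 \<le> norm (y - t)"
      using z(2)[OF \<open>t \<in> K\<close>] dist_triangle[of z t y] by (simp add: dist_norm norm_minus_commute)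
    then have "riesz_power CARD('n) \<alpha> (norm (y - t)) \<le> riesz_power CARD('n) \<alpha> (norm (z - t) / 2)"
      by (intro riesz_power_antimono \<alpha>_less) auto
    also have "\<dots> = ennreal C * riesz_power CARD('n) \<alpha> (norm (z - t))"
      unfolding C_def by (rule riesz_power_half) (auto simp: \<alpha>_less)
    finally have "riesz_power CARD('n) \<alpha> (norm (y - t)) - ennreal (C * J)
      \<le> ennreal C * riesz_power CARD('n) \<alpha> (norm (z - t)) - ennreal C * ennreal J"
      using \<open>C > 0\<close> \<open>0 \<le> J\<close> by (intro ennreal_minus_mono) (auto simp: ennreal_mult)
    also have "\<dots> = ennreal C * (riesz_power CARD('n) \<alpha> (norm (z - t)) - ennreal J)"
      by (cases "riesz_power CARD('n) \<alpha> (norm (z - t))")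
        (use \<open>C > 0\<close> \<open>0 \<le> J\<close> in \<open>auto simp: ennreal_mult'[symmetric] ennreal_minus right_diff_distrib ennreal_mult_top\<close>)
    finally show "riesz_power CARD('n) \<alpha> (norm (y - t)) - ennreal (C * J)
      \<le> ennreal C * (riesz_power CARD('n) \<alpha> (norm (z - t)) - ennreal J)" .
  qed
  also have "\<dots> = ennreal C * tail J M z" unfolding tail_def by (rule nn_integral_cmult) measurable
  also have "\<dots> \<le> ennreal C * \<eta>" by (intro mult_left_mono small z) simp
  finally show ?thesis by (simp add: C_def)
qed

text \<open>Otherwise points violating the inequality would converge to some x \<in> K. By
  \<open>tail_off_support\<close> the potential exceeds a truncated one by at most \<delta> / 2
  everywhere; the truncated one is continuous and S is lower semicontinuous, so the limit would give
  \<delta> \<le> \<delta> / 2.\<close>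

lemma pot_le_near_support:
  assumes M: "finite_measure M" and s[measurable_cong]: "sets M = sets borel"
    and K: "compact K" "K \<noteq> {}" "AE t in M. t \<in> K"
    and small: "\<And>\<eta>. 0 < \<eta> \<Longrightarrow> \<exists>J\<ge>0. \<forall>x\<in>K. tail J M x \<le> ennreal \<eta>"
    and S: "seq_lsc S" "\<And>x. x \<in> K \<Longrightarrow> pot M x \<le> S x" and "0 < \<delta>"
  shows "\<exists>d>0. \<forall>x t. t \<in> K \<longrightarrow> dist x t < d \<longrightarrow> pot M x \<le> S x + ennreal \<delta>"
proof (rule ccontr)
  interpret finite_measure M by fact
  assume "\<not> ?thesis"
  then have "\<exists>x t. t \<in> K \<and> dist x t < 1 / real (Suc n) \<and> S x + ennreal \<delta> < pot M x" for n
    by (meson not_le of_nat_0_less_iff zero_less_Suc zero_less_divide_1_iff)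
  then obtain X T where X: "\<And>n. T n \<in> K" "\<And>n. dist (X n) (T n) < 1 / real (Suc n)"
    "\<And>n. S (X n) + ennreal \<delta> < pot M (X n)" by metis
  obtain x r where x: "x \<in> K" "strict_mono r" "(T \<circ> r) \<longlonglongrightarrow> x"
    using compact_imp_seq_compact[OF K(1), unfolded seq_compact_def, rule_format, of T] X(1) by blast
  have "(\<lambda>n. dist (X n) (T n)) \<longlonglongrightarrow> 0"
  proof (rule tendsto_sandwich[OF _ _ tendsto_const LIMSEQ_inverse_real_of_nat])
    show "\<forall>\<^sub>F n in sequentially. dist (X n) (T n) \<le> inverse (real (Suc n))"
      unfolding inverse_eq_divide by (intro always_eventually allI less_imp_le X(2))
  qed simp
  then have "(\<lambda>n. norm (X n - T n)) \<longlonglongrightarrow> 0" by (simp only: dist_norm)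
  then have "(\<lambda>n. X n - T n) \<longlonglongrightarrow> 0" by (rule tendsto_norm_zero_cancel)
  from tendsto_add[OF LIMSEQ_subseq_LIMSEQ[OF this x(2)] x(3)]
  have Xr: "(\<lambda>n. X (r n)) \<longlonglongrightarrow> x" by (simp add: comp_def)
  define C where "C = 2 powr (real CARD('n) - \<alpha>)"
  have "C > 0" by (simp add: C_def)
  \<comment> \<open>Division by C makes up for the factor lost in \<open>tail_off_support\<close>
    away from K.\<close>
  obtain J0 where J0: "0 \<le> J0" "\<forall>x\<in>K. tail J0 M x \<le> ennreal (\<delta> / 2 / C)"
    using small[of "\<delta> / 2 / C"] \<open>0 < \<delta>\<close> \<open>C > 0\<close> by auto
  define J where "J = C * J0"
  define V where "V = (\<lambda>x. \<integral>\<^sup>+ t. min (riesz_power CARD('n) \<alpha> (norm (x - t))) (ennreal J) \<partial>M)"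
  have tl: "tail J M y \<le> ennreal (\<delta> / 2)" for y
  proof -
    have "tail J M y \<le> ennreal C * ennreal (\<delta> / 2 / C)"
      unfolding J_def C_def by (intro tail_off_support[of K] compact_imp_closed K s) (use J0 in \<open>auto simp: C_def\<close>)
    then show ?thesis using \<open>C > 0\<close> \<open>0 < \<delta>\<close> by (simp add: ennreal_mult'[symmetric])
  qed
  have UV: "pot M y \<le> V y + ennreal (\<delta> / 2)" for y
  proof -
    have "pot M y \<le> (\<integral>\<^sup>+ t. min (riesz_power CARD('n) \<alpha> (norm (y - t))) (ennreal J)
        + (riesz_power CARD('n) \<alpha> (norm (y - t)) - ennreal J) \<partial>M)"
      unfolding pot_def
    proof (rule nn_integral_mono)
      fix t show "riesz_power CARD('n) \<alpha> (norm (y - t)) \<le> min (riesz_power CARD('n) \<alpha> (norm (y - t))) (ennreal J)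
        + (riesz_power CARD('n) \<alpha> (norm (y - t)) - ennreal J)"
        by (auto simp: min_def add_diff_inverse_ennreal not_le less_imp_le)
    qed
    also have "\<dots> = V y + tail J M y" unfolding V_def tail_def by (rule nn_integral_add) measurable
    also have "\<dots> \<le> V y + ennreal (\<delta> / 2)" by (intro add_left_mono tl)
    finally show ?thesis .
  qed
  have V_lim: "(\<lambda>n. V (X (r n))) \<longlonglongrightarrow> V x"
    unfolding V_def
  proof (rule nn_integral_dominated_convergence[where w = "\<lambda>_. ennreal J"])
    show "(\<integral>\<^sup>+ t. ennreal J \<partial>M) < \<infinity>" by (simp add: less_top[symmetric] ennreal_mult_eq_top_iff)
    show "AE t in M. (\<lambda>i. min (riesz_power CARD('n) \<alpha> (norm (X (r i) - t))) (ennreal J))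
      \<longlonglongrightarrow> min (riesz_power CARD('n) \<alpha> (norm (x - t))) (ennreal J)"
      by (intro AE_I2 tendsto_min kernel_tendsto Xr tendsto_const)
  qed simp_all
  have V_fin: "V x < top"
  proof -
    have "V x \<le> (\<integral>\<^sup>+ t. ennreal J \<partial>M)" unfolding V_def by (intro nn_integral_mono) simp
    also have "\<dots> < top" by (simp add: less_top[symmetric] ennreal_mult_eq_top_iff)
    finally show ?thesis .
  qed
  have "V x + ennreal \<delta> \<le> S x + ennreal \<delta>"
  proof (intro add_right_mono)
    have "V x \<le> pot M x" unfolding V_def pot_def by (intro nn_integral_mono) simp
    then show "V x \<le> S x" using S(2)[OF x(1)] by simp
  qed
  also have "\<dots> \<le> liminf (\<lambda>n. S (X (r n)) + ennreal \<delta>)"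
    using seq_lscD[OF seq_lsc_add[OF S(1) seq_lsc_const] Xr] .
  also have "\<dots> \<le> liminf (\<lambda>n. V (X (r n)) + ennreal (\<delta> / 2))"
  proof (intro Liminf_mono always_eventually allI)
    fix n show "S (X (r n)) + ennreal \<delta> \<le> V (X (r n)) + ennreal (\<delta> / 2)"
      using X(3)[of "r n"] UV[of "X (r n)"] by simp
  qed
  also have "\<dots> = V x + ennreal (\<delta> / 2)"
    by (intro lim_imp_Liminf tendsto_add V_lim tendsto_const) simp
  finally have "ennreal \<delta> \<le> ennreal (\<delta> / 2)"
    using V_fin by (auto simp: ennreal_add_left_cancel_le)
  then show False using \<open>0 < \<delta>\<close> by simp
qed

text \<open>Egorov's argument. Where the potential is finite the tails decrease to 0, so there are
  heights \<open>j i\<close> whose tail exceeds 1 / (i + 1) only on a set of measure below 2^(- i);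
  by Borel-Cantelli almost every point lies in finitely many of these sets.\<close>

lemma exists_uniform_tail_sets:
  assumes M: "finite_measure M" and s[measurable_cong]: "sets M = sets borel"
    and E: "compact E" "AE t in M. t \<in> E" and W: "AE x in M. pot M x \<le> ennreal W"
  obtains F :: "nat \<Rightarrow> (real^'n) set" where "incseq F" "\<And>n. compact (F n)" "\<And>n. F n \<subseteq> E"
    "\<And>n x. x \<in> F n \<Longrightarrow> pot M x \<le> ennreal W" "AE x in M. \<exists>n. x \<in> F n"
    "\<And>n \<eta>. 0 < \<eta> \<Longrightarrow> \<exists>J\<ge>0. \<forall>x\<in>F n. tail J M x \<le> ennreal \<eta>"
proof -
  interpret finite_measure M by fact
  have [measurable]: "tail J M \<in> borel_measurable borel" for J
    unfolding tail_def by measurable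
  have sp: "space M = UNIV" using sets_eq_imp_space_eq[OF s] by simp
  have lim0: "(\<lambda>j. tail (real j) M x) \<longlonglongrightarrow> 0" if "pot M x \<le> ennreal W" for x
  proof -
    have "(\<lambda>j. tail (real j) M x) \<longlonglongrightarrow> (\<integral>\<^sup>+ t. 0 \<partial>M)"
      unfolding tail_def
    proof (rule nn_integral_dominated_convergence[where w = "\<lambda>t. riesz_power CARD('n) \<alpha> (norm (x - t))"])
      show fin: "(\<integral>\<^sup>+ t. riesz_power CARD('n) \<alpha> (norm (x - t)) \<partial>M) < \<infinity>"
        using that le_less_trans[OF _ ennreal_less_top] unfolding pot_def by auto
      have "AE t in M. riesz_power CARD('n) \<alpha> (norm (x - t)) \<noteq> \<infinity>"
        using fin by (intro nn_integral_noteq_infinite) auto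
      then show "AE t in M. (\<lambda>j. riesz_power CARD('n) \<alpha> (norm (x - t)) - ennreal (real j)) \<longlonglongrightarrow> 0"
      proof eventually_elim
        case (elim t)
        then obtain c where c: "riesz_power CARD('n) \<alpha> (norm (x - t)) = ennreal c" "0 \<le> c"
          by (cases "riesz_power CARD('n) \<alpha> (norm (x - t))") auto
        have "\<forall>\<^sub>F j in sequentially. riesz_power CARD('n) \<alpha> (norm (x - t)) - ennreal (real j) = 0"
          using eventually_ge_at_top[of "nat \<lceil>c\<rceil>"]
          by eventually_elim (simp add: c ennreal_minus ennreal_neg nat_le_iff ceiling_le_iff)
        then show ?case by (rule tendsto_eventually)
      qed
    qed auto
    then show ?thesis by simp
  qed
  have ex: "\<exists>j. measure M {x. ennreal (1 / real (Suc i)) < tail (real j) M x} < (1/2) ^ i" for i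
  proof -
    define A where "A = (\<lambda>j. {x. ennreal (1 / real (Suc i)) < tail (real j) M x})"
    have [measurable]: "A j \<in> sets borel" for j unfolding A_def by measurable
    have "decseq A"
    proof (rule decseq_SucI)
      fix j
      have "tail (real (Suc j)) M x \<le> tail (real j) M x" for x
        unfolding tail_def by (intro nn_integral_mono ennreal_minus_mono) auto
      then show "A (Suc j) \<subseteq> A j" unfolding A_def by (auto intro: less_le_trans)
    qed
    then have "(\<lambda>j. measure M (A j)) \<longlonglongrightarrow> measure M (\<Inter>j. A j)"
      by (intro finite_Lim_measure_decseq) (auto simp: s)
    moreover have "AE x in M. x \<notin> (\<Inter>j. A j)"
      using W
    proof eventually_elim
      case (elim x)
      have "\<forall>\<^sub>F j in sequentially. tail (real j) M x < ennreal (1 / real (Suc i))"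
        by (rule order_tendstoD(2)[OF lim0[OF elim]]) simp
      then obtain j where "tail (real j) M x < ennreal (1 / real (Suc i))"
        by (auto simp: eventually_sequentially)
      then show ?case unfolding A_def by (auto simp: not_less intro!: exI[of _ j] less_imp_le)
    qed
    then have "measure M (\<Inter>j. A j) = 0"
      by (subst (asm) AE_iff_measurable[where N = "\<Inter>j. A j"]) (auto simp: measure_def sp s)
    ultimately have "\<forall>\<^sub>F j in sequentially. measure M (A j) < (1/2) ^ i"
      by (intro order_tendstoD(2)) auto
    then show ?thesis unfolding A_def by (auto simp: eventually_sequentially)
  qed
  then obtain j where j: "\<And>i. measure M {x. ennreal (1 / real (Suc i)) < tail (real (j i)) M x} < (1/2) ^ i"
    by metis
  \<comment> \<open>Imposing the bounds from index n on makes the sets increase with n. Every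
    condition is a sublevel set of a lower semicontinuous function, so the sets are compact.\<close>
  define F where "F = (\<lambda>n. E \<inter> {x. pot M x \<le> ennreal W} \<inter>
    (\<Inter>i\<in>{n..}. {x. tail (real (j i)) M x \<le> ennreal (1 / real (Suc i))}))"
  show ?thesis
  proof (rule that)
    show "incseq F" unfolding F_def by (auto simp: incseq_def)
    show "compact (F n)" for n
      unfolding F_def Int_assoc
      by (intro compact_Int_closed E(1) closed_Int closed_INT ballI seq_lsc_le_closed seq_lsc_pot seq_lsc_tail s)
    show "F n \<subseteq> E" "x \<in> F n \<Longrightarrow> pot M x \<le> ennreal W" for n x by (auto simp: F_def)
    have "AE x in M. \<forall>\<^sub>F i in sequentially. x \<in> space M - {x. ennreal (1 / real (Suc i)) < tail (real (j i)) M x}"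
    proof (rule borel_cantelli_AE1)
      show "summable (\<lambda>i. measure M {x. ennreal (1 / real (Suc i)) < tail (real (j i)) M x})"
        using j by (intro summable_comparison_test[OF _ summable_geometric[of "1/2::real"]] exI[of _ 0])
          (auto intro: less_imp_le)
    qed (auto simp: s less_top[symmetric])
    then show "AE x in M. \<exists>n. x \<in> F n"
      using E(2) W by eventually_elim (auto simp: F_def eventually_sequentially not_less)
    show "\<exists>J\<ge>0. \<forall>x\<in>F n. tail J M x \<le> ennreal \<eta>" if "0 < \<eta>" for n \<eta>
    proof -
      obtain i0 where i0: "1 / real (Suc i0) < \<eta>" using nat_approx_posE[OF \<open>0 < \<eta>\<close>] by blast
      have "1 / real (Suc (max n i0)) \<le> 1 / real (Suc i0)" by (intro divide_left_mono) auto
      then have "ennreal (1 / real (Suc (max n i0))) \<le> ennreal \<eta>" using i0 by (intro ennreal_leI) simp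
      then have "\<forall>x\<in>F n. tail (real (j (max n i0))) M x \<le> ennreal \<eta>"
        unfolding F_def by (auto intro: order_trans)
      then show ?thesis by (intro exI[of _ "real (j (max n i0))"]) auto
    qed
  qed
qed

text \<open>Exhausting \<open>M\<close> by restrictions with continuous potential reduces the maximum principle
  to the case where the inequality extends from the support to a neighbourhood.\<close>

theorem maximum_principle:
  assumes M: "finite_measure M" and s[measurable_cong]: "sets M = sets borel"
    and E: "compact E" "AE t in M. t \<in> E" and W: "AE x in M. pot M x \<le> ennreal W"
    and S: "S \<in> borel_measurable borel" "seq_lsc S" "\<And>j x. conv (p j) S x \<le> S x" "\<And>x. x \<in> E \<Longrightarrow> ennreal W \<le> S x"
  shows "pot M x \<le> S x"
proof -
  interpret finite_measure M by fact
  have sp: "space M = UNIV" using sets_eq_imp_space_eq[OF s] by simp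
  obtain F where F: "incseq F" "\<And>n. compact (F n)" "\<And>n. F n \<subseteq> E"
    "\<And>n x. x \<in> F n \<Longrightarrow> pot M x \<le> ennreal W" "AE x in M. \<exists>n. x \<in> F n"
    "\<And>n \<eta>. 0 < \<eta> \<Longrightarrow> \<exists>J\<ge>0. \<forall>x\<in>F n. tail J M x \<le> ennreal \<eta>"
    using exists_uniform_tail_sets[OF M s E W] by blast
  have [measurable]: "F n \<in> sets borel" for n using F(2) by (simp add: compact_imp_closed)
  define R where "R = (\<lambda>n. density M (indicator (F n)))"
  have Rs[measurable_cong]: "sets (R n) = sets borel" for n by (simp add: R_def s)
  have RI: "(\<integral>\<^sup>+ t. f t \<partial>R n) = (\<integral>\<^sup>+ t. indicator (F n) t * f t \<partial>M)"
    if [measurable]: "f \<in> borel_measurable borel" for f n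
    unfolding R_def by (subst nn_integral_density) auto
  have Rle: "(\<integral>\<^sup>+ t. f t \<partial>R n) \<le> (\<integral>\<^sup>+ t. f t \<partial>M)" if "f \<in> borel_measurable borel" for f n
    unfolding RI[OF that] by (intro nn_integral_mono) (auto split: split_indicator)
  have Rf: "finite_measure (R n)" for n
  proof
    have "emeasure (R n) (space (R n)) \<le> emeasure M UNIV"
      unfolding R_def using sp by (subst emeasure_density) (auto simp: emeasure_mono)
    then show "emeasure (R n) (space (R n)) \<noteq> \<infinity>"
      using emeasure_finite[of UNIV] by (metis infinity_ennreal_def top.extremum_unique)
  qed
  have RF: "AE t in R n. t \<in> F n" for n
    unfolding R_def by (subst AE_density) (auto split: split_indicator_asm)
  have R_le: "pot (R n) x \<le> S x" for n x
  proof (cases "F n = {}")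
    case True
    then have "pot (R n) x = 0" unfolding pot_def by (subst RI) auto
    then show ?thesis by simp
  next
    case False
    show ?thesis
    proof (rule ennreal_le_epsilon)
      fix \<delta> :: real assume "0 < \<delta>"
      have potR: "pot (R n) x \<le> pot M x" for x unfolding pot_def by (rule Rle) measurable
      have tailR: "tail J (R n) x \<le> tail J M x" for J x unfolding tail_def by (rule Rle) measurable
      obtain d where d: "0 < d" "\<And>x t. t \<in> F n \<Longrightarrow> dist x t < d \<Longrightarrow> pot (R n) x \<le> S x + ennreal \<delta>"
      proof -
        have "\<exists>J\<ge>0. \<forall>x\<in>F n. tail J (R n) x \<le> ennreal \<eta>" if "0 < \<eta>" for \<eta>
          using F(6)[OF that, of n] tailR order_trans by blast
        moreover have "pot (R n) x \<le> S x" if "x \<in> F n" for x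
          using potR[of x] F(4)[OF that] S(4)[of x] F(3)[of n] that by auto
        ultimately have "\<exists>d>0. \<forall>x t. t \<in> F n \<longrightarrow> dist x t < d \<longrightarrow> pot (R n) x \<le> S x + ennreal \<delta>"
          by (rule pot_le_near_support[OF Rf Rs F(2) False RF _ S(2) _ \<open>0 < \<delta>\<close>])
        then show ?thesis using that by blast
      qed
      have 0: "emeasure (R n) (- F n) = 0"
        using RF[of n] AE_iff_measurable[of "- F n" "R n" "\<lambda>t. t \<in> F n"] Rs sets_eq_imp_space_eq[OF Rs]
        by (auto simp: Compl_eq)
      show "pot (R n) x \<le> S x + ennreal \<delta>"
        by (rule domination_principle[OF Rf Rs 0 _ S(1,3) d]) auto
    qed
  qed
  \<comment> \<open>Almost every point lies in some F n, so the restrictions R n exhaust M.\<close>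
  have "pot M x \<le> (\<integral>\<^sup>+ t. (SUP n. indicator (F n) t * riesz_power CARD('n) \<alpha> (norm (x - t))) \<partial>M)"
    unfolding pot_def
  proof (rule nn_integral_mono_AE, use F(5) in eventually_elim)
    fix t assume "\<exists>n. t \<in> F n"
    then obtain n where "t \<in> F n" by blast
    then show "riesz_power CARD('n) \<alpha> (norm (x - t)) \<le> (SUP n. indicator (F n) t * riesz_power CARD('n) \<alpha> (norm (x - t)))"
      by (intro SUP_upper2[of n]) auto
  qed
  also have "\<dots> = (SUP n. \<integral>\<^sup>+ t. indicator (F n) t * riesz_power CARD('n) \<alpha> (norm (x - t)) \<partial>M)"
  proof (rule nn_integral_monotone_convergence_SUP)
    show "incseq (\<lambda>n t. indicator (F n) t * riesz_power CARD('n) \<alpha> (norm (x - t)))"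
      using F(1) by (auto simp: incseq_def le_fun_def indicator_def intro!: mult_right_mono)
  qed measurable
  also have "\<dots> = (SUP n. pot (R n) x)" unfolding pot_def by (subst RI) auto
  also have "\<dots> \<le> S x" by (rule SUP_least) (rule R_le)
  finally show ?thesis .
qed

end

section \<open>Discrete measures with large potential\<close>

text \<open>Digits by rounding down: the m-th partial sum is the largest multiple of 2^(- m) not
  exceeding y.\<close>

lemma binary_expansion:
  fixes y :: real
  assumes "0 \<le> y" "y < 1"
  shows "\<exists>d. (\<forall>n. d n \<in> {0, 1::real}) \<and> (\<lambda>n. d n * (1/2) ^ Suc n) sums y"
proof (intro exI conjI allI)
  define d where "d = (\<lambda>n. real_of_int (\<lfloor>2 ^ Suc n * y\<rfloor> mod 2))"
  show "d n \<in> {0, 1}" for n by (auto simp: d_def)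
  have part: "(\<Sum>n<m. d n * (1/2) ^ Suc n) = real_of_int \<lfloor>2 ^ m * y\<rfloor> * (1/2) ^ m" for m
  proof (induction m)
    case 0
    show ?case using assms by (simp add: floor_eq_iff)
  next
    case (Suc m)
    have "\<lfloor>2 ^ Suc m * y\<rfloor> div 2 = \<lfloor>2 ^ m * y\<rfloor>"
      using floor_divide_real_eq_div[of 2 "2 ^ Suc m * y"] by simp
    then have "\<lfloor>2 ^ Suc m * y\<rfloor> = 2 * \<lfloor>2 ^ m * y\<rfloor> + \<lfloor>2 ^ Suc m * y\<rfloor> mod 2"
      by (metis mult_div_mod_eq)
    then have "real_of_int \<lfloor>2 ^ Suc m * y\<rfloor> = 2 * real_of_int \<lfloor>2 ^ m * y\<rfloor> + d m"
      unfolding d_def by (metis of_int_add of_int_mult of_int_numeral)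
    then show ?case by (simp only: sum.lessThan_Suc Suc) (simp add: algebra_simps)
  qed
  show "(\<lambda>n. d n * (1/2) ^ Suc n) sums y"
    unfolding sums_def part
  proof (rule tendsto_sandwich[of "\<lambda>m. y - (1/2) ^ m" _ _ "\<lambda>_. y"])
    have "y - (1/2) ^ m \<le> real_of_int \<lfloor>2 ^ m * y\<rfloor> * (1/2) ^ m \<and> real_of_int \<lfloor>2 ^ m * y\<rfloor> * (1/2) ^ m \<le> y" for m
    proof -
      have "(2 ^ m * y - 1) * (1/2) ^ m \<le> real_of_int \<lfloor>2 ^ m * y\<rfloor> * (1/2) ^ m"
        "real_of_int \<lfloor>2 ^ m * y\<rfloor> * (1/2) ^ m \<le> (2 ^ m * y) * (1/2) ^ m"
        by (intro mult_right_mono; linarith | simp)+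
      then show ?thesis by (simp add: algebra_simps power_one_over)
    qed
    then show "\<forall>\<^sub>F m in sequentially. y - (1/2) ^ m \<le> real_of_int \<lfloor>2 ^ m * y\<rfloor> * (1/2) ^ m"
      "\<forall>\<^sub>F m in sequentially. real_of_int \<lfloor>2 ^ m * y\<rfloor> * (1/2) ^ m \<le> y"
      by auto
    have "(\<lambda>m. y - (1/2) ^ m) \<longlonglongrightarrow> y - 0"
      by (intro tendsto_diff tendsto_const LIMSEQ_power_zero) simp
    then show "(\<lambda>m. y - (1/2) ^ m) \<longlonglongrightarrow> y" by simp
  qed simp
qed

text \<open>A clipped cosine in place of Schoenberg's piecewise linear function: it has period 2, is
  0 on [0, 1/3] and 1 on [2/3, 1], as cos (pi / 3) = 1/2 and cos (2 pi / 3) = - 1/2.\<close>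

definition saw :: "real \<Rightarrow> real" where
  "saw s = max 0 (min 1 (1/2 - cos (pi * s)))"

lemma saw_bounds: "0 \<le> saw s" "saw s \<le> 1"
  by (simp_all add: saw_def)

lemma saw_ternary:
  assumes "d \<in> {0, 1}" "0 \<le> r" "r \<le> 1/3"
  shows "saw (2 * real n + (2 * d / 3 + r)) = d"
proof -
  have "cos (pi * (2 * real n + (2 * d / 3 + r))) = cos (pi * (2 * d / 3 + r) + 2 * pi * real n)"
    by (simp add: algebra_simps)
  also have "\<dots> = cos (pi * (2 * d / 3 + r))"
    using cos.plus_of_nat[of "pi * (2 * d / 3 + r)" n] by (simp add: mult.commute mult.left_commute)
  finally have 1: "cos (pi * (2 * real n + (2 * d / 3 + r))) = cos (pi * (2 * d / 3 + r))" .
  have r: "0 \<le> pi * r" "pi * r \<le> pi / 3" using assms by auto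
  show ?thesis
  proof (cases "d = 0")
    case True
    have "cos (pi / 3) \<le> cos (pi * r)" using r by (intro cos_monotone_0_pi_le) auto
    then show ?thesis unfolding saw_def 1 using True by (simp add: cos_60)
  next
    case False
    then have d: "d = 1" using assms by auto
    have "cos (pi * (2 / 3 + r)) \<le> cos (2 * pi / 3)"
    proof (rule cos_monotone_0_pi_le)
      have "pi * (2 / 3 + r) \<le> pi * 1" using assms by (intro mult_left_mono) auto
      then show "pi * (2 / 3 + r) \<le> pi" by (simp only: mult_1_right)
      show "2 * pi / 3 \<le> pi * (2 / 3 + r)" using r by (simp add: distrib_left)
    qed simp
    also have "cos (2 * pi / 3) = - 1/2" by (simp add: cos_120)
    finally show ?thesis unfolding saw_def 1 using d by simp
  qed
qed

text \<open>A shift by m ternary places turns t into an integer plus 2 A m / 3 plus a remainder of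
  at most 1/3. The integer is even because all digits are 0 or 2, so \<open>saw\<close>, having
  period 2, does not see it.\<close>

lemma saw_ternary_expansion:
  assumes A: "\<And>j. A j \<in> {0, 1::real}"
  defines "t \<equiv> \<Sum>j. 2 * A j * (1/3) ^ Suc j"
  shows "saw (3 ^ m * t) = A m" "0 \<le> t" "t \<le> 1"
proof -
  have bnd: "0 \<le> A j" "A j \<le> 1" for j using A[of j] by auto
  have geo: "(\<lambda>j. 2 * (1/3::real) ^ Suc (j + l)) sums (1/3) ^ l" for l
  proof -
    have "(\<lambda>j. (2/3) * (1/3::real) ^ l * (1/3) ^ j) sums ((2/3) * (1/3) ^ l * (1 / (1 - 1/3)))"
      by (intro sums_mult geometric_sums) simp
    then show ?thesis by (simp add: power_add mult_ac)
  qed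
  have le: "norm (2 * A (j + l) * (1/3) ^ Suc (j + l)) \<le> 2 * (1/3::real) ^ Suc (j + l)" for j l
    using bnd[of "j + l"] by (simp add: abs_mult)
  have sm: "summable (\<lambda>j. 2 * A (j + l) * (1/3) ^ Suc (j + l))" for l
    by (rule summable_comparison_test'[OF sums_summable[OF geo[of l]] le])
  have tail0: "0 \<le> (\<Sum>j. 2 * A (j + l) * (1/3) ^ Suc (j + l))" for l
    by (intro suminf_nonneg sm) (auto intro!: mult_nonneg_nonneg bnd)
  have tail1: "(\<Sum>j. 2 * A (j + l) * (1/3) ^ Suc (j + l)) \<le> (1/3) ^ l" for l
  proof -
    have "(\<Sum>j. 2 * A (j + l) * (1/3) ^ Suc (j + l)) \<le> (\<Sum>j. 2 * (1/3::real) ^ Suc (j + l))"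
      by (intro suminf_le sm sums_summable[OF geo]) (simp add: bnd)
    then show ?thesis using sums_unique[OF geo[of l]] by simp
  qed
  show "0 \<le> t" "t \<le> 1" using tail0[of 0] tail1[of 0] by (simp_all add: t_def)
  have t: "t = (\<Sum>j. 2 * A (j + Suc m) * (1/3) ^ Suc (j + Suc m)) + (\<Sum>j<Suc m. 2 * A j * (1/3) ^ Suc j)"
    unfolding t_def using suminf_split_initial_segment[of "\<lambda>j. 2 * A j * (1/3) ^ Suc j" "Suc m"] sm[of 0] by simp
  define r where "r = 3 ^ m * (\<Sum>j. 2 * A (j + Suc m) * (1/3) ^ Suc (j + Suc m))"
  have r: "0 \<le> r" "r \<le> 1/3"
  proof -
    show "0 \<le> r" unfolding r_def using tail0[of "Suc m"] by simp
    have "r \<le> 3 ^ m * (1/3) ^ Suc m" unfolding r_def by (intro mult_left_mono tail1) simp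
    then show "r \<le> 1/3" by (simp add: power_one_over)
  qed
  have nat: "\<exists>n. 3 ^ m * (\<Sum>j<m. 2 * A j * (1/3) ^ Suc j) = 2 * real n"
  proof -
    have digit: "3 ^ m * (2 * A j * (1/3) ^ Suc j) = 2 * real (if A j = 0 then 0 else 3 ^ (m - Suc j))" if "j < m" for j
    proof -
      have "(3::real) ^ m = 3 ^ (m - Suc j) * 3 ^ Suc j" using that by (simp add: power_add[symmetric] del: power_Suc)
      then have "(3::real) ^ m * (1/3) ^ Suc j = 3 ^ (m - Suc j)" by (simp add: power_one_over del: power_Suc)
      then show ?thesis using A[of j] by (auto simp del: power_Suc)
    qed
    have "3 ^ m * (\<Sum>j<m. 2 * A j * (1/3) ^ Suc j) = (\<Sum>j<m. 2 * real (if A j = 0 then 0 else 3 ^ (m - Suc j)))"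
      unfolding sum_distrib_left by (intro sum.cong refl digit) simp
    also have "\<dots> = 2 * real (\<Sum>j<m. if A j = 0 then 0 else 3 ^ (m - Suc j))"
      by (simp add: sum_distrib_left)
    finally have "3 ^ m * (\<Sum>j<m. 2 * A j * (1/3) ^ Suc j) = 2 * real (\<Sum>j<m. if A j = 0 then 0 else 3 ^ (m - Suc j))" .
    then show ?thesis by blast
  qed
  then obtain n where n: "3 ^ m * (\<Sum>j<m. 2 * A j * (1/3) ^ Suc j) = 2 * real n" by blast
  have "3 ^ m * t = r + 3 ^ m * (\<Sum>j<m. 2 * A j * (1/3) ^ Suc j) + 3 ^ m * (2 * A m * (1/3) ^ Suc m)"
    unfolding t r_def by (simp add: distrib_left)
  also have "3 ^ m * (2 * A m * (1/3) ^ Suc m) = 2 * A m / 3" by (simp add: power_one_over)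
  finally have "3 ^ m * t = 2 * real n + (2 * A m / 3 + r)" unfolding n by simp
  then show "saw (3 ^ m * t) = A m" using saw_ternary[OF A r] by simp
qed

text \<open>Schoenberg's space-filling curve: the ternary digits of the parameter, read through \<open>saw\<close>,
  are the interleaved binary digits of the coordinates.\<close>

lemma space_filling_curve:
  "\<exists>G :: real \<Rightarrow> real^'n. continuous_on UNIV G \<and>
    (\<forall>x. (\<forall>i. 0 \<le> x $ i \<and> x $ i < 1) \<longrightarrow> (\<exists>t. 0 \<le> t \<and> t \<le> 1 \<and> G t = x))"
proof -
  define N where "N = CARD('n)"
  have "N > 0" by (simp add: N_def)
  obtain h :: "'n \<Rightarrow> nat" where h: "bij_betw h UNIV {0..<N}"
    using ex_bij_betw_finite_nat[of "UNIV :: 'n set"] by (auto simp: N_def)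
  have hN: "h i < N" for i using h by (auto simp: bij_betw_def)
  \<comment> \<open>Place n N + h i holds digit n of coordinate i; division with remainder by N
    recovers both.\<close>
  define idx where "idx = (\<lambda>i n. n * N + h i)"
  define G where "G = (\<lambda>t. \<chi> i. \<Sum>n. saw (3 ^ idx i n * t) * (1/2) ^ Suc n)"
  have "continuous_on UNIV (\<lambda>t. \<Sum>n. saw (3 ^ idx i n * t) * (1/2) ^ Suc n)" for i
  proof (rule uniform_limit_theorem)
    show "uniform_limit UNIV (\<lambda>n t. \<Sum>j<n. saw (3 ^ idx i j * t) * (1/2) ^ Suc j)
        (\<lambda>t. \<Sum>n. saw (3 ^ idx i n * t) * (1/2) ^ Suc n) sequentially"
    proof (rule Weierstrass_m_test)
      show "norm (saw (3 ^ idx i n * t) * (1/2) ^ Suc n) \<le> (1/2) ^ Suc n" for n t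
        using saw_bounds[of "3 ^ idx i n * t"] by (simp add: abs_mult del: power_Suc)
      show "summable (\<lambda>n. (1/2::real) ^ Suc n)" by (subst summable_Suc_iff) (simp add: summable_geometric)
    qed
    show "\<forall>\<^sub>F n in sequentially. continuous_on UNIV (\<lambda>t. \<Sum>j<n. saw (3 ^ idx i j * t) * (1/2) ^ Suc j)"
      unfolding saw_def by (intro always_eventually allI continuous_intros)
  qed simp
  then have "continuous_on UNIV G" unfolding G_def by (rule continuous_on_vec_lambda)
  moreover have "\<exists>t. 0 \<le> t \<and> t \<le> 1 \<and> G t = x" if x: "\<forall>i. 0 \<le> x $ i \<and> x $ i < 1" for x
  proof -
    have "\<exists>d. (\<forall>n. d n \<in> {0, 1::real}) \<and> (\<lambda>n. d n * (1/2) ^ Suc n) sums (x $ i)" for i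
      using x by (intro binary_expansion) auto
    then have "\<exists>d. \<forall>i. (\<forall>n. d i n \<in> {0, 1::real}) \<and> (\<lambda>n. d i n * (1/2) ^ Suc n) sums (x $ i)"
      by (intro choice allI)
    then obtain d where d: "\<And>i n. d i n \<in> {0, 1::real}" "\<And>i. (\<lambda>n. d i n * (1/2) ^ Suc n) sums (x $ i)"
      by blast
    define A where "A = (\<lambda>j. d (inv_into UNIV h (j mod N)) (j div N))"
    have Aidx: "A (idx i n) = d i n" for i n
      using hN[of i] h \<open>N > 0\<close> by (simp add: A_def idx_def bij_betw_def)
    have A01: "A j \<in> {0, 1}" for j using d(1) by (simp add: A_def)
    define t where "t = (\<Sum>j. 2 * A j * (1/3) ^ Suc j)"
    have digit: "saw (3 ^ idx i n * t) = d i n" for i n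
      unfolding t_def Aidx[symmetric] by (rule saw_ternary_expansion(1)[OF A01])
    have "G t $ i = x $ i" for i
      unfolding G_def vec_lambda_beta digit by (rule sums_unique[OF d(2), symmetric])
    then have "G t = x" by (simp add: vec_eq_iff)
    moreover have "0 \<le> t" "t \<le> 1" unfolding t_def by (rule saw_ternary_expansion(2,3)[OF A01])+
    ultimately show ?thesis by (intro exI[of _ t] conjI)
  qed
  ultimately show ?thesis by (intro exI[of _ G] conjI allI impI)
qed

lemma curve_through_bounded_set:
  fixes K :: "(real^'n) set"
  assumes "bounded K"
  obtains G :: "real \<Rightarrow> real^'n" where "continuous_on UNIV G" "\<And>x. x \<in> K \<Longrightarrow> \<exists>t. 0 \<le> t \<and> t \<le> 1 \<and> G t = x"
proof -
  obtain G0 :: "real \<Rightarrow> real^'n" where G0: "continuous_on UNIV G0"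
    "\<And>x. (\<forall>i. 0 \<le> x $ i \<and> x $ i < 1) \<Longrightarrow> \<exists>t. 0 \<le> t \<and> t \<le> 1 \<and> G0 t = x"
    using space_filling_curve by blast
  obtain B where B: "0 < B" "\<And>x. x \<in> K \<Longrightarrow> norm x < B"
    using assms bounded_pos_less by blast
  define G where "G = (\<lambda>t. (2 * B) *\<^sub>R G0 t - (\<chi> i. B))"
  show ?thesis
  proof
    show "continuous_on UNIV G" unfolding G_def by (intro continuous_intros G0)
    fix x assume "x \<in> K"
    define y where "y = (1 / (2 * B)) *\<^sub>R (x + (\<chi> i. B))"
    have "\<forall>i. 0 \<le> y $ i \<and> y $ i < 1"
    proof
      fix i
      have "\<bar>x $ i\<bar> < B" using B(2)[OF \<open>x \<in> K\<close>] component_le_norm_cart[of x i] by simp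
      then show "0 \<le> y $ i \<and> y $ i < 1" using B(1) by (auto simp: y_def field_simps)
    qed
    then obtain t where t: "0 \<le> t" "t \<le> 1" "G0 t = y" using G0(2) by blast
    have "G t = x" using B(1) by (simp add: G_def t(3) y_def)
    then show "\<exists>t. 0 \<le> t \<and> t \<le> 1 \<and> G t = x" using t by blast
  qed
qed

text \<open>Helly's selection theorem and Skorohod's representation on the real line, transported by the curve.\<close>

lemma empirical_subsequence_limit:
  fixes x :: "nat \<Rightarrow> real^'n"
  assumes "compact K" "\<And>n. x n \<in> K"
  obtains r :: "nat \<Rightarrow> nat" and \<Omega> :: "real measure" and Z :: "nat \<Rightarrow> real \<Rightarrow> real^'n" and Z' :: "real \<Rightarrow> real^'n"
  where "strict_mono r" "prob_space \<Omega>" "\<And>n. Z n \<in> borel_measurable \<Omega>" "Z' \<in> borel_measurable \<Omega>"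
    "\<And>n. distr \<Omega> borel (Z n) = distr (measure_pmf (pmf_of_set {..r n})) borel x"
    "\<And>\<omega>. \<omega> \<in> space \<Omega> \<Longrightarrow> (\<lambda>n. Z n \<omega>) \<longlonglongrightarrow> Z' \<omega>" "AE \<omega> in \<Omega>. Z' \<omega> \<in> K"
proof -
  obtain G :: "real \<Rightarrow> real^'n" where G: "continuous_on UNIV G" "\<And>x. x \<in> K \<Longrightarrow> \<exists>t. 0 \<le> t \<and> t \<le> 1 \<and> G t = x"
    using curve_through_bounded_set[OF compact_imp_bounded[OF assms(1)]] by blast
  have "\<forall>n. \<exists>t. 0 \<le> t \<and> t \<le> 1 \<and> G t = x n" using G(2) assms(2) by blast
  then obtain t where t: "\<And>n. 0 \<le> t n" "\<And>n. t n \<le> 1" "\<And>n. G (t n) = x n" by metis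
  \<comment> \<open>Empirical measures of curve parameters of the points. All parameters lie in
    [0, 1], so the sequence is tight.\<close>
  define \<mu> where "\<mu> = (\<lambda>n. distr (measure_pmf (pmf_of_set {..n::nat})) borel t)"
  have \<mu>: "real_distribution (\<mu> n)" for n
    unfolding \<mu>_def real_distribution_def real_distribution_axioms_def
    by (auto intro!: measure_pmf.prob_space_distr)
  have "tight \<mu>"
    unfolding tight_def
  proof (intro conjI allI impI)
    fix e :: real assume "0 < e"
    have "measure (\<mu> n) {-1<..2} = 1" for n
    proof -
      have "-1 < t i \<and> t i \<le> 2" for i using t(1)[of i] t(2)[of i] by simp
      then have "t -` {-1<..2} = UNIV" by auto
      then show ?thesis unfolding \<mu>_def by (subst measure_distr) auto
    qed
    then show "\<exists>a b. a < b \<and> (\<forall>n. 1 - e < measure (\<mu> n) {a<..b})"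
      using \<open>0 < e\<close> by (intro exI[of _ "-1"] exI[of _ 2]) auto
  qed (rule \<mu>)
  then obtain r M where r: "strict_mono r" "real_distribution M" "weak_conv_m (\<mu> \<circ> id \<circ> r) M"
    using tight_imp_convergent_subsubsequence[of \<mu> id] by (auto simp: strict_mono_def)
  obtain \<Omega> :: "real measure" and Y :: "nat \<Rightarrow> real \<Rightarrow> real" and Y' :: "real \<Rightarrow> real" where Y: "prob_space \<Omega>" "\<forall>n. Y n \<in> measurable \<Omega> borel"
    "\<forall>n. distr \<Omega> borel (Y n) = \<mu> (r n)" "Y' \<in> measurable \<Omega> lborel"
    "\<forall>x\<in>space \<Omega>. (\<lambda>n. Y n x) \<longlonglongrightarrow> Y' x"
  proof -
    have "weak_conv_m (\<lambda>n. \<mu> (r n)) M" using r(3) by (simp add: comp_def)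
    from Skorohod[of "\<lambda>n. \<mu> (r n)", OF \<mu> r(2) this] show ?thesis using that by blast
  qed
  have [measurable]: "G \<in> borel_measurable borel" using G(1) by (rule borel_measurable_continuous_onI)
  have [measurable]: "Y n \<in> borel_measurable \<Omega>" "Y' \<in> borel_measurable \<Omega>" for n using Y(2,4) by auto
  have KB[measurable]: "K \<in> sets borel" using assms(1) by (simp add: compact_imp_closed)
  have dY: "distr \<Omega> borel (\<lambda>\<omega>. G (Y n \<omega>)) = distr (measure_pmf (pmf_of_set {..r n})) borel x" for n
  proof -
    have "distr \<Omega> borel (\<lambda>\<omega>. G (Y n \<omega>)) = distr (distr \<Omega> borel (Y n)) borel G"
      by (subst distr_distr) (auto simp: comp_def)
    also have "\<dots> = distr (\<mu> (r n)) borel G" using Y(3) by simp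
    also have "\<dots> = distr (measure_pmf (pmf_of_set {..r n})) borel x"
      unfolding \<mu>_def by (subst distr_distr) (auto simp: comp_def t)
    finally show ?thesis .
  qed
  have lim: "(\<lambda>n. G (Y n \<omega>)) \<longlonglongrightarrow> G (Y' \<omega>)" if "\<omega> \<in> space \<Omega>" for \<omega>
    by (rule continuous_on_tendsto_compose[OF G(1) Y(5)[rule_format, OF that]]) simp_all
  have "AE \<omega> in \<Omega>. G (Y n \<omega>) \<in> K" for n
  proof -
    have "AE y in distr \<Omega> borel (\<lambda>\<omega>. G (Y n \<omega>)). y \<in> K"
      unfolding dY using assms(2) by (subst AE_distr_iff) auto
    then show ?thesis by (subst (asm) AE_distr_iff) auto
  qed
  then have "AE \<omega> in \<Omega>. \<forall>n. G (Y n \<omega>) \<in> K" by (simp add: AE_all_countable)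
  then have "AE \<omega> in \<Omega>. G (Y' \<omega>) \<in> K"
    using AE_space
  proof eventually_elim
    case (elim \<omega>)
    then show ?case using closed_sequentially[OF compact_imp_closed[OF assms(1)] _ lim] by blast
  qed
  then show ?thesis using that[OF r(1) Y(1) _ _ dY lim] by simp
qed

text \<open>A new point x n adds a row and a column, equal by symmetry and each at most B n, and the
  diagonal term F 0 \<le> L; moreover 2 B n \<le> B ((n + 1)^2 - n^2).\<close>

lemma double_sum_le_of_greedy:
  fixes F :: "'a::group_add \<Rightarrow> ennreal"
  assumes F: "\<And>y. F (- y) = F y" "\<And>y. F y \<le> ennreal L" and "0 \<le> L" "0 \<le> B"
    and x: "\<And>n. (\<Sum>i<n. F (x n - x i)) \<le> ennreal (B * real n)"
  shows "(\<Sum>i<n. \<Sum>j<n. F (x i - x j)) \<le> ennreal (B * (real n)\<^sup>2 + L * real n)"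
proof (induction n)
  case (Suc n)
  have sym: "F (x i - x n) = F (x n - x i)" for i using F(1)[of "x n - x i"] by simp
  have "(\<Sum>i<Suc n. \<Sum>j<Suc n. F (x i - x j))
    = (\<Sum>i<n. \<Sum>j<n. F (x i - x j)) + ((\<Sum>i<n. F (x n - x i)) + (\<Sum>i<n. F (x n - x i))) + F 0"
    by (simp add: sum.distrib sym add_ac)
  also have "\<dots> \<le> ennreal (B * (real n)\<^sup>2 + L * real n) + (ennreal (B * real n) + ennreal (B * real n)) + ennreal L"
    by (intro add_mono Suc.IH x F)
  also have "\<dots> = ennreal (B * (real n)\<^sup>2 + L * real n + 2 * B * real n + L)"
    using \<open>0 \<le> L\<close> \<open>0 \<le> B\<close> by (simp add: ennreal_plus[symmetric] algebra_simps del: ennreal_plus)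
  also have "\<dots> \<le> ennreal (B * (real (Suc n))\<^sup>2 + L * real (Suc n))"
    using \<open>0 \<le> B\<close> by (intro ennreal_leI) (simp add: power2_eq_square algebra_simps)
  finally show ?case .
qed simp

lemma nn_integral_empirical:
  fixes x :: "nat \<Rightarrow> 'a::topological_space"
  assumes "f \<in> borel_measurable borel"
  shows "(\<integral>\<^sup>+ y. f y \<partial>distr (measure_pmf (pmf_of_set {..n::nat})) borel x) = (\<Sum>i<Suc n. f (x i)) / of_nat (Suc n)"
  using assms by (subst nn_integral_distr) (auto simp: nn_integral_pmf_of_set lessThan_Suc_atMost)

text \<open>Greedily chosen points: if every finite family fails to have a large potential somewhere on
  \<open>K\<close>, then adding a point of failure each time bounds the energies of the empirical measures,
  and hence that of a limit measure.\<close>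

lemma exists_large_discrete_potential:
  fixes K :: "(real^'n) set"
  assumes K: "compact K" "K \<noteq> {}" and \<alpha>: "\<alpha> < real CARD('n)"
    and inf: "\<And>\<tau>. borel_measure_on K \<tau> \<Longrightarrow> prob_space \<tau> \<Longrightarrow> riesz_energy \<alpha> \<tau> = \<infinity>" and "0 \<le> B"
  shows "\<exists>n (x :: nat \<Rightarrow> real^'n). (\<forall>i. x i \<in> K) \<and>
    (\<forall>y\<in>K. ennreal (B * real (Suc n)) \<le> (\<Sum>i<Suc n. riesz_power CARD('n) \<alpha> (norm (y - x i))))"
proof (rule ccontr)
  assume neg: "\<not> ?thesis"
  define k where "k = (\<lambda>y::real^'n. riesz_power CARD('n) \<alpha> (norm y))"
  have [measurable]: "k \<in> borel_measurable borel" unfolding k_def by measurable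
  obtain a where a: "a \<in> K" using K(2) by blast
  have step: "\<exists>y\<in>K. (\<Sum>i<n. k (y - xs ! i)) \<le> ennreal (B * real n)"
    if "set xs \<subseteq> K" "length xs = n" for xs n
  proof (cases n)
    case 0
    then show ?thesis using a by auto
  next
    case (Suc n')
    \<comment> \<open>The negated claim concerns families indexed by all naturals, so the list is
      continued by a fixed point of K.\<close>
    define x where "x = (\<lambda>i. if i < n then xs ! i else a)"
    have "\<forall>i. x i \<in> K" using that a by (auto simp: x_def)
    then obtain y where y: "y \<in> K" "\<not> ennreal (B * real (Suc n')) \<le> (\<Sum>i<Suc n'. riesz_power CARD('n) \<alpha> (norm (y - x i)))"
      using neg by blast
    have "(\<Sum>i<Suc n'. riesz_power CARD('n) \<alpha> (norm (y - x i))) = (\<Sum>i<n. k (y - xs ! i))"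
      unfolding Suc by (rule sum.cong) (auto simp: x_def k_def Suc)
    then show ?thesis using y Suc by (intro bexI[of _ y]) auto
  qed
  \<comment> \<open>Each new point depends on all earlier ones; hence the choice is made among lists
    that grow by one entry.\<close>
  have "\<exists>f. \<forall>n. (set (f n) \<subseteq> K \<and> length (f n) = n) \<and>
      (\<exists>y. f (Suc n) = f n @ [y] \<and> (\<Sum>i<n. k (y - f n ! i)) \<le> ennreal (B * real n))"
  proof (rule dependent_nat_choice)
    show "\<exists>xs::(real^'n) list. set xs \<subseteq> K \<and> length xs = 0" by auto
    fix xs n assume "set xs \<subseteq> K \<and> length xs = (n::nat)"
    then obtain y where "y \<in> K" "(\<Sum>i<n. k (y - xs ! i)) \<le> ennreal (B * real n)" using step by blast
    then show "\<exists>ys. (set ys \<subseteq> K \<and> length ys = Suc n) \<and>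
        (\<exists>y. ys = xs @ [y] \<and> (\<Sum>i<n. k (y - xs ! i)) \<le> ennreal (B * real n))"
      using \<open>set xs \<subseteq> K \<and> length xs = n\<close> by (intro exI[of _ "xs @ [y]"]) auto
  qed
  then obtain f where f0: "\<forall>n. (set (f n) \<subseteq> K \<and> length (f n) = n) \<and>
      (\<exists>y. f (Suc n) = f n @ [y] \<and> (\<Sum>i<n. k (y - f n ! i)) \<le> ennreal (B * real n))" ..
  note f = f0[rule_format, THEN conjunct1, THEN conjunct1] f0[rule_format, THEN conjunct1, THEN conjunct2]
    f0[rule_format, THEN conjunct2]
  define x where "x = (\<lambda>n. f (Suc n) ! n)"
  have fx: "f n ! i = x i" if "i < n" for i n
    using that
  proof (induction n)
    case (Suc n)
    obtain y where "f (Suc n) = f n @ [y]" using f(3) by blast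
    then show ?case using Suc f(2)[of n] by (cases "i = n") (auto simp: nth_append x_def)
  qed simp
  have xK: "x n \<in> K" for n
    using f(1)[of "Suc n"] f(2)[of "Suc n"] nth_mem[of n "f (Suc n)"] by (auto simp: x_def)
  have xB: "(\<Sum>i<n. k (x n - x i)) \<le> ennreal (B * real n)" for n
  proof -
    obtain y where y: "f (Suc n) = f n @ [y]" "(\<Sum>i<n. k (y - f n ! i)) \<le> ennreal (B * real n)" using f(3) by blast
    then have "x n = y" using f(2)[of n] by (simp add: x_def nth_append)
    then show ?thesis using y(2) fx by simp
  qed
  obtain r :: "nat \<Rightarrow> nat" and \<Omega> :: "real measure" and Z :: "nat \<Rightarrow> real \<Rightarrow> real^'n" and Z' :: "real \<Rightarrow> real^'n"
    where r: "strict_mono r" and \<Omega>: "prob_space \<Omega>" and Z[measurable]: "\<And>n. Z n \<in> borel_measurable \<Omega>"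
      and Z'[measurable]: "Z' \<in> borel_measurable \<Omega>"
      and dZ: "\<And>n. distr \<Omega> borel (Z n) = distr (measure_pmf (pmf_of_set {..r n})) borel x"
      and lim: "\<And>\<omega>. \<omega> \<in> space \<Omega> \<Longrightarrow> (\<lambda>n. Z n \<omega>) \<longlonglongrightarrow> Z' \<omega>" and ZK: "AE \<omega> in \<Omega>. Z' \<omega> \<in> K"
    by (rule empirical_subsequence_limit[OF K(1) xK]) (rule that)
  interpret \<Omega>: prob_space \<Omega> by fact
  define \<tau> where "\<tau> = distr \<Omega> borel Z'"
  have KB[measurable]: "K \<in> sets borel" using K(1) by (simp add: compact_imp_closed)
  have "prob_space \<tau>" unfolding \<tau>_def by (rule \<Omega>.prob_space_distr) simp
  moreover have "borel_measure_on K \<tau>"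
    unfolding borel_measure_on_def
  proof
    show "sets \<tau> = sets borel" by (simp add: \<tau>_def)
    have "AE y in \<tau>. y \<in> K" unfolding \<tau>_def using ZK by (subst AE_distr_iff) auto
    then show "emeasure \<tau> (- K) = 0"
      by (subst (asm) AE_iff_measurable[where N = "- K"]) (auto simp: \<tau>_def)
  qed
  moreover have "riesz_energy \<alpha> \<tau> \<le> ennreal B"
  proof -
    \<comment> \<open>The kernel is infinite on the diagonal, so the energies of empirical measures
      are taken for the kernel cut at L; for N points the diagonal then costs at most L / N. The
      limit in n is taken for fixed L, and only then L grows.\<close>
    define F where "F = (\<lambda>L (y::real^'n). min (k y) (ennreal (real L)))"
    have [measurable]: "F L \<in> borel_measurable borel" for L unfolding F_def by measurable
    have E: "(\<integral>\<^sup>+ y. \<integral>\<^sup>+ z. h (y - z) \<partial>distr \<Omega> borel V \<partial>distr \<Omega> borel V)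
      = (\<integral>\<^sup>+ \<omega>. \<integral>\<^sup>+ \<omega>'. h (V \<omega> - V \<omega>') \<partial>\<Omega> \<partial>\<Omega>)"
      if [measurable]: "V \<in> borel_measurable \<Omega>" "h \<in> borel_measurable borel" for V :: "real \<Rightarrow> real^'n" and h :: "real^'n \<Rightarrow> ennreal"
    proof -
      interpret V: prob_space "distr \<Omega> borel V" by (rule \<Omega>.prob_space_distr) simp
      show ?thesis by (subst nn_integral_distr, measurable) (auto simp: nn_integral_distr intro!: nn_integral_cong)
    qed
    have FE: "(\<integral>\<^sup>+ \<omega>. \<integral>\<^sup>+ \<omega>'. F L (Z n \<omega> - Z n \<omega>') \<partial>\<Omega> \<partial>\<Omega>) \<le> ennreal (B + real L / real (Suc n))" for L n
    proof -
      define N where "N = Suc (r n)"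
      have N: "Suc n \<le> N" unfolding N_def using strict_mono_imp_increasing[OF r] by simp
      have "(\<integral>\<^sup>+ \<omega>. \<integral>\<^sup>+ \<omega>'. F L (Z n \<omega> - Z n \<omega>') \<partial>\<Omega> \<partial>\<Omega>)
        = (\<integral>\<^sup>+ y. \<integral>\<^sup>+ z. F L (y - z) \<partial>distr \<Omega> borel (Z n) \<partial>distr \<Omega> borel (Z n))"
        by (rule E[symmetric]) measurable
      also have "\<dots> = (\<integral>\<^sup>+ y. (\<Sum>j<N. F L (y - x j)) / of_nat N \<partial>distr \<Omega> borel (Z n))"
        unfolding dZ N_def by (intro nn_integral_cong nn_integral_empirical) measurable
      also have "\<dots> = (\<Sum>i<N. (\<Sum>j<N. F L (x i - x j)) / of_nat N) / of_nat N"
        unfolding dZ N_def by (rule nn_integral_empirical) measurable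
      also have "\<dots> = (\<Sum>i<N. \<Sum>j<N. F L (x i - x j)) / (of_nat N * of_nat N)"
      proof -
        have "inverse (of_nat N) * inverse (of_nat N) = inverse (of_nat N * of_nat N :: ennreal)"
          using N by (simp add: ennreal_of_nat_eq_real_of_nat inverse_ennreal ennreal_mult[symmetric])
        then show ?thesis by (simp add: divide_ennreal_def sum_distrib_right[symmetric] mult.assoc)
      qed
      also have "\<dots> \<le> ennreal (B * (real N)\<^sup>2 + real L * real N) / (of_nat N * of_nat N)"
      proof (intro divide_right_mono_ennreal double_sum_le_of_greedy)
        show "(\<Sum>i<n. F L (x n - x i)) \<le> ennreal (B * real n)" for n
          using xB[of n] by (rule order_trans[rotated]) (auto intro!: sum_mono simp: F_def)
      qed (auto simp: F_def k_def \<open>0 \<le> B\<close>)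
      also have "\<dots> = ennreal (B + real L / real N)"
      proof -
        have "of_nat N * of_nat N = ennreal ((real N)\<^sup>2)"
          by (simp add: ennreal_of_nat_eq_real_of_nat ennreal_mult[symmetric] power2_eq_square)
        moreover have "(B * (real N)\<^sup>2 + real L * real N) / (real N)\<^sup>2 = B + real L / real N"
          using N by (simp add: power2_eq_square add_divide_distrib)
        ultimately show ?thesis
          using N \<open>0 \<le> B\<close> by (simp only: divide_ennreal[of "B * (real N)\<^sup>2 + real L * real N" "(real N)\<^sup>2"]
              add_nonneg_nonneg mult_nonneg_nonneg of_nat_0_le_iff zero_le_power2 zero_less_power2 of_nat_eq_0_iff)
      qed
      also have "\<dots> \<le> ennreal (B + real L / real (Suc n))"
        using N by (intro ennreal_leI add_left_mono divide_left_mono) auto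
      finally show ?thesis .
    qed
    have FL: "(\<integral>\<^sup>+ \<omega>. \<integral>\<^sup>+ \<omega>'. F L (Z' \<omega> - Z' \<omega>') \<partial>\<Omega> \<partial>\<Omega>) \<le> ennreal B" for L
    proof -
      have Fl: "F L (Z' \<omega> - Z' \<omega>') = liminf (\<lambda>n. F L (Z n \<omega> - Z n \<omega>'))"
        if "\<omega> \<in> space \<Omega>" "\<omega>' \<in> space \<Omega>" for \<omega> \<omega>'
        unfolding F_def k_def
        by (intro lim_imp_Liminf[symmetric] tendsto_min tendsto_const
            isCont_tendsto_compose[OF isCont_riesz_power[OF \<alpha>]] tendsto_diff lim that) simp
      have "(\<integral>\<^sup>+ \<omega>. \<integral>\<^sup>+ \<omega>'. F L (Z' \<omega> - Z' \<omega>') \<partial>\<Omega> \<partial>\<Omega>)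
        = (\<integral>\<^sup>+ \<omega>. \<integral>\<^sup>+ \<omega>'. liminf (\<lambda>n. F L (Z n \<omega> - Z n \<omega>')) \<partial>\<Omega> \<partial>\<Omega>)"
        by (intro nn_integral_cong Fl)
      also have "\<dots> \<le> (\<integral>\<^sup>+ \<omega>. liminf (\<lambda>n. \<integral>\<^sup>+ \<omega>'. F L (Z n \<omega> - Z n \<omega>') \<partial>\<Omega>) \<partial>\<Omega>)"
        by (intro nn_integral_mono nn_integral_liminf) measurable
      also have "\<dots> \<le> liminf (\<lambda>n. \<integral>\<^sup>+ \<omega>. \<integral>\<^sup>+ \<omega>'. F L (Z n \<omega> - Z n \<omega>') \<partial>\<Omega> \<partial>\<Omega>)"
        by (intro nn_integral_liminf) measurable
      also have "\<dots> \<le> liminf (\<lambda>n. ennreal (B + real L / real (Suc n)))"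
        by (intro Liminf_mono always_eventually allI FE)
      also have "\<dots> = ennreal B"
      proof -
        have "(\<lambda>n. B + real L * (1 / real (Suc n))) \<longlonglongrightarrow> B + real L * 0"
          by (intro tendsto_intros LIMSEQ_Suc[OF lim_1_over_n])
        then have "(\<lambda>n. ennreal (B + real L / real (Suc n))) \<longlonglongrightarrow> ennreal B"
          by (intro tendsto_ennrealI) simp
        then show ?thesis by (simp add: lim_imp_Liminf)
      qed
      finally show ?thesis .
    qed
    have kF: "k y = (SUP L. F L y)" for y
    proof -
      have "(SUP L. min (k y) (ennreal (real L))) = min (k y) (SUP L. ennreal (real L))"
        by (simp add: inf_min[symmetric] inf_SUP)
      also have "(SUP L. ennreal (real L)) = top"
        using ennreal_SUP_of_nat_eq_top by (simp add: ennreal_of_nat_eq_real_of_nat)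
      finally show ?thesis by (simp add: F_def)
    qed
    have incF: "incseq (\<lambda>L. F L y)" for y
      unfolding incseq_def F_def by (intro allI impI min.mono order_refl ennreal_leI) simp
    have "riesz_energy \<alpha> \<tau> = (\<integral>\<^sup>+ \<omega>. \<integral>\<^sup>+ \<omega>'. k (Z' \<omega> - Z' \<omega>') \<partial>\<Omega> \<partial>\<Omega>)"
      using E[OF Z', of k] unfolding riesz_energy_def riesz_potential_def \<tau>_def k_def by simp
    also have "\<dots> = (\<integral>\<^sup>+ \<omega>. (SUP L. \<integral>\<^sup>+ \<omega>'. F L (Z' \<omega> - Z' \<omega>') \<partial>\<Omega>) \<partial>\<Omega>)"
      unfolding kF using incF
      by (intro nn_integral_cong nn_integral_monotone_convergence_SUP) (auto simp: incseq_def le_fun_def)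
    also have "\<dots> = (SUP L. \<integral>\<^sup>+ \<omega>. \<integral>\<^sup>+ \<omega>'. F L (Z' \<omega> - Z' \<omega>') \<partial>\<Omega> \<partial>\<Omega>)"
    proof (intro nn_integral_monotone_convergence_SUP)
      show "incseq (\<lambda>L \<omega>. \<integral>\<^sup>+ \<omega>'. F L (Z' \<omega> - Z' \<omega>') \<partial>\<Omega>)"
        using incF by (auto simp: incseq_def le_fun_def intro!: nn_integral_mono)
    qed measurable
    also have "\<dots> \<le> ennreal B" by (intro SUP_least FL)
    finally show ?thesis .
  qed
  ultimately show False using inf[of \<tau>] by (simp add: top_unique)
qed

section \<open>Equilibrium measures\<close>

text \<open>The measure (1 - t) M + t N. Written as a bind, it inherits total mass 1 and its
  integral formula from the general facts on bind.\<close>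

definition mixture :: "real \<Rightarrow> 'a measure \<Rightarrow> 'a measure \<Rightarrow> 'a measure" where
  "mixture t M N = measure_pmf (bernoulli_pmf t) \<bind> (\<lambda>b. if b then N else M)"

lemma mixture:
  fixes M N :: "'a::topological_space measure"
  assumes M: "prob_space M" "sets M = sets borel" and N: "prob_space N" "sets N = sets borel" and t: "0 \<le> t" "t \<le> 1"
  shows prob_space_mixture: "prob_space (mixture t M N)"
    and sets_mixture: "sets (mixture t M N) = sets borel"
    and nn_integral_mixture: "\<And>f. f \<in> borel_measurable borel \<Longrightarrow>
      (\<integral>\<^sup>+ x. f x \<partial>mixture t M N) = ennreal (1 - t) * (\<integral>\<^sup>+ x. f x \<partial>M) + ennreal t * (\<integral>\<^sup>+ x. f x \<partial>N)"
proof -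
  have K: "(\<lambda>b. if b then N else M) \<in> measurable (measure_pmf (bernoulli_pmf t)) (subprob_algebra borel)"
    using M N by (auto simp: space_subprob_algebra prob_space_imp_subprob_space)
  show "prob_space (mixture t M N)"
    unfolding mixture_def by (rule measure_pmf.prob_space_bind[OF _ K]) (use M N in auto)
  show "sets (mixture t M N) = sets borel"
    unfolding mixture_def using M N by (intro sets_bind) auto
  fix f :: "'a \<Rightarrow> ennreal" assume f: "f \<in> borel_measurable borel"
  show "(\<integral>\<^sup>+ x. f x \<partial>mixture t M N) = ennreal (1 - t) * (\<integral>\<^sup>+ x. f x \<partial>M) + ennreal t * (\<integral>\<^sup>+ x. f x \<partial>N)"
    unfolding mixture_def nn_integral_bind[OF f K] using t by (simp add: mult.commute add.commute)
qed

lemma borel_measure_on_mixture: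
  assumes M: "prob_space M" "borel_measure_on E M" and N: "prob_space N" "borel_measure_on E N"
    and t: "0 \<le> t" "t \<le> 1" and E: "E \<in> sets borel"
  shows "borel_measure_on E (mixture t M N)"
proof -
  have s: "sets M = sets borel" "sets N = sets borel" using M N by (auto simp: borel_measure_on_def)
  note mix = mixture[OF M(1) s(1) N(1) s(2) t]
  have "emeasure (mixture t M N) (- E) = (\<integral>\<^sup>+ x. indicator (- E) x \<partial>mixture t M N)"
    using E mix(2) by (subst nn_integral_indicator) auto
  also have "\<dots> = ennreal (1 - t) * emeasure M (- E) + ennreal t * emeasure N (- E)"
    using E by (subst mix(3)) (auto simp: nn_integral_indicator s)
  finally show ?thesis using M(2) N(2) mix(2) by (simp add: borel_measure_on_def)
qed

lemma borel_measurable_riesz_potential: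
  fixes M :: "(real^'n) measure"
  assumes "finite_measure M" and [measurable_cong]: "sets M = sets borel"
  shows "riesz_potential \<alpha> M \<in> borel_measurable borel"
proof -
  interpret finite_measure M by fact
  show ?thesis unfolding riesz_potential_def by measurable
qed

lemma riesz_mutual_energy_commute:
  fixes M N :: "(real^'n) measure"
  assumes "finite_measure M" and [measurable_cong]: "sets M = sets borel"
    and "finite_measure N" and [measurable_cong]: "sets N = sets borel"
  shows "(\<integral>\<^sup>+ x. riesz_potential \<alpha> M x \<partial>N) = (\<integral>\<^sup>+ x. riesz_potential \<alpha> N x \<partial>M)"
proof -
  interpret M: finite_measure M by fact
  interpret N: finite_measure N by fact
  interpret P: pair_sigma_finite M N ..
  have "(\<integral>\<^sup>+ x. riesz_potential \<alpha> M x \<partial>N) = (\<integral>\<^sup>+ t. \<integral>\<^sup>+ x. riesz_power CARD('n) \<alpha> (norm (x - t)) \<partial>N \<partial>M)"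
    unfolding riesz_potential_def by (rule P.Fubini') measurable
  then show ?thesis unfolding riesz_potential_def by (simp add: norm_minus_commute)
qed

lemma quadratic_minimum_at_0:
  fixes w a j :: real
  assumes "\<And>t. 0 < t \<Longrightarrow> t \<le> 1 \<Longrightarrow> w \<le> (1 - t) * ((1 - t) * w + t * a) + t * ((1 - t) * a + t * j)"
  shows "w \<le> a"
proof (rule ccontr)
  assume "\<not> w \<le> a"
  \<comment> \<open>The hypothesis amounts to 2 t d \<le> t^2 c, and this t satisfies t c \<le> t (d
    + |c|) = d.\<close>
  define d c t where "d = w - a" and "c = w + j - 2 * a" and "t = d / (d + \<bar>c\<bar>)"
  have d: "0 < d" using \<open>\<not> w \<le> a\<close> by (simp add: d_def)
  have t: "0 < t" "t \<le> 1" using d by (auto simp: t_def field_simps)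
  have "t * (2 * d - t * c) \<le> 0" using assms[OF t] by (simp add: d_def c_def algebra_simps)
  then have "2 * d \<le> t * c" using t(1) by (simp add: mult_le_0_iff)
  also have "\<dots> \<le> t * (d + \<bar>c\<bar>)" using t d by (intro mult_left_mono) auto
  also have "\<dots> = d" using d by (simp add: t_def)
  finally show False using d by simp
qed

section \<open>The equilibrium potential almost everywhere\<close>

lemma equilibrium_measureD:
  assumes "equilibrium_measure \<alpha> E \<mu>"
  shows "prob_space \<mu>" "finite_measure \<mu>" "sets \<mu> = sets borel" "emeasure \<mu> (- E) = 0"
    "riesz_energy \<alpha> \<mu> = min_riesz_energy \<alpha> E"
  using assms by (auto simp: equilibrium_measure_def borel_measure_on_def prob_space.axioms(1) prob_space_def)

text \<open>First variation of the energy at \<open>\<mu>\<close> in the direction of \<open>\<tau>\<close>.\<close>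

lemma min_energy_le_mutual_energy:
  fixes E :: "(real^'n) set"
  assumes E: "E \<in> sets borel" and eq: "equilibrium_measure \<alpha> E \<mu>" and W: "min_riesz_energy \<alpha> E < \<infinity>"
    and \<tau>: "borel_measure_on E \<tau>" "prob_space \<tau>" "riesz_energy \<alpha> \<tau> < \<infinity>"
  shows "min_riesz_energy \<alpha> E \<le> (\<integral>\<^sup>+ x. riesz_potential \<alpha> \<mu> x \<partial>\<tau>)"
proof (cases "(\<integral>\<^sup>+ x. riesz_potential \<alpha> \<mu> x \<partial>\<tau>) = \<infinity>")
  case False
  note \<mu> = equilibrium_measureD[OF eq]
  have \<tau>s: "sets \<tau> = sets borel" using \<tau> by (simp add: borel_measure_on_def)
  have \<tau>f: "finite_measure \<tau>" using \<tau> by (simp add: prob_space_def)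
  define w j a where "w = enn2real (min_riesz_energy \<alpha> E)" and "j = enn2real (riesz_energy \<alpha> \<tau>)"
    and "a = enn2real (\<integral>\<^sup>+ x. riesz_potential \<alpha> \<mu> x \<partial>\<tau>)"
  have w: "min_riesz_energy \<alpha> E = ennreal w" "0 \<le> w" using W by (simp_all add: w_def less_top)
  have j: "riesz_energy \<alpha> \<tau> = ennreal j" "0 \<le> j" using \<tau> by (simp_all add: j_def less_top)
  have a: "(\<integral>\<^sup>+ x. riesz_potential \<alpha> \<mu> x \<partial>\<tau>) = ennreal a" "0 \<le> a" using False by (simp_all add: a_def less_top)
  have a': "(\<integral>\<^sup>+ x. riesz_potential \<alpha> \<tau> x \<partial>\<mu>) = ennreal a"
    using riesz_mutual_energy_commute[OF \<tau>f \<tau>s \<mu>(2,3)] a by simp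
  have "w \<le> (1 - t) * ((1 - t) * w + t * a) + t * ((1 - t) * a + t * j)" if t: "0 < t" "t \<le> 1" for t
  proof -
    have t': "0 \<le> t" using t by simp
    define \<rho> where "\<rho> = mixture t \<mu> \<tau>"
    note mix = mixture[OF \<mu>(1,3) \<tau>(2) \<tau>s t' t(2), folded \<rho>_def]
    have [measurable]: "riesz_potential \<alpha> \<mu> \<in> borel_measurable borel" "riesz_potential \<alpha> \<tau> \<in> borel_measurable borel"
      by (rule borel_measurable_riesz_potential; fact)+
    note [measurable_cong] = \<mu>(3) \<tau>s
    have pot: "riesz_potential \<alpha> \<rho> x = ennreal (1 - t) * riesz_potential \<alpha> \<mu> x + ennreal t * riesz_potential \<alpha> \<tau> x" for x
      unfolding riesz_potential_def by (rule mix(3)) measurable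
    have "riesz_energy \<alpha> \<rho> = ennreal (1 - t) * (\<integral>\<^sup>+ x. riesz_potential \<alpha> \<rho> x \<partial>\<mu>) + ennreal t * (\<integral>\<^sup>+ x. riesz_potential \<alpha> \<rho> x \<partial>\<tau>)"
      unfolding riesz_energy_def by (rule mix(3)) (simp add: pot)
    also have "(\<integral>\<^sup>+ x. riesz_potential \<alpha> \<rho> x \<partial>\<mu>) = ennreal (1 - t) * ennreal w + ennreal t * ennreal a"
      unfolding pot using \<mu>(5) a' w(1) by (simp add: nn_integral_add nn_integral_cmult riesz_energy_def)
    also have "(\<integral>\<^sup>+ x. riesz_potential \<alpha> \<rho> x \<partial>\<tau>) = ennreal (1 - t) * ennreal a + ennreal t * ennreal j"
      unfolding pot using a j(1) by (simp add: nn_integral_add nn_integral_cmult riesz_energy_def)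
    finally have energy: "riesz_energy \<alpha> \<rho> = ennreal ((1 - t) * ((1 - t) * w + t * a) + t * ((1 - t) * a + t * j))"
      using t w(2) a(2) j(2) by (simp add: ennreal_mult'[symmetric] ennreal_plus[symmetric] del: ennreal_plus)
    have "borel_measure_on E \<rho>"
      unfolding \<rho>_def using eq by (intro borel_measure_on_mixture \<mu>(1) \<tau> t' t(2) E) (simp add: equilibrium_measure_def)
    then have "min_riesz_energy \<alpha> E \<le> riesz_energy \<alpha> \<rho>"
      unfolding min_riesz_energy_def using mix(1) by (intro INF_lower) auto
    then have "ennreal w \<le> ennreal ((1 - t) * ((1 - t) * w + t * a) + t * ((1 - t) * a + t * j))"
      unfolding energy w(1) .
    then show ?thesis using t w(2) a(2) j(2) by (subst (asm) ennreal_le_iff) auto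
  qed
  then have "w \<le> a" by (rule quadratic_minimum_at_0)
  then show ?thesis unfolding a(1) w(1) by (rule ennreal_leI)
qed simp


text \<open>Otherwise condition \<mu> on this set. The resulting measure on E has finite energy, at
  most the minimum energy over the squared mass of the set, and its mutual energy with \<mu> is at
  most c, against \<open>min_energy_le_mutual_energy\<close>.\<close>

lemma equilibrium_low_potential_null:
  fixes E :: "(real^'n) set"
  assumes E: "E \<in> sets borel" and eq: "equilibrium_measure \<alpha> E \<mu>" and W: "min_riesz_energy \<alpha> E < \<infinity>"
    and c: "c < min_riesz_energy \<alpha> E"
  shows "emeasure \<mu> {x. riesz_potential \<alpha> \<mu> x \<le> c} = 0"
proof (rule ccontr)
  note \<mu> = equilibrium_measureD[OF eq]
  interpret prob_space \<mu> by (rule \<mu>(1))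
  note [measurable_cong] = \<mu>(3)
  have [measurable]: "riesz_potential \<alpha> \<mu> \<in> borel_measurable borel"
    by (rule borel_measurable_riesz_potential[OF \<mu>(2,3)])
  define A where "A = {x. riesz_potential \<alpha> \<mu> x \<le> c}"
  have A[measurable]: "A \<in> sets borel" unfolding A_def by measurable
  assume "emeasure \<mu> {x. riesz_potential \<alpha> \<mu> x \<le> c} \<noteq> 0"
  then have A0: "emeasure \<mu> A \<noteq> 0" "emeasure \<mu> A \<noteq> \<infinity>" by (auto simp: A_def)
  define \<tau> where "\<tau> = uniform_measure \<mu> A"
  have int: "(\<integral>\<^sup>+ x. f x \<partial>\<tau>) = (\<integral>\<^sup>+ x. f x * indicator A x \<partial>\<mu>) / emeasure \<mu> A"
    if "f \<in> borel_measurable borel" for f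
    unfolding \<tau>_def using that by (intro nn_integral_uniform_measure) (auto simp: \<mu>(3))
  have \<tau>: "prob_space \<tau>" "sets \<tau> = sets borel"
    unfolding \<tau>_def by (rule prob_space_uniform_measure[OF A0]) (simp add: \<mu>(3))
  have le: "(\<integral>\<^sup>+ x. f x * indicator A x \<partial>\<mu>) \<le> (\<integral>\<^sup>+ x. f x \<partial>\<mu>)" for f :: "real^'n \<Rightarrow> ennreal"
    by (intro nn_integral_mono) (auto split: split_indicator)
  have \<tau>E: "borel_measure_on E \<tau>"
    unfolding borel_measure_on_def
  proof
    have "emeasure \<tau> (- E) = emeasure \<mu> (A \<inter> - E) / emeasure \<mu> A"
      unfolding \<tau>_def using E by (intro emeasure_uniform_measure) (auto simp: \<mu>(3))
    moreover have "emeasure \<mu> (A \<inter> - E) \<le> emeasure \<mu> (- E)"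
      using E by (intro emeasure_mono) (auto simp: \<mu>(3))
    ultimately show "emeasure \<tau> (- E) = 0" by (simp add: \<mu>(4))
  qed (rule \<tau>(2))
  have [measurable]: "riesz_potential \<alpha> \<tau> \<in> borel_measurable borel"
    using \<tau> by (intro borel_measurable_riesz_potential) (auto simp: prob_space_def)
  have pot: "riesz_potential \<alpha> \<tau> x \<le> riesz_potential \<alpha> \<mu> x / emeasure \<mu> A" for x
    unfolding riesz_potential_def by (subst int) (auto intro!: divide_right_mono_ennreal le)
  have "riesz_energy \<alpha> \<tau> \<le> (\<integral>\<^sup>+ x. riesz_potential \<alpha> \<tau> x \<partial>\<mu>) / emeasure \<mu> A"
    unfolding riesz_energy_def by (subst int) (auto intro!: divide_right_mono_ennreal le)
  also have "\<dots> \<le> (\<integral>\<^sup>+ x. riesz_potential \<alpha> \<mu> x / emeasure \<mu> A \<partial>\<mu>) / emeasure \<mu> A"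
    by (intro divide_right_mono_ennreal nn_integral_mono pot)
  also have "\<dots> = min_riesz_energy \<alpha> E / emeasure \<mu> A / emeasure \<mu> A"
    using \<mu>(5) by (subst nn_integral_divide) (auto simp: riesz_energy_def)
  also have "\<dots> < \<infinity>"
    using W A0 by (auto simp: divide_ennreal_def ennreal_mult_eq_top_iff less_top[symmetric])
  finally have "min_riesz_energy \<alpha> E \<le> (\<integral>\<^sup>+ x. riesz_potential \<alpha> \<mu> x \<partial>\<tau>)"
    by (rule min_energy_le_mutual_energy[OF E eq W \<tau>E \<tau>(1)])
  also have "\<dots> = (\<integral>\<^sup>+ x. riesz_potential \<alpha> \<mu> x * indicator A x \<partial>\<mu>) / emeasure \<mu> A"
    by (rule int) measurable
  also have "\<dots> \<le> (\<integral>\<^sup>+ x. c * indicator A x \<partial>\<mu>) / emeasure \<mu> A"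
    by (intro divide_right_mono_ennreal nn_integral_mono) (auto simp: A_def split: split_indicator)
  also have "\<dots> = c"
    using A0 by (simp add: nn_integral_cmult_indicator \<mu>(3) ennreal_mult_divide_eq)
  finally show False using c by simp
qed

text \<open>By \<open>equilibrium_low_potential_null\<close> the potential is almost everywhere at
  least the energy, and its integral equals the energy, so the excess integrates to 0.\<close>

lemma equilibrium_potential_le_AE:
  fixes E :: "(real^'n) set"
  assumes E: "E \<in> sets borel" and eq: "equilibrium_measure \<alpha> E \<mu>" and W: "min_riesz_energy \<alpha> E < \<infinity>"
  shows "AE x in \<mu>. riesz_potential \<alpha> \<mu> x \<le> min_riesz_energy \<alpha> E"
proof -
  note \<mu> = equilibrium_measureD[OF eq]
  interpret prob_space \<mu> by (rule \<mu>(1))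
  note [measurable_cong] = \<mu>(3)
  let ?U = "riesz_potential \<alpha> \<mu>" and ?W = "min_riesz_energy \<alpha> E"
  have [measurable]: "?U \<in> borel_measurable borel"
    by (rule borel_measurable_riesz_potential[OF \<mu>(2,3)])
  have ge: "AE x in \<mu>. ?W \<le> ?U x"
  proof (cases "?W = 0")
    case False
    then obtain s where s: "\<And>n. s n < ?W" "s \<longlonglongrightarrow> ?W"
      using approx_from_below_dense_linorder[of 0 ?W] by (auto simp: zero_less_iff_neq_zero)
    have "AE x in \<mu>. s n < ?U x" for n
      using equilibrium_low_potential_null[OF E eq W s(1)[of n]]
      by (intro AE_I[where N = "{x. ?U x \<le> s n}"]) (auto simp: \<mu>(3))
    then have "AE x in \<mu>. \<forall>n. s n < ?U x" by (simp add: AE_all_countable)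
    then show ?thesis
      by eventually_elim (auto intro: LIMSEQ_le_const2[OF s(2)] less_imp_le)
  qed simp
  have "?W = (\<integral>\<^sup>+ x. ?U x \<partial>\<mu>)" using \<mu>(5) by (simp add: riesz_energy_def)
  also have "\<dots> = (\<integral>\<^sup>+ x. (?U x - ?W) + ?W \<partial>\<mu>)"
    by (intro nn_integral_cong_AE) (use ge in eventually_elim, simp add: diff_add_cancel_ennreal)
  also have "\<dots> = (\<integral>\<^sup>+ x. ?U x - ?W \<partial>\<mu>) + ?W"
    by (subst nn_integral_add) (auto simp: emeasure_space_1)
  finally have W_eq: "?W = (\<integral>\<^sup>+ x. ?U x - ?W \<partial>\<mu>) + ?W" .
  have "(\<integral>\<^sup>+ x. ?U x - ?W \<partial>\<mu>) = (\<integral>\<^sup>+ x. ?U x - ?W \<partial>\<mu>) + ?W - ?W" using W by simp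
  also have "\<dots> = ?W - ?W" by (simp only: W_eq[symmetric])
  also have "\<dots> = 0" using W by simp
  finally have "(\<integral>\<^sup>+ x. ?U x - ?W \<partial>\<mu>) = 0" .
  then have "AE x in \<mu>. ?U x - ?W = 0"
    by (subst (asm) nn_integral_0_iff_AE) auto
  then show ?thesis
    by eventually_elim (use W in \<open>auto simp: ennreal_minus_eq_0\<close>)
qed

section \<open>Minima over finitely many kernels\<close>

lemma tendsto_Min:
  fixes f :: "'i \<Rightarrow> 'a \<Rightarrow> 'b::linorder_topology"
  assumes "finite I" "I \<noteq> {}" "\<And>i. i \<in> I \<Longrightarrow> (f i \<longlongrightarrow> l i) F"
  shows "((\<lambda>x. MIN i\<in>I. f i x) \<longlongrightarrow> (MIN i\<in>I. l i)) F"
  using assms by (induction rule: finite_ne_induct) (auto intro!: tendsto_min)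

text \<open>Ties go to the least index. The partition is expressed by indicators summing to 1, the
  form in which a measure is split and reassembled under the integral.\<close>

lemma measurable_argmin_partition:
  fixes f :: "nat \<Rightarrow> 'a::topological_space \<Rightarrow> ennreal"
  assumes I: "finite I" "I \<noteq> {}" and [measurable]: "\<And>i. i \<in> I \<Longrightarrow> f i \<in> borel_measurable borel"
  obtains A where "\<And>i. i \<in> I \<Longrightarrow> A i \<in> sets borel" "\<And>x. (\<Sum>i\<in>I. indicator (A i) x) = (1::ennreal)"
    "\<And>i x. i \<in> I \<Longrightarrow> x \<in> A i \<Longrightarrow> f i x = (MIN j\<in>I. f j x)"
proof
  define A where "A = (\<lambda>i. {x. f i x = (MIN j\<in>I. f j x) \<and> (\<forall>j\<in>I. j < i \<longrightarrow> f j x \<noteq> (MIN j\<in>I. f j x))})"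
  show "A i \<in> sets borel" if [simp]: "i \<in> I" for i
    unfolding A_def using I by measurable
  show "f i x = (MIN j\<in>I. f j x)" if "i \<in> I" "x \<in> A i" for i x using that by (simp add: A_def)
  fix x
  have "(MIN j\<in>I. f j x) \<in> (\<lambda>j. f j x) ` I" using I by (intro Min_in) auto
  then have ex: "\<exists>i. i \<in> I \<and> f i x = (MIN j\<in>I. f j x)" by auto
  define i0 where "i0 = (LEAST i. i \<in> I \<and> f i x = (MIN j\<in>I. f j x))"
  have i0: "i0 \<in> I" "f i0 x = (MIN j\<in>I. f j x)" using LeastI_ex[OF ex] by (auto simp: i0_def)
  have least: "i0 \<le> i" if "i \<in> I" "f i x = (MIN j\<in>I. f j x)" for i
    unfolding i0_def by (rule Least_le) (use that in auto)
  have "x \<in> A i \<longleftrightarrow> i = i0" if "i \<in> I" for i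
  proof
    assume "x \<in> A i"
    then have i: "f i x = (MIN j\<in>I. f j x)" "\<not> i0 < i" using i0 by (auto simp: A_def)
    then show "i = i0" using least[OF that i(1)] by simp
  next
    assume "i = i0"
    then show "x \<in> A i" using i0(2) least by (auto simp: A_def not_less[symmetric])
  qed
  then have "(\<Sum>i\<in>I. indicator (A i) x) = (\<Sum>i\<in>I. if i = i0 then 1 else (0::ennreal))"
    by (intro sum.cong) (auto simp: indicator_def)
  then show "(\<Sum>i\<in>I. indicator (A i) x) = (1::ennreal)" using I i0(1) by simp
qed

lemma unit_sum_familyD:
  assumes "unit_sum_family m \<nu>" "k \<in> {1..m}"
  shows "sets (\<nu> k) = sets borel" "finite_measure (\<nu> k)"
proof -
  show s: "sets (\<nu> k) = sets borel" using assms by (auto simp: unit_sum_family_def borel_measure_on_def)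
  have "emeasure (\<nu> k) UNIV \<le> (\<Sum>k=1..m. emeasure (\<nu> k) UNIV)"
    using assms(2) by (intro member_le_sum) auto
  then have "emeasure (\<nu> k) UNIV \<le> 1" using assms(1) by (simp add: unit_sum_family_def)
  then show "finite_measure (\<nu> k)"
    using sets_eq_imp_space_eq[OF s] by (intro finite_measureI) (auto simp: top_unique)
qed

text \<open>By Tychonoff the sequences in E indexed by all naturals form a compact space, on which
  Fatou's lemma makes the integral lower semicontinuous. Only the coordinates 1 to m matter, so any
  family on {1..m} can be continued by a fixed point of E.\<close>

lemma min_kernel_integral_attained:
  fixes E :: "(real^'n) set"
  assumes "compact E" "E \<noteq> {}" and \<alpha>: "\<alpha> < real CARD('n)" and [measurable_cong]: "sets \<mu> = sets borel" and "1 \<le> m"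
  shows "\<exists>c \<in> {1..m} \<rightarrow> E. \<forall>c' \<in> {1..m} \<rightarrow> E. min_kernel_integral \<alpha> \<mu> m c \<le> min_kernel_integral \<alpha> \<mu> m c'"
proof -
  have comp: "compact (PiE UNIV (\<lambda>_. E) :: (nat \<Rightarrow> real^'n) set)"
    using compactin_PiE[of "\<lambda>_. euclidean" "UNIV :: nat set" "\<lambda>_. E"] assms(1)
    by (simp add: euclidean_product_topology)
  have lsc: "seq_lsc (min_kernel_integral \<alpha> \<mu> m)"
    unfolding min_kernel_integral_def
  proof (rule seq_lsc_nn_integral)
    fix X :: "nat \<Rightarrow> nat \<Rightarrow> real^'n" and c t assume X: "X \<longlonglongrightarrow> c"
    have "(\<lambda>n. X n k) \<longlonglongrightarrow> c k" for k
      by (rule continuous_on_tendsto_compose[OF continuous_on_product_coordinates X]) simp_all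
    then show "(\<lambda>n. MIN k\<in>{1..m}. riesz_power CARD('n) \<alpha> (norm (t - X n k)))
      \<longlonglongrightarrow> (MIN k\<in>{1..m}. riesz_power CARD('n) \<alpha> (norm (t - c k)))"
      using \<open>1 \<le> m\<close>
      by (intro tendsto_Min) (auto intro: isCont_tendsto_compose[OF isCont_riesz_power[OF \<alpha>] tendsto_diff[OF tendsto_const]])
  qed measurable
  have ne: "(PiE UNIV (\<lambda>_. E) :: (nat \<Rightarrow> real^'n) set) \<noteq> {}" using assms(2) by (simp add: PiE_eq_empty_iff)
  obtain c where c: "c \<in> PiE UNIV (\<lambda>_. E)"
    "\<And>c'. c' \<in> PiE UNIV (\<lambda>_. E) \<Longrightarrow> min_kernel_integral \<alpha> \<mu> m c \<le> min_kernel_integral \<alpha> \<mu> m c'"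
    using seq_lsc_attains_inf[OF lsc comp ne] by blast
  obtain e where "e \<in> E" using assms(2) by blast
  show ?thesis
  proof (intro bexI ballI)
    show "c \<in> {1..m} \<rightarrow> E" using c(1) by auto
    fix c' assume c': "c' \<in> {1..m} \<rightarrow> E"
    define c'' where "c'' = (\<lambda>k. if k \<in> {1..m} then c' k else e)"
    have "c'' \<in> PiE UNIV (\<lambda>_. E)" using c' \<open>e \<in> E\<close> by (auto simp: c''_def)
    then have "min_kernel_integral \<alpha> \<mu> m c \<le> min_kernel_integral \<alpha> \<mu> m c''" by (rule c(2))
    also have "\<dots> = min_kernel_integral \<alpha> \<mu> m c'"
    proof -
      have "(\<lambda>k. riesz_power CARD('n) \<alpha> (norm (x - c'' k))) ` {1..m}
        = (\<lambda>k. riesz_power CARD('n) \<alpha> (norm (x - c' k))) ` {1..m}" for x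
        by (rule image_cong) (simp_all add: c''_def)
      then show ?thesis by (simp only: min_kernel_integral_def)
    qed
    finally show "min_kernel_integral \<alpha> \<mu> m c \<le> min_kernel_integral \<alpha> \<mu> m c'" .
  qed
qed

section \<open>The reverse triangle inequality\<close>

context riesz_kernel
begin

lemma conv_p_const: "conv (p j) (\<lambda>_. C) x = C"
  by (simp add: conv_const_right nn_integral_p)

text \<open>Minima of excessive functions are excessive, constants included. The cut at L makes u
  bounded, as the charges require.\<close>

lemma conv_p_truncated_kernel_le:
  fixes c :: "'i \<Rightarrow> real^'n" and L :: real
  assumes "finite I" "I \<noteq> {}"
  defines "u \<equiv> \<lambda>x. min (MIN k\<in>I. riesz_power CARD('n) \<alpha> (norm (x - c k))) (ennreal L)"
  shows "conv (p j) u x \<le> u x"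
proof -
  have k: "conv (p j) u x \<le> riesz_power CARD('n) \<alpha> (norm (x - c i))" if "i \<in> I" for i
  proof -
    have "conv (p j) u x \<le> conv (p j) (\<lambda>x. riesz_power CARD('n) \<alpha> (norm (x - c i))) x"
      unfolding u_def using that assms(1)
      by (intro conv_mono order_refl min.coboundedI1 Min_le) auto
    also have "\<dots> = conv (p j) (\<lambda>x. riesz_power CARD('n) \<alpha> (norm x)) (x - c i)"
      by (simp add: conv_def diff_diff_eq add.commute)
    also have "\<dots> \<le> riesz_power CARD('n) \<alpha> (norm (x - c i))"
      by (subst (2) decomp[of _ j]) simp
    finally show ?thesis .
  qed
  have L: "conv (p j) u x \<le> ennreal L"
  proof -
    have "conv (p j) u x \<le> conv (p j) (\<lambda>_. ennreal L) x"
      unfolding u_def by (intro conv_mono order_refl) simp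
    then show ?thesis by (simp only: conv_p_const)
  qed
  have "conv (p j) u x \<le> min (MIN k\<in>I. riesz_power CARD('n) \<alpha> (norm (x - c k))) (ennreal L)"
    using L k assms(1,2) by (auto intro!: min.boundedI)
  then show ?thesis by (simp only: u_def)
qed

lemma equilibrium_potential_le:
  fixes E :: "(real^'n) set"
  assumes E: "compact E" and eq: "equilibrium_measure \<alpha> E \<mu>" and W: "min_riesz_energy \<alpha> E < \<infinity>"
    and S: "S \<in> borel_measurable borel" "seq_lsc S" "\<And>j x. conv (p j) S x \<le> S x"
      "\<And>x. x \<in> E \<Longrightarrow> min_riesz_energy \<alpha> E \<le> S x"
  shows "riesz_potential \<alpha> \<mu> x \<le> S x"
proof -
  note \<mu> = equilibrium_measureD[OF eq]
  have EB: "E \<in> sets borel" using E by (simp add: compact_imp_closed)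
  define w where "w = enn2real (min_riesz_energy \<alpha> E)"
  have w: "min_riesz_energy \<alpha> E = ennreal w" using W by (simp add: w_def less_top)
  have "AE t in \<mu>. t \<in> E"
    using \<mu>(3,4) EB by (intro AE_I[where N = "- E"]) auto
  then have "pot \<mu> x \<le> S x"
    by (rule maximum_principle[OF \<mu>(2,3) E])
      (use equilibrium_potential_le_AE[OF EB eq W] S in \<open>simp_all add: pot_eq w\<close>)
  then show ?thesis by (simp add: pot_eq)
qed

lemma polarization_inequality:
  fixes E :: "(real^'n) set"
  assumes E: "compact E" and eq: "equilibrium_measure \<alpha> E \<mu>" and W: "min_riesz_energy \<alpha> E < \<infinity>"
    and m1: "1 \<le> m'" and \<nu>: "unit_sum_family m' \<nu>" and c: "c \<in> {1..m'} \<rightarrow> E"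
  shows "min_kernel_integral \<alpha> \<mu> m' c + (INF x\<in>E. \<Sum>k=1..m'. riesz_potential \<alpha> (\<nu> k) x)
    \<le> (\<Sum>k=1..m'. riesz_potential \<alpha> (\<nu> k) (c k)) + min_riesz_energy \<alpha> E"
proof -
  note \<mu> = equilibrium_measureD[OF eq]
  interpret \<mu>: prob_space \<mu> by (rule \<mu>(1))
  note \<nu>sf = unit_sum_familyD[OF \<nu>]
  note [measurable_cong] = \<mu>(3)
  define W where "W = min_riesz_energy \<alpha> E"
  define I where "I = (INF x\<in>E. \<Sum>k=1..m'. riesz_potential \<alpha> (\<nu> k) x)"
  have pm[measurable]: "k \<in> {1..m'} \<Longrightarrow> riesz_potential \<alpha> (\<nu> k) \<in> borel_measurable borel" for k
    by (intro borel_measurable_riesz_potential \<nu>sf)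
  \<comment> \<open>Frostman's bound on the whole space: the maximum principle with the constant W
    as S.\<close>
  have U_le: "riesz_potential \<alpha> \<mu> x \<le> W" for x
    unfolding W_def
    by (rule equilibrium_potential_le[OF E eq \<open>min_riesz_energy \<alpha> E < \<infinity>\<close>]) (auto simp: seq_lsc_const conv_p_const)
  have AE_E: "AE t in \<mu>. t \<in> E"
    using \<mu>(3,4) E by (intro AE_I[where N = "- E"]) (auto simp: compact_imp_closed)
  \<comment> \<open>Integrating over \<mu> and exchanging the order of integration gives I \<le> W,
    so that e below is a genuine difference.\<close>
  have "I = (\<integral>\<^sup>+ x. I \<partial>\<mu>)" by (simp add: \<mu>.emeasure_space_1)
  also have "\<dots> \<le> (\<integral>\<^sup>+ x. (\<Sum>k=1..m'. riesz_potential \<alpha> (\<nu> k) x) \<partial>\<mu>)"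
    by (rule nn_integral_mono_AE) (use AE_E in eventually_elim, auto simp: I_def intro: INF_lower)
  also have "\<dots> = (\<Sum>k=1..m'. \<integral>\<^sup>+ x. riesz_potential \<alpha> (\<nu> k) x \<partial>\<mu>)"
    by (rule nn_integral_sum) measurable
  also have "\<dots> = (\<Sum>k=1..m'. \<integral>\<^sup>+ x. riesz_potential \<alpha> \<mu> x \<partial>\<nu> k)"
    by (intro sum.cong refl riesz_mutual_energy_commute \<nu>sf \<mu>)
  also have "\<dots> \<le> (\<Sum>k=1..m'. \<integral>\<^sup>+ x. W \<partial>\<nu> k)"
    by (intro sum_mono nn_integral_mono U_le)
  also have "\<dots> = W"
  proof -
    have "(\<Sum>k=1..m'. \<integral>\<^sup>+ x. W \<partial>\<nu> k) = (\<Sum>k=1..m'. W * emeasure (\<nu> k) UNIV)"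
      using sets_eq_imp_space_eq[OF \<nu>sf(1)] by (intro sum.cong) auto
    also have "\<dots> = W * (\<Sum>k=1..m'. emeasure (\<nu> k) UNIV)" by (rule sum_distrib_left[symmetric])
    finally show ?thesis using \<nu> by (simp add: unit_sum_family_def)
  qed
  finally have "I \<le> W" .
  define e where "e = W - I"
  have We: "W = I + e" using \<open>I \<le> W\<close> by (simp add: e_def ennreal_ineq_diff_add[symmetric])
  have psum: "(\<Sum>k\<in>{1..m'}. pot (\<nu> k) x) = (\<Sum>k=1..m'. riesz_potential \<alpha> (\<nu> k) x)" for x
    by (simp add: pot_eq)
  \<comment> \<open>The maximum principle again, now with the total potential plus e as S; on E this
    is at least I + e = W.\<close>
  have dom: "pot \<mu> x \<le> (\<Sum>k\<in>{1..m'}. pot (\<nu> k) x) + e" for x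
    unfolding pot_eq[of \<mu>]
  proof (rule equilibrium_potential_le[OF E eq \<open>min_riesz_energy \<alpha> E < \<infinity>\<close>])
    show "(\<lambda>x. (\<Sum>k\<in>{1..m'}. pot (\<nu> k) x) + e) \<in> borel_measurable borel"
      unfolding psum by measurable
    show "seq_lsc (\<lambda>x. (\<Sum>k\<in>{1..m'}. pot (\<nu> k) x) + e)"
      by (intro seq_lsc_add seq_lsc_sum seq_lsc_pot seq_lsc_const \<nu>sf)
    have super: "conv (p j) (\<lambda>x. \<Sum>k\<in>J. pot (\<nu> k) x) x \<le> (\<Sum>k\<in>J. pot (\<nu> k) x)" if "J \<subseteq> {1..m'}" for J j x
    proof -
      have "finite J" using that finite_subset by blast
      then show ?thesis using that
      proof (induction J)
        case (insert i J)
        have [measurable]: "l \<in> insert i J \<Longrightarrow> pot (\<nu> l) \<in> borel_measurable borel" for l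
          using insert.prems \<nu>sf by (intro pot_measurable) auto
        have "conv (p j) (\<lambda>x. \<Sum>k\<in>insert i J. pot (\<nu> k) x) x
          = conv (p j) (pot (\<nu> i)) x + conv (p j) (\<lambda>x. \<Sum>k\<in>J. pot (\<nu> k) x) x"
          using insert by (simp add: conv_add_right)
        also have "\<dots> \<le> pot (\<nu> i) x + (\<Sum>k\<in>J. pot (\<nu> k) x)"
          using insert \<nu>sf by (intro add_mono conv_pot_le insert.IH) auto
        finally show ?case using insert by simp
      qed (simp add: conv_p_const)
    qed
    show "conv (p j) (\<lambda>x. (\<Sum>k\<in>{1..m'}. pot (\<nu> k) x) + e) x \<le> (\<Sum>k\<in>{1..m'}. pot (\<nu> k) x) + e" for j x
    proof -
      have "conv (p j) (\<lambda>x. (\<Sum>k\<in>{1..m'}. pot (\<nu> k) x) + e) x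
        = conv (p j) (\<lambda>x. \<Sum>k\<in>{1..m'}. pot (\<nu> k) x) x + conv (p j) (\<lambda>_. e) x"
        by (rule conv_add_right) (use \<nu>sf in \<open>auto intro!: borel_measurable_sum pot_measurable\<close>)
      then show ?thesis by (simp only: conv_p_const add_right_mono[OF super[OF order_refl]])
    qed
    show "min_riesz_energy \<alpha> E \<le> (\<Sum>k\<in>{1..m'}. pot (\<nu> k) x) + e" if "x \<in> E" for x
      unfolding W_def[symmetric] We psum I_def using that by (intro add_right_mono INF_lower)
  qed
  \<comment> \<open>The cut at L yields the bounded continuous functions that
    \<open>nn_integral_superharmonic_le\<close> asks for; monotone convergence removes it at the
    end.\<close>
  define u where "u = (\<lambda>L::nat. \<lambda>x. min (MIN k\<in>{1..m'}. riesz_power CARD('n) \<alpha> (norm (x - c k))) (ennreal (real L)))"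
  have [measurable]: "u L \<in> borel_measurable borel" for L
    unfolding u_def using m1 by measurable
  have ne: "finite {1..m'}" "{1..m'} \<noteq> {}" using m1 by auto
  have u_k: "u L x \<le> riesz_power CARD('n) \<alpha> (norm (x - c k))" if "k \<in> {1..m'}" for L x k
    unfolding u_def using that by (intro min.coboundedI1 Min_le) auto
  have cont: "isCont (u L) x" for L x
    unfolding u_def isCont_def
  proof (intro tendsto_min tendsto_const tendsto_Min ne)
    fix i
    have "isCont (\<lambda>x. riesz_power CARD('n) \<alpha> (norm (x - c i))) x"
      by (rule isCont_o2[OF _ isCont_riesz_power[OF \<alpha>_less]]) simp
    then show "((\<lambda>x. riesz_power CARD('n) \<alpha> (norm (x - c i))) \<longlongrightarrow> riesz_power CARD('n) \<alpha> (norm (x - c i))) (at x)"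
      by (simp add: isCont_def)
  qed
  have step: "(\<integral>\<^sup>+ x. u L x \<partial>\<mu>) \<le> (\<Sum>k=1..m'. riesz_potential \<alpha> (\<nu> k) (c k)) + e" for L
  proof -
    have "(\<integral>\<^sup>+ x. u L x \<partial>\<mu>) \<le> (\<Sum>k\<in>{1..m'}. \<integral>\<^sup>+ x. u L x \<partial>\<nu> k) + e"
    proof (rule nn_integral_superharmonic_le[OF \<mu>(2,3) ne(1) \<nu>sf(2) \<nu>sf(1) dom])
      show "u L x \<le> ennreal (real L)" for x by (simp add: u_def)
      show "conv (p j) (u L) x \<le> u L x" for j x
        unfolding u_def by (rule conv_p_truncated_kernel_le[OF ne])
      show "u L x \<le> riesz_power CARD('n) \<alpha> (norm (x - c 1))" for x using m1 by (intro u_k) auto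
    qed (use cont in simp_all)
    \<comment> \<open>On the k-th measure u is estimated by the kernel centred at c k alone.\<close>
    also have "\<dots> \<le> (\<Sum>k=1..m'. riesz_potential \<alpha> (\<nu> k) (c k)) + e"
    proof (intro add_right_mono sum_mono)
      fix k assume "k \<in> {1..m'}"
      then show "(\<integral>\<^sup>+ x. u L x \<partial>\<nu> k) \<le> riesz_potential \<alpha> (\<nu> k) (c k)"
        unfolding riesz_potential_def using u_k by (intro nn_integral_mono) (simp add: norm_minus_commute)
    qed
    finally show ?thesis .
  qed
  have "min_kernel_integral \<alpha> \<mu> m' c = (\<integral>\<^sup>+ x. (SUP L. u L x) \<partial>\<mu>)"
    unfolding min_kernel_integral_def
  proof (rule nn_integral_cong)
    fix x
    have top: "(SUP L. ennreal (real L)) = top"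
      using ennreal_SUP_of_nat_eq_top by (simp add: ennreal_of_nat_eq_real_of_nat)
    show "(MIN k\<in>{1..m'}. riesz_power CARD('n) \<alpha> (norm (x - c k))) = (SUP L. u L x)"
      unfolding u_def inf_min[symmetric] inf_SUP[symmetric] top by simp
  qed
  also have "\<dots> = (SUP L. \<integral>\<^sup>+ x. u L x \<partial>\<mu>)"
  proof (rule nn_integral_monotone_convergence_SUP)
    show "incseq u" unfolding incseq_def le_fun_def u_def
      by (intro allI impI min.mono order_refl ennreal_leI) simp
  qed measurable
  also have "\<dots> \<le> (\<Sum>k=1..m'. riesz_potential \<alpha> (\<nu> k) (c k)) + e"
    by (intro SUP_least step)
  finally have "min_kernel_integral \<alpha> \<mu> m' c + I \<le> (\<Sum>k=1..m'. riesz_potential \<alpha> (\<nu> k) (c k)) + e + I"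
    by (rule add_right_mono)
  then show ?thesis
    unfolding I_def[symmetric] W_def[symmetric] We by (simp add: add_ac)
qed

end

text \<open>On a one-point set a unit measure is a point mass and has infinite energy. Besides E
  being nonempty, this provides the two distinct points that the sharpness argument needs.\<close>

lemma exists_other_point:
  fixes E :: "(real^'n) set"
  assumes "compact E" and eq: "equilibrium_measure \<alpha> E \<mu>" and W: "min_riesz_energy \<alpha> E < \<infinity>"
  shows "\<exists>y\<in>E. y \<noteq> a"
proof (rule ccontr)
  note \<mu> = equilibrium_measureD[OF eq]
  interpret prob_space \<mu> by (rule \<mu>(1))
  assume single: "\<not> (\<exists>y\<in>E. y \<noteq> a)"
  have "AE t in \<mu>. t \<in> E"
    using \<mu>(3,4) \<open>compact E\<close> by (intro AE_I[where N = "- E"]) (auto simp: compact_imp_closed)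
  then have a: "AE t in \<mu>. t = a" by eventually_elim (use single in auto)
  have "riesz_potential \<alpha> \<mu> a = (\<integral>\<^sup>+ t. \<infinity> \<partial>\<mu>)"
    unfolding riesz_potential_def
    by (rule nn_integral_cong_AE) (use a in eventually_elim, simp add: riesz_power_def)
  then have Ua: "riesz_potential \<alpha> \<mu> a = \<infinity>" by (simp add: emeasure_space_1)
  have "riesz_energy \<alpha> \<mu> = (\<integral>\<^sup>+ t. \<infinity> \<partial>\<mu>)"
    unfolding riesz_energy_def by (rule nn_integral_cong_AE) (use a in eventually_elim, simp add: Ua)
  then show False using \<mu>(5) W by (simp add: emeasure_space_1)
qed

text \<open>The uniform measure on the points of \<open>exists_large_discrete_potential\<close>,
  where the factor \<open>Suc n\<close> counts the points. For empty K any point mass on E will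
  do.\<close>

lemma exists_large_potential:
  fixes E K :: "(real^'n) set"
  assumes "compact K" "K \<subseteq> E" "E \<noteq> {}" "E \<in> sets borel" and \<alpha>: "\<alpha> < real CARD('n)"
    and inf: "\<And>\<tau>. borel_measure_on K \<tau> \<Longrightarrow> prob_space \<tau> \<Longrightarrow> riesz_energy \<alpha> \<tau> = \<infinity>" and "0 \<le> B"
  shows "\<exists>\<tau>. prob_space \<tau> \<and> borel_measure_on E \<tau> \<and> (\<forall>y\<in>K. ennreal B \<le> riesz_potential \<alpha> \<tau> y)"
proof (cases "K = {}")
  case True
  obtain a where "a \<in> E" using assms(3) by blast
  then have "prob_space (return borel a) \<and> borel_measure_on E (return borel a)"
    using assms(4) by (auto simp: borel_measure_on_def prob_space_return)
  then show ?thesis using True by blast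
next
  case False
  obtain n and x :: "nat \<Rightarrow> real^'n" where x: "\<And>i. x i \<in> K"
    "\<And>y. y \<in> K \<Longrightarrow> ennreal (B * real (Suc n)) \<le> (\<Sum>i<Suc n. riesz_power CARD('n) \<alpha> (norm (y - x i)))"
    using exists_large_discrete_potential[OF assms(1) False \<alpha> inf \<open>0 \<le> B\<close>] by blast
  define \<tau> where "\<tau> = distr (measure_pmf (pmf_of_set {..n})) borel x"
  have "prob_space \<tau>" unfolding \<tau>_def by (rule measure_pmf.prob_space_distr) simp
  moreover have "borel_measure_on E \<tau>"
  proof -
    have "x -` (- E) = {}" using x(1) assms(2) by auto
    then show ?thesis using assms(4) by (simp add: borel_measure_on_def \<tau>_def emeasure_distr)
  qed
  moreover have "ennreal B \<le> riesz_potential \<alpha> \<tau> y" if "y \<in> K" for y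
  proof -
    have "ennreal B = ennreal (B * real (Suc n)) / of_nat (Suc n)"
      using \<open>0 \<le> B\<close> by (simp add: ennreal_of_nat_eq_real_of_nat divide_ennreal del: of_nat_Suc)
    also have "\<dots> \<le> (\<Sum>i<Suc n. riesz_power CARD('n) \<alpha> (norm (y - x i))) / of_nat (Suc n)"
      by (intro divide_right_mono_ennreal x that)
    also have "\<dots> = riesz_potential \<alpha> \<tau> y"
      unfolding riesz_potential_def \<tau>_def by (rule nn_integral_empirical[symmetric]) measurable
    finally show ?thesis .
  qed
  ultimately show ?thesis by blast
qed

text \<open>The equilibrium potential may be smaller than the energy at exceptional points of \<open>E\<close>; these
  form a set of zero capacity and are lifted by a small multiple of a measure with large potential.\<close>

lemma nearly_equilibrium_measure:
  fixes E :: "(real^'n) set"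
  assumes E: "compact E" and \<alpha>: "\<alpha> < real CARD('n)" and eq: "equilibrium_measure \<alpha> E \<mu>"
    and W: "min_riesz_energy \<alpha> E < \<infinity>" and "0 < \<epsilon>" "0 \<le> D"
  shows "\<exists>\<rho>. prob_space \<rho> \<and> borel_measure_on E \<rho> \<and>
    (\<forall>x\<in>E. min_riesz_energy \<alpha> E \<le> riesz_potential \<alpha> \<rho> x + ennreal (2 * \<epsilon>)) \<and>
    (\<forall>u\<in>borel_measurable borel. (\<forall>x. u x \<le> ennreal D) \<longrightarrow> (\<integral>\<^sup>+ x. u x \<partial>\<rho>) \<le> (\<integral>\<^sup>+ x. u x \<partial>\<mu>) + ennreal \<epsilon>)"
proof -
  note \<mu> = equilibrium_measureD[OF eq]
  interpret \<mu>: prob_space \<mu> by (rule \<mu>(1))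
  have EB[measurable]: "E \<in> sets borel" using E by (simp add: compact_imp_closed)
  obtain y0 where y0: "y0 \<in> E" using exists_other_point[OF E eq W, of 0] by blast
  define w where "w = enn2real (min_riesz_energy \<alpha> E)"
  have w: "min_riesz_energy \<alpha> E = ennreal w" "0 \<le> w" using W by (simp_all add: w_def less_top)
  \<comment> \<open>The exceptional points, where the potential of \<mu> is at least \<epsilon>
    below the energy. K is closed by lower semicontinuity.\<close>
  define K where "K = E \<inter> {x. riesz_potential \<alpha> \<mu> x + ennreal \<epsilon> \<le> ennreal w}"
  have lsc: "seq_lsc (riesz_potential \<alpha> \<mu>)"
  proof -
    have "seq_lsc (\<lambda>x. \<integral>\<^sup>+ t. riesz_power CARD('n) \<alpha> (norm (x - t)) \<partial>\<mu>)"
    proof (rule seq_lsc_nn_integral)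
      show "(\<lambda>t. riesz_power CARD('n) \<alpha> (norm (x - t))) \<in> borel_measurable \<mu>" for x
        unfolding measurable_cong_sets[OF \<mu>(3) refl] by measurable
      show "(\<lambda>n. riesz_power CARD('n) \<alpha> (norm (X n - t))) \<longlonglongrightarrow> riesz_power CARD('n) \<alpha> (norm (x - t))"
        if "X \<longlonglongrightarrow> x" for t X and x :: "real^'n"
        by (rule isCont_tendsto_compose[OF isCont_riesz_power[OF \<alpha>] tendsto_diff[OF that tendsto_const]])
    qed
    then show ?thesis by (simp add: riesz_potential_def[abs_def])
  qed
  have "compact K"
    unfolding K_def by (intro compact_Int_closed E seq_lsc_le_closed seq_lsc_add lsc seq_lsc_const)
  have KE: "K \<subseteq> E" by (simp add: K_def)
  have KB[measurable]: "K \<in> sets borel" using \<open>compact K\<close> by (simp add: compact_imp_closed)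
  \<comment> \<open>K has zero capacity: a unit measure on K of finite energy would have mutual
    energy with \<mu> at most w - \<epsilon>, against the first variation inequality.\<close>
  have cap0: "riesz_energy \<alpha> \<tau> = \<infinity>" if \<tau>: "borel_measure_on K \<tau>" "prob_space \<tau>" for \<tau>
  proof (rule ccontr)
    assume fin: "riesz_energy \<alpha> \<tau> \<noteq> \<infinity>"
    interpret \<tau>: prob_space \<tau> by fact
    have s: "sets \<tau> = sets borel" using \<tau> by (simp add: borel_measure_on_def)
    note [measurable_cong] = s
    have [measurable]: "riesz_potential \<alpha> \<mu> \<in> borel_measurable borel"
      by (rule borel_measurable_riesz_potential[OF \<mu>(2,3)])
    have AEK: "AE t in \<tau>. t \<in> K"
      using \<tau>(1) KB by (intro AE_I[where N = "- K"]) (auto simp: borel_measure_on_def)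
    have "emeasure \<tau> (- E) \<le> emeasure \<tau> (- K)" using KE s KB by (intro emeasure_mono) auto
    then have "borel_measure_on E \<tau>" using \<tau>(1) by (simp add: borel_measure_on_def)
    then have le: "ennreal w \<le> (\<integral>\<^sup>+ x. riesz_potential \<alpha> \<mu> x \<partial>\<tau>)"
      using min_energy_le_mutual_energy[OF EB eq W _ \<tau>(2)] fin by (simp add: w(1) less_top)
    have "(\<integral>\<^sup>+ x. riesz_potential \<alpha> \<mu> x \<partial>\<tau>) + ennreal \<epsilon> = (\<integral>\<^sup>+ x. riesz_potential \<alpha> \<mu> x + ennreal \<epsilon> \<partial>\<tau>)"
      by (subst nn_integral_add) (auto simp: \<tau>.emeasure_space_1)
    also have "\<dots> \<le> (\<integral>\<^sup>+ x. ennreal w \<partial>\<tau>)"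
      by (rule nn_integral_mono_AE) (use AEK in eventually_elim, simp add: K_def)
    also have "\<dots> = ennreal w" by (simp add: \<tau>.emeasure_space_1)
    finally have "ennreal w + ennreal \<epsilon> \<le> ennreal w" using le by (meson add_right_mono order_trans)
    then show False using w(2) \<open>0 < \<epsilon>\<close> by (simp add: ennreal_plus[symmetric] del: ennreal_plus)
  qed
  \<comment> \<open>Small enough that the loss \<eta> w caused by the factor 1 - \<eta> off K and
    the gain \<eta> D in the integral of u both stay within \<epsilon>. On K the share \<eta> of a
    potential w / \<eta> already reaches w.\<close>
  define \<eta> where "\<eta> = \<epsilon> / (w + \<epsilon> + D)"
  have pos: "0 < w + \<epsilon> + D" using w(2) \<open>0 < \<epsilon>\<close> \<open>0 \<le> D\<close> by simp
  have \<eta>: "0 < \<eta>" "\<eta> \<le> 1" "\<eta> * w \<le> \<epsilon>" "\<eta> * D \<le> \<epsilon>"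
    using w(2) \<open>0 < \<epsilon>\<close> \<open>0 \<le> D\<close> pos by (auto simp: \<eta>_def divide_le_eq mult_left_mono)
  obtain \<tau> where \<tau>: "prob_space \<tau>" "borel_measure_on E \<tau>" "\<And>y. y \<in> K \<Longrightarrow> ennreal (w / \<eta>) \<le> riesz_potential \<alpha> \<tau> y"
    using exists_large_potential[OF \<open>compact K\<close> KE _ EB \<alpha> cap0, of "w / \<eta>"] y0 w(2) \<eta>(1) by fastforce
  interpret \<tau>: prob_space \<tau> by (rule \<tau>(1))
  have \<tau>s: "sets \<tau> = sets borel" using \<tau>(2) by (simp add: borel_measure_on_def)
  define \<rho> where "\<rho> = mixture \<eta> \<mu> \<tau>"
  note mix = mixture[OF \<mu>(1,3) \<tau>(1) \<tau>s less_imp_le[OF \<eta>(1)] \<eta>(2), folded \<rho>_def]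
  have pot: "riesz_potential \<alpha> \<rho> x = ennreal (1 - \<eta>) * riesz_potential \<alpha> \<mu> x + ennreal \<eta> * riesz_potential \<alpha> \<tau> x" for x
    unfolding riesz_potential_def by (rule mix(3)) measurable
  show ?thesis
  proof (intro exI[of _ \<rho>] conjI ballI impI)
    show "prob_space \<rho>" by (rule mix(1))
    show "borel_measure_on E \<rho>"
      unfolding \<rho>_def using eq \<eta>(1)
      by (intro borel_measure_on_mixture \<mu>(1) \<tau>(1,2) \<eta>(2) EB) (simp_all add: equilibrium_measure_def)
    show "min_riesz_energy \<alpha> E \<le> riesz_potential \<alpha> \<rho> x + ennreal (2 * \<epsilon>)" if "x \<in> E" for x
    proof (cases "x \<in> K")
      case True
      have "ennreal w = ennreal \<eta> * ennreal (w / \<eta>)" using \<eta>(1) w(2) by (simp add: ennreal_mult[symmetric])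
      also have "\<dots> \<le> ennreal \<eta> * riesz_potential \<alpha> \<tau> x" by (intro mult_left_mono \<tau>(3) True) simp
      also have "\<dots> \<le> riesz_potential \<alpha> \<rho> x" unfolding pot by simp
      finally show ?thesis unfolding w(1) by (rule add_increasing2[OF zero_le])
    next
      case False
      then have gt: "ennreal w \<le> riesz_potential \<alpha> \<mu> x + ennreal \<epsilon>" using that by (simp add: K_def)
      have "ennreal w = ennreal (1 - \<eta>) * ennreal w + ennreal (\<eta> * w)"
      proof -
        have "0 \<le> (1 - \<eta>) * w" "0 \<le> \<eta> * w" using \<eta> w(2) by auto
        then have "ennreal ((1 - \<eta>) * w) + ennreal (\<eta> * w) = ennreal w"
          by (subst ennreal_plus[symmetric]) (auto simp: algebra_simps)
        then show ?thesis using \<eta> w(2) by (simp add: ennreal_mult[symmetric])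
      qed
      also have "\<dots> \<le> ennreal (1 - \<eta>) * (riesz_potential \<alpha> \<mu> x + ennreal \<epsilon>) + ennreal \<epsilon>"
        using \<eta>(3) by (intro add_mono mult_left_mono gt ennreal_leI) auto
      also have "\<dots> \<le> (ennreal (1 - \<eta>) * riesz_potential \<alpha> \<mu> x + ennreal \<epsilon>) + ennreal \<epsilon>"
      proof (intro add_right_mono)
        have "ennreal (1 - \<eta>) * ennreal \<epsilon> \<le> 1 * ennreal \<epsilon>"
          using \<eta>(1) by (intro mult_right_mono) (auto simp: ennreal_le_1)
        then show "ennreal (1 - \<eta>) * (riesz_potential \<alpha> \<mu> x + ennreal \<epsilon>) \<le> ennreal (1 - \<eta>) * riesz_potential \<alpha> \<mu> x + ennreal \<epsilon>"
          by (simp add: distrib_left add_left_mono)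
      qed
      also have "\<dots> \<le> riesz_potential \<alpha> \<rho> x + ennreal (2 * \<epsilon>)"
        unfolding pot using \<open>0 < \<epsilon>\<close> by (simp add: ennreal_plus[symmetric] add.assoc add_left_mono del: ennreal_plus)
      finally show ?thesis by (simp only: w(1))
    qed
    fix u :: "real^'n \<Rightarrow> ennreal" assume u: "u \<in> borel_measurable borel" "\<forall>x. u x \<le> ennreal D"
    have "(\<integral>\<^sup>+ x. u x \<partial>\<rho>) = ennreal (1 - \<eta>) * (\<integral>\<^sup>+ x. u x \<partial>\<mu>) + ennreal \<eta> * (\<integral>\<^sup>+ x. u x \<partial>\<tau>)"
      by (rule mix(3)[OF u(1)])
    also have "\<dots> \<le> 1 * (\<integral>\<^sup>+ x. u x \<partial>\<mu>) + ennreal \<eta> * (\<integral>\<^sup>+ x. ennreal D \<partial>\<tau>)"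
      using \<eta>(1) u(2) by (intro add_mono mult_right_mono mult_left_mono nn_integral_mono) (auto simp: ennreal_le_1)
    also have "\<dots> \<le> (\<integral>\<^sup>+ x. u x \<partial>\<mu>) + ennreal \<epsilon>"
      using \<eta> \<open>0 \<le> D\<close> by (auto simp: \<tau>.emeasure_space_1 ennreal_mult[symmetric] intro!: add_left_mono ennreal_leI)
    finally show "(\<integral>\<^sup>+ x. u x \<partial>\<rho>) \<le> (\<integral>\<^sup>+ x. u x \<partial>\<mu>) + ennreal \<epsilon>" .
  qed
qed

section \<open>Sharpness\<close>

text \<open>The condition \<open>c 1 \<noteq> c 2\<close> keeps the minimum u of the kernels
  bounded, so that passing from \<mu> to the nearby measure \<rho> raises its integral by at most
  \<epsilon>. The piece of \<rho> on the k-th cell has at c k a potential equal to the integral of u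
  over that cell, and these integrals add up to that of u over \<rho>.\<close>

lemma near_extremal_family:
  fixes E :: "(real^'n) set"
  assumes E: "compact E" and \<alpha>: "\<alpha> < real CARD('n)" and eq: "equilibrium_measure \<alpha> E \<mu>"
    and W: "min_riesz_energy \<alpha> E < \<infinity>" and "0 < \<epsilon>" and m: "2 \<le> m"
    and c: "c \<in> {1..m} \<rightarrow> E" "c 1 \<noteq> c 2"
  shows "\<exists>\<nu>. unit_sum_family m \<nu> \<and>
    min_riesz_energy \<alpha> E \<le> (INF x\<in>E. \<Sum>k=1..m. riesz_potential \<alpha> (\<nu> k) x) + ennreal (2 * \<epsilon>) \<and>
    (\<Sum>k=1..m. INF x\<in>E. riesz_potential \<alpha> (\<nu> k) x) \<le> min_kernel_integral \<alpha> \<mu> m c + ennreal \<epsilon>"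
proof -
  define f where "f = (\<lambda>k x. riesz_power CARD('n) \<alpha> (norm (x - c k)))"
  define u where "u = (\<lambda>x. MIN k\<in>{1..m}. f k x)"
  have ne: "finite {1..m}" "{1..m} \<noteq> {}" using m by auto
  have [measurable]: "f k \<in> borel_measurable borel" for k unfolding f_def by measurable
  have u_meas[measurable]: "u \<in> borel_measurable borel" unfolding u_def using ne by measurable
  \<comment> \<open>Every point is at least half the distance of c 1 and c 2 away from one of them;
    D is the kernel at that half distance.\<close>
  define D where "D = (norm (c 1 - c 2) / 2) powr (\<alpha> - real CARD('n))"
  have uD: "u x \<le> ennreal D" for x
  proof -
    have "norm (c 1 - c 2) / 2 \<le> norm (x - c 1) \<or> norm (c 1 - c 2) / 2 \<le> norm (x - c 2)"
      using norm_triangle_ineq4[of "x - c 2" "x - c 1"] by auto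
    then obtain k where k: "k \<in> {1..m}" "norm (c 1 - c 2) / 2 \<le> norm (x - c k)"
      using m by (auto simp: Ball_def intro: that[of 1] that[of 2])
    have "u x \<le> f k x" unfolding u_def using k(1) by (intro Min_le) auto
    also have "\<dots> \<le> riesz_power CARD('n) \<alpha> (norm (c 1 - c 2) / 2)"
      unfolding f_def using k(2) \<alpha> by (intro riesz_power_antimono) auto
    also have "\<dots> = ennreal D" using c(2) by (simp add: riesz_power_def D_def)
    finally show ?thesis .
  qed
  obtain \<rho> where \<rho>: "prob_space \<rho>" "borel_measure_on E \<rho>"
    "\<And>x. x \<in> E \<Longrightarrow> min_riesz_energy \<alpha> E \<le> riesz_potential \<alpha> \<rho> x + ennreal (2 * \<epsilon>)"
    "(\<integral>\<^sup>+ x. u x \<partial>\<rho>) \<le> (\<integral>\<^sup>+ x. u x \<partial>\<mu>) + ennreal \<epsilon>"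
    using nearly_equilibrium_measure[OF E \<alpha> eq W \<open>0 < \<epsilon>\<close>, of D] u_meas uD by (auto simp: D_def)
  interpret \<rho>: prob_space \<rho> by (rule \<rho>(1))
  have s[measurable_cong]: "sets \<rho> = sets borel" using \<rho>(2) by (simp add: borel_measure_on_def)
  have sp: "space \<rho> = UNIV" using sets_eq_imp_space_eq[OF s] by simp
  obtain A where A: "\<And>i. i \<in> {1..m} \<Longrightarrow> A i \<in> sets borel" "\<And>x. (\<Sum>i\<in>{1..m}. indicator (A i) x) = (1::ennreal)"
    "\<And>i x. i \<in> {1..m} \<Longrightarrow> x \<in> A i \<Longrightarrow> f i x = (MIN j\<in>{1..m}. f j x)"
    using measurable_argmin_partition[OF ne, of f] by auto
  note [measurable] = A(1)
  define \<nu> where "\<nu> = (\<lambda>k. density \<rho> (indicator (A k)))"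
  have int: "(\<integral>\<^sup>+ x. h x \<partial>\<nu> k) = (\<integral>\<^sup>+ x. indicator (A k) x * h x \<partial>\<rho>)"
    if "k \<in> {1..m}" and [measurable]: "h \<in> borel_measurable borel" for h k
    unfolding \<nu>_def using that(1) by (subst nn_integral_density) auto
  have sum_int: "(\<Sum>k\<in>{1..m}. \<integral>\<^sup>+ x. h x \<partial>\<nu> k) = (\<integral>\<^sup>+ x. h x \<partial>\<rho>)"
    if [measurable]: "h \<in> borel_measurable borel" for h
  proof -
    have "(\<Sum>k\<in>{1..m}. \<integral>\<^sup>+ x. h x \<partial>\<nu> k) = (\<Sum>k\<in>{1..m}. \<integral>\<^sup>+ x. indicator (A k) x * h x \<partial>\<rho>)"
      by (intro sum.cong refl int that)
    also have "\<dots> = (\<integral>\<^sup>+ x. (\<Sum>k\<in>{1..m}. indicator (A k) x * h x) \<partial>\<rho>)"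
      by (rule nn_integral_sum[symmetric]) measurable
    also have "\<dots> = (\<integral>\<^sup>+ x. h x \<partial>\<rho>)"
      by (simp only: sum_distrib_right[symmetric] A(2) mult_1_left)
    finally show ?thesis .
  qed
  have pot: "(\<Sum>k=1..m. riesz_potential \<alpha> (\<nu> k) x) = riesz_potential \<alpha> \<rho> x" for x
    unfolding riesz_potential_def by (rule sum_int) measurable
  have "unit_sum_family m \<nu>"
    unfolding unit_sum_family_def
  proof (intro conjI ballI exI)
    fix k assume k: "k \<in> {1..m}"
    show "compact E" by (rule E)
    have "emeasure (\<nu> k) (- E) \<le> emeasure \<rho> (- E)"
    proof -
      have "emeasure (\<nu> k) (- E) = (\<integral>\<^sup>+ x. indicator (A k) x * indicator (- E) x \<partial>\<rho>)"
        unfolding \<nu>_def using k E s by (intro emeasure_density) (auto simp: compact_imp_closed)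
      also have "\<dots> \<le> (\<integral>\<^sup>+ x. indicator (- E) x \<partial>\<rho>)"
        by (intro nn_integral_mono) (auto split: split_indicator)
      also have "\<dots> = emeasure \<rho> (- E)"
        using E s by (intro nn_integral_indicator) (auto simp: compact_imp_closed)
      finally show ?thesis .
    qed
    then show "borel_measure_on E (\<nu> k)"
      using \<rho>(2) by (simp add: borel_measure_on_def \<nu>_def)
  next
    have "(\<Sum>k=1..m. emeasure (\<nu> k) UNIV) = (\<Sum>k\<in>{1..m}. \<integral>\<^sup>+ x. 1 \<partial>\<nu> k)"
      by (simp add: \<nu>_def sp)
    also have "\<dots> = 1" by (subst sum_int) (auto simp: \<rho>.emeasure_space_1)
    finally show "(\<Sum>k=1..m. emeasure (\<nu> k) UNIV) = 1" .
  qed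
  moreover have "min_riesz_energy \<alpha> E \<le> (INF x\<in>E. \<Sum>k=1..m. riesz_potential \<alpha> (\<nu> k) x) + ennreal (2 * \<epsilon>)"
  proof -
    have "min_riesz_energy \<alpha> E - ennreal (2 * \<epsilon>) \<le> (INF x\<in>E. riesz_potential \<alpha> \<rho> x)"
      using \<rho>(3) by (intro INF_greatest) (auto simp: ennreal_minus_le_iff add.commute)
    then show ?thesis unfolding pot by (simp add: ennreal_minus_le_iff add.commute)
  qed
  moreover have "(\<Sum>k=1..m. INF x\<in>E. riesz_potential \<alpha> (\<nu> k) x) \<le> min_kernel_integral \<alpha> \<mu> m c + ennreal \<epsilon>"
  proof -
    have "(\<Sum>k=1..m. INF x\<in>E. riesz_potential \<alpha> (\<nu> k) x) \<le> (\<Sum>k\<in>{1..m}. \<integral>\<^sup>+ x. u x \<partial>\<nu> k)"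
    proof (rule sum_mono)
      fix k assume k: "k \<in> {1..m}"
      have "(INF x\<in>E. riesz_potential \<alpha> (\<nu> k) x) \<le> riesz_potential \<alpha> (\<nu> k) (c k)"
        using c(1) k by (intro INF_lower) auto
      also have "\<dots> = (\<integral>\<^sup>+ x. indicator (A k) x * f k x \<partial>\<rho>)"
        unfolding riesz_potential_def f_def
        by (subst int[OF k]) (auto simp: norm_minus_commute)
      also have "\<dots> = (\<integral>\<^sup>+ x. indicator (A k) x * u x \<partial>\<rho>)"
        using A(3)[OF k] by (intro nn_integral_cong) (auto simp: u_def split: split_indicator)
      finally show "(INF x\<in>E. riesz_potential \<alpha> (\<nu> k) x) \<le> (\<integral>\<^sup>+ x. u x \<partial>\<nu> k)"
        by (subst int[OF k u_meas])
    qed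
    also have "\<dots> = (\<integral>\<^sup>+ x. u x \<partial>\<rho>)" by (rule sum_int[OF u_meas])
    also have "\<dots> \<le> (\<integral>\<^sup>+ x. u x \<partial>\<mu>) + ennreal \<epsilon>" by (rule \<rho>(4))
    finally show ?thesis by (simp add: min_kernel_integral_def u_def f_def)
  qed
  ultimately show ?thesis by blast
qed

text \<open>If c 1 = c 2, moving c 2 to y keeps all the old kernels and adds one, so the minimum can
  only drop.\<close>

lemma min_kernel_integral_le_distinct:
  fixes E :: "(real^'n) set"
  assumes "2 \<le> m" and c: "c \<in> {1..m} \<rightarrow> E" and y: "y \<in> E" "y \<noteq> c 1"
  shows "\<exists>c' \<in> {1..m} \<rightarrow> E. c' 1 \<noteq> c' 2 \<and> min_kernel_integral \<alpha> \<mu> m c' \<le> min_kernel_integral \<alpha> \<mu> m c"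
proof (cases "c 1 = c 2")
  case True
  define c' where "c' = c(2 := y)"
  have "min_kernel_integral \<alpha> \<mu> m c' \<le> min_kernel_integral \<alpha> \<mu> m c"
    unfolding min_kernel_integral_def
  proof (intro nn_integral_mono)
    fix x
    have sub: "(\<lambda>k. riesz_power CARD('n) \<alpha> (norm (x - c k))) ` {1..m}
      \<subseteq> (\<lambda>k. riesz_power CARD('n) \<alpha> (norm (x - c' k))) ` {1..m}"
    proof safe
      fix k assume "k \<in> {1..m}"
      then show "riesz_power CARD('n) \<alpha> (norm (x - c k)) \<in> (\<lambda>k. riesz_power CARD('n) \<alpha> (norm (x - c' k))) ` {1..m}"
        using True \<open>2 \<le> m\<close> by (intro image_eqI[of _ _ "if k = 2 then 1 else k"]) (auto simp: c'_def)
    qed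
    show "(MIN k\<in>{1..m}. riesz_power CARD('n) \<alpha> (norm (x - c' k))) \<le> (MIN k\<in>{1..m}. riesz_power CARD('n) \<alpha> (norm (x - c k)))"
      using \<open>2 \<le> m\<close> by (intro Min_antimono sub) auto
  qed
  moreover have "c' \<in> {1..m} \<rightarrow> E" using c y by (auto simp: c'_def)
  moreover have "c' 1 \<noteq> c' 2" using y by (simp add: c'_def)
  ultimately show ?thesis by blast
qed (use c in auto)

text \<open>The kernel decreases with the distance, and no c k is farther from x than
  \<open>farthest_dist E x\<close>; boundedness of E makes this supremum an upper bound.\<close>

lemma farthest_kernel_integral_le:
  fixes E :: "(real^'n) set"
  assumes "compact E" and \<alpha>: "\<alpha> < real CARD('n)" and "1 \<le> m" and c: "c \<in> {1..m} \<rightarrow> E"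
  shows "(\<integral>\<^sup>+ x. riesz_power CARD('n) \<alpha> (farthest_dist E x) \<partial>\<mu>) \<le> min_kernel_integral \<alpha> \<mu> m c"
  unfolding min_kernel_integral_def
proof (intro nn_integral_mono)
  fix x
  obtain B where B: "\<And>y. y \<in> E \<Longrightarrow> norm y \<le> B"
    using compact_imp_bounded[OF assms(1)] by (auto simp: bounded_iff)
  have bdd: "bdd_above ((\<lambda>t. norm (x - t)) ` E)"
    using B by (intro bdd_aboveI2[of _ _ "norm x + B"]) (meson add_left_mono norm_triangle_ineq4 order_trans)
  have "riesz_power CARD('n) \<alpha> (farthest_dist E x) \<le> riesz_power CARD('n) \<alpha> (norm (x - c k))" if "k \<in> {1..m}" for k
  proof (rule riesz_power_antimono[OF _ _ \<alpha>])
    show "norm (x - c k) \<le> farthest_dist E x"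
      unfolding farthest_dist_def using c that by (intro cSUP_upper bdd) auto
  qed simp
  then show "riesz_power CARD('n) \<alpha> (farthest_dist E x) \<le> (MIN k\<in>{1..m}. riesz_power CARD('n) \<alpha> (norm (x - c k)))"
    using \<open>1 \<le> m\<close> by (subst Min_ge_iff) auto
qed

section \<open>Passage to extended reals and conclusion\<close>

lemma ereal_minus_add_le:
  assumes "A + I \<le> S + W" "W < top"
  shows "enn2ereal A - enn2ereal W + enn2ereal I \<le> enn2ereal S"
  using assms
  by (cases A; cases I; cases S; cases W) (auto simp: ennreal_plus[symmetric] top_unique simp del: ennreal_plus)

text \<open>The error 3 \<epsilon> collects 2 \<epsilon> from the infimum of the total potential and
  \<epsilon> from the sum of the infima. An infinite A is trivial because W is finite; otherwise S
  is finite, and so is I unless C = -\<infinity>.\<close>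

lemma ereal_le_minus_add:
  fixes C :: ereal
  assumes "C + enn2ereal I \<le> enn2ereal S" "W \<le> I + ennreal (2 * \<epsilon>)" "S \<le> A + ennreal \<epsilon>" "W < top" "0 < \<epsilon>"
  shows "C \<le> enn2ereal A - enn2ereal W + ereal (3 * \<epsilon>)"
proof (cases A)
  case (real a)
  obtain w where w: "W = ennreal w" "0 \<le> w" using assms(4) by (cases W) auto
  have "S < top" using assms(3) real by (auto simp: less_top[symmetric] top_unique)
  then obtain t where t: "S = ennreal t" "0 \<le> t" by (cases S) auto
  have ta: "t \<le> a + \<epsilon>" using assms(3,5) real t by (simp add: ennreal_plus[symmetric] del: ennreal_plus)
  show ?thesis
  proof (cases C)
    case (real r)
    then obtain i where i: "I = ennreal i" "0 \<le> i" using assms(1) t by (cases I) auto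
    have "w \<le> i + 2 * \<epsilon>" using assms(2,5) w i by (simp add: ennreal_plus[symmetric] del: ennreal_plus)
    moreover have "r + i \<le> t" using assms(1) t i real by simp
    ultimately show ?thesis using ta \<open>A = ennreal a\<close> \<open>0 \<le> a\<close> w real by simp
  qed (use assms(1) t in \<open>auto simp: plus_ereal.simps\<close>)
qed (use assms(4) in \<open>cases W; auto\<close>)

theorem theorem2p3:
  fixes E :: "(real^'n) set" and \<mu> :: "(real^'n) measure" and \<alpha> :: real and m :: nat
  assumes "CARD('n) \<ge> 2" and "0 < \<alpha>" and "\<alpha> \<le> 2"
    and "\<not> (CARD('n) = 2 \<and> \<alpha> = 2)"
    and "compact E"
    and "min_riesz_energy \<alpha> E < \<infinity>"
    and "equilibrium_measure \<alpha> E \<mu>"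
    and "m \<ge> 2"
  shows
    "(\<exists>c \<in> {1..m} \<rightarrow> E. \<forall>c' \<in> {1..m} \<rightarrow> E.
        min_kernel_integral \<alpha> \<mu> m c \<le> min_kernel_integral \<alpha> \<mu> m c') \<and>
     (\<forall>\<nu>. unit_sum_family m \<nu> \<longrightarrow> reverse_triangle \<alpha> E m \<nu> (C_points \<alpha> E \<mu> m)) \<and>
     (\<forall>C. (\<forall>\<nu>. unit_sum_family m \<nu> \<longrightarrow> reverse_triangle \<alpha> E m \<nu> C)
            \<longrightarrow> C \<le> C_points \<alpha> E \<mu> m) \<and>
     (\<forall>\<nu>. unit_sum_family m \<nu> \<longrightarrow> reverse_triangle \<alpha> E m \<nu> (C_farthest \<alpha> E \<mu>))"
proof -
  note E = \<open>compact E\<close> and W = \<open>min_riesz_energy \<alpha> E < \<infinity>\<close> and eq = \<open>equilibrium_measure \<alpha> E \<mu>\<close>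
  note \<mu> = equilibrium_measureD[OF eq]
  \<comment> \<open>For N \<ge> 2 and \<alpha> \<le> 2, excluding N = \<alpha> = 2 amounts to
    \<alpha> < N, which makes the exponent of the kernel negative.\<close>
  have \<alpha>: "\<alpha> < real CARD('n)"
    using assms(1,3,4) by (cases "CARD('n) = 2") auto
  have m1: "1 \<le> m" using \<open>m \<ge> 2\<close> by simp
  obtain p g q mm b where "potential_kernel (\<lambda>x::real^'n. riesz_power DIM(real^'n) \<alpha> (norm x)) p g q mm b"
    using riesz_potential_kernel[where 'a = "real^'n", OF assms(2,3)] \<alpha> by auto
  then interpret riesz_kernel \<alpha> p g q mm b
    using \<alpha> by (simp add: riesz_kernel_def riesz_kernel_axioms_def)
  have E_ne: "E \<noteq> {}" using exists_other_point[OF E eq W] by blast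
  obtain c0 where c0: "c0 \<in> {1..m} \<rightarrow> E"
    "\<And>c'. c' \<in> {1..m} \<rightarrow> E \<Longrightarrow> min_kernel_integral \<alpha> \<mu> m c0 \<le> min_kernel_integral \<alpha> \<mu> m c'"
    using min_kernel_integral_attained[OF E E_ne \<alpha> \<mu>(3) m1] by blast
  have A: "(INF c \<in> {1..m} \<rightarrow> E. min_kernel_integral \<alpha> \<mu> m c) = min_kernel_integral \<alpha> \<mu> m c0"
    using c0 by (intro antisym INF_lower INF_greatest) auto
  have points: "reverse_triangle \<alpha> E m \<nu> (C_points \<alpha> E \<mu> m)" if \<nu>: "unit_sum_family m \<nu>" for \<nu>
  proof -
    \<comment> \<open>Potentials are lower semicontinuous, so each of the m infima is attained on
      the compact set E.\<close>
    have "\<exists>x\<in>E. \<forall>y\<in>E. riesz_potential \<alpha> (\<nu> k) x \<le> riesz_potential \<alpha> (\<nu> k) y" if "k \<in> {1..m}" for k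
      using seq_lsc_attains_inf[OF seq_lsc_pot E E_ne, of "\<nu> k"] unit_sum_familyD[OF \<nu> that] by (simp add: pot_eq)
    then obtain c where c: "\<And>k. k \<in> {1..m} \<Longrightarrow> c k \<in> E"
      "\<And>k y. k \<in> {1..m} \<Longrightarrow> y \<in> E \<Longrightarrow> riesz_potential \<alpha> (\<nu> k) (c k) \<le> riesz_potential \<alpha> (\<nu> k) y"
      by metis
    have "min_kernel_integral \<alpha> \<mu> m c0 + (INF x\<in>E. \<Sum>k=1..m. riesz_potential \<alpha> (\<nu> k) x)
      \<le> min_kernel_integral \<alpha> \<mu> m c + (INF x\<in>E. \<Sum>k=1..m. riesz_potential \<alpha> (\<nu> k) x)"
      using c(1) by (intro add_right_mono c0) auto
    also have "\<dots> \<le> (\<Sum>k=1..m. riesz_potential \<alpha> (\<nu> k) (c k)) + min_riesz_energy \<alpha> E"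
      using c(1) by (intro polarization_inequality[OF E eq W m1 \<nu>]) auto
    also have "\<dots> \<le> (\<Sum>k=1..m. INF x\<in>E. riesz_potential \<alpha> (\<nu> k) x) + min_riesz_energy \<alpha> E"
      using c(2) by (intro add_right_mono sum_mono INF_greatest) auto
    finally show ?thesis
      using W unfolding reverse_triangle_def C_points_def A by (simp add: ereal_minus_add_le)
  qed
  have sharp: "C \<le> C_points \<alpha> E \<mu> m"
    if C: "\<And>\<nu>. unit_sum_family m \<nu> \<Longrightarrow> reverse_triangle \<alpha> E m \<nu> C" for C
  proof (rule ereal_le_epsilon2)
    fix e :: real assume "0 < e"
    \<comment> \<open>The minimiser c0 may have equal first two points. It is replaced by a family
      with distinct ones and no larger integral, to which \<open>near_extremal_family\<close>
      applies.\<close>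
    obtain y where y: "y \<in> E" "y \<noteq> c0 1" using exists_other_point[OF E eq W] by blast
    obtain c where c: "c \<in> {1..m} \<rightarrow> E" "c 1 \<noteq> c 2" "min_kernel_integral \<alpha> \<mu> m c \<le> min_kernel_integral \<alpha> \<mu> m c0"
      using min_kernel_integral_le_distinct[OF \<open>m \<ge> 2\<close> c0(1) y] by blast
    obtain \<nu> where \<nu>: "unit_sum_family m \<nu>"
      "min_riesz_energy \<alpha> E \<le> (INF x\<in>E. \<Sum>k=1..m. riesz_potential \<alpha> (\<nu> k) x) + ennreal (2 * (e / 3))"
      "(\<Sum>k=1..m. INF x\<in>E. riesz_potential \<alpha> (\<nu> k) x) \<le> min_kernel_integral \<alpha> \<mu> m c + ennreal (e / 3)"
      using near_extremal_family[OF E \<alpha> eq W _ \<open>m \<ge> 2\<close> c(1,2), of "e / 3"] \<open>0 < e\<close> by auto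
    have "C + enn2ereal (INF x\<in>E. \<Sum>k=1..m. riesz_potential \<alpha> (\<nu> k) x)
      \<le> enn2ereal (\<Sum>k=1..m. INF x\<in>E. riesz_potential \<alpha> (\<nu> k) x)"
      using C[OF \<nu>(1)] unfolding reverse_triangle_def by simp
    moreover have "(\<Sum>k=1..m. INF x\<in>E. riesz_potential \<alpha> (\<nu> k) x) \<le> min_kernel_integral \<alpha> \<mu> m c0 + ennreal (e / 3)"
      using \<nu>(3) c(3) by (meson add_right_mono order_trans)
    ultimately have "C \<le> enn2ereal (min_kernel_integral \<alpha> \<mu> m c0) - enn2ereal (min_riesz_energy \<alpha> E) + ereal (3 * (e / 3))"
      using W \<open>0 < e\<close> by (intro ereal_le_minus_add[OF _ \<nu>(2)]) auto
    then show "C \<le> C_points \<alpha> E \<mu> m + ereal e"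
      unfolding C_points_def A by simp
  qed
  \<comment> \<open>The kernel at the farthest distance lies below every minimum of kernels, so the
    bound free of m follows from the sharp one.\<close>
  have "C_farthest \<alpha> E \<mu> \<le> C_points \<alpha> E \<mu> m"
    unfolding C_farthest_def C_points_def A
    using farthest_kernel_integral_le[OF E \<alpha> m1 c0(1)] by (intro ereal_minus_mono) (auto simp: less_eq_ennreal.rep_eq)
  then have "reverse_triangle \<alpha> E m \<nu> (C_farthest \<alpha> E \<mu>)" if "unit_sum_family m \<nu>" for \<nu>
    using points[OF that] unfolding reverse_triangle_def by (meson add_right_mono order_trans)
  then show ?thesis using c0 points sharp by blast
qed

end
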